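(* Let $(X,\mathsf d,\mu)=(\mathbb R^n,\mathsf d_e,\mathcal H^{m_1}\llcorner M_1+\dots+\mathcal H^{m_k}\llcorner M_k)$, where $m_1\le\dots\le m_k$ are integers and, for any $1\le j\le k$, $(M_j,g_j)$ is a smooth $m_j$-dimensional Riemannian submanifold of $\mathbb R^n$ without boundary which is a closed subset of $\mathbb R^n$. Write $\mu_j:=\mathcal H^{m_j}\llcorner M_j$. Let $u\in L^1_{\mathrm{loc}}(X,\mu)$ and let $x\in\bigcap_{i=1}^l M_{j_i}$, where $j_1<\dots<j_l$ are exactly the indices $j\in\{1,\dots,k\}$ with $x\in M_j$. Let $1\le t\le l$ be such that $m_{j_1}=\dots=m_{j_t}$ and, if $t<l$, $m_{j_t}<m_{j_{t+1}}$. If $\Delta_{\mu_{j_i}}^{\mathsf d_e}u(x)$ exists for all $i\in\{1,\dots,t\}$ and $$r^{m_{j_i}-m_{j_1}}\big|\Delta_{\mu_{j_i},r}^{\mathsf d_e}u(x)\big|\to0\quad\text{as } r\to0^+\qquad\text{for all } i\in\{t+1,\dots,l\},$$ then $\Delta_\mu^{\mathsf d_e}u(x)$ exists and $$\Delta_\mu^{\mathsf d_e}u(x)=\frac1t\sum_{i=1}^t\Delta_{\mathcal H^{m_{j_i}}\llcorner M_{j_i}}^{\mathsf d_e}u(x).$$ Furthermore, if $u\in C^2(\mathbb R^n)$, then $$\Delta_\mu^{\mathsf d_e}u(x)=\frac{1}{2(m_{j_1}+2)\,t}\sum_{i=1}^t\Delta_{g_{j_i}}u(x).$$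
   Context: $\mathsf d_e$ is the Euclidean distance on $\mathbb R^n$, $B_r(x)$ the corresponding ball of center $x$ and radius $r$, $\mathcal H^m$ the $m$-dimensional Hausdorff measure, and $\mathcal H^m\llcorner M$ its restriction to $M$. A Riemannian submanifold of $\mathbb R^n$ carries the Riemannian metric inherited from the Euclidean metric; $\Delta_g$ is the Laplace–Beltrami operator of $(M,g)$ (with the sign convention giving $\sum_k\partial_{kk}$ in the flat case), and $\Delta_gu$ means $\Delta_g(u|_M)$. For a Borel measure $\nu$, the asymptotic mean value (AMV) quantities are $$\Delta_{\nu,r}^{\mathsf d_e}u(x):=\frac1{r^2}\,\frac{1}{\nu(B_r(x))}\int_{B_r(x)}\big(u(y)-u(x)\big)\,d\nu(y)\quad(r>0),\qquad \Delta_\nu^{\mathsf d_e}u(x):=\lim_{r\to0^+}\Delta_{\nu,r}^{\mathsf d_e}u(x),$$ the latter (the AMV Laplacian) being said to exist at $x$ when the limit exists. Convention: a function $u\in L^1_{\mathrm{loc}}(X,\mu)$ is evaluated pointwise through its representative whose value at $x$ is $\lim_{r\to0^+}\mu(B_r(x))^{-1}\int_{B_r(x)}u\,d\mu$ whenever this limit exists. *)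

theory Defs
  imports "HOL-Analysis.Analysis"
begin

section \<open>Hausdorff measure\<close>

text \<open>
  The weight of a covering set is normalised so that the \<open>m\<close>-dimensional Hausdorff measure
  of \<open>\<real>\<^sup>m\<close> is Lebesgue measure.  The empty set has weight \<open>0\<close> also for
  \<open>m = 0\<close>, whereas points then have weight \<open>0 ^ 0 = 1\<close> (counting measure).
\<close>

definition hausdorff_weight :: "nat \<Rightarrow> 'a::metric_space set \<Rightarrow> ennreal" where
  "hausdorff_weight m C =
     (if C = {} then 0 else ennreal (unit_ball_vol (real m) * (diameter C / 2) ^ m))"

definition hausdorff_covers :: "real \<Rightarrow> 'a::metric_space set \<Rightarrow> (nat \<Rightarrow> 'a set) set" where
  "hausdorff_covers \<delta> A =
     {C. A \<subseteq> (\<Union>i. C i) \<and> (\<forall>i. bounded (C i) \<and> diameter (C i) \<le> \<delta>)}"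

definition hausdorff_content :: "nat \<Rightarrow> real \<Rightarrow> 'a::metric_space set \<Rightarrow> ennreal" where
  "hausdorff_content m \<delta> A = (INF C\<in>hausdorff_covers \<delta> A. \<Sum>i. hausdorff_weight m (C i))"

definition hausdorff_outer :: "nat \<Rightarrow> 'a::metric_space set \<Rightarrow> ennreal" where
  "hausdorff_outer m A = (SUP \<delta>\<in>{0<..}. hausdorff_content m \<delta> A)"

definition hausdorff_measure :: "nat \<Rightarrow> 'a::metric_space measure" where
  "hausdorff_measure m = measure_of UNIV (sets borel) (hausdorff_outer m)"

text \<open>
  \<open>hausdorff_outer\<close> is a metric outer measure, so by Caratheodory's criterion the Borel sets
  are measurable and the value is not the default \<open>0\<close> of \<open>measure_of\<close>.
\<close>

lemma hausdorff_content_mono: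
  "A \<subseteq> B \<Longrightarrow> hausdorff_content m \<delta> A \<le> hausdorff_content m \<delta> B"
  unfolding hausdorff_content_def
  by (rule INF_superset_mono) (auto simp: hausdorff_covers_def)

lemma hausdorff_content_antimono:
  "\<delta> \<le> \<epsilon> \<Longrightarrow> hausdorff_content m \<epsilon> A \<le> hausdorff_content m \<delta> A"
  unfolding hausdorff_content_def
  by (rule INF_superset_mono) (auto simp: hausdorff_covers_def intro: order_trans)

lemma hausdorff_content_le_outer:
  "0 < \<delta> \<Longrightarrow> hausdorff_content m \<delta> A \<le> hausdorff_outer m A"
  unfolding hausdorff_outer_def by (rule SUP_upper) auto

lemma hausdorff_outer_mono: "A \<subseteq> B \<Longrightarrow> hausdorff_outer m A \<le> hausdorff_outer m B"
  unfolding hausdorff_outer_def by (intro SUP_mono' hausdorff_content_mono)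

lemma hausdorff_outer_empty [simp]: "hausdorff_outer m {} = 0"
proof -
  have "hausdorff_content m \<delta> ({} :: 'a set) \<le> 0" if "0 < \<delta>" for \<delta>
    unfolding hausdorff_content_def
    by (rule INF_lower2[of "\<lambda>_. {}"]) (use that in \<open>auto simp: hausdorff_covers_def hausdorff_weight_def\<close>)
  then show ?thesis
    unfolding hausdorff_outer_def by (auto intro!: antisym SUP_least)
qed

lemma hausdorff_content_subadditive:
  "hausdorff_content m \<delta> (\<Union>i. A i) \<le> (\<Sum>i::nat. hausdorff_content m \<delta> (A i))"
proof (rule ennreal_le_epsilon)
  fix e :: real
  assume "0 < e" and fin: "(\<Sum>i. hausdorff_content m \<delta> (A i)) < top"
  then have "hausdorff_content m \<delta> (A i) < hausdorff_content m \<delta> (A i) + e * (1/2) ^ Suc i" for i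
    by (auto simp: less_top dest!: ennreal_suminf_lessD)
  then have "\<exists>C\<in>hausdorff_covers \<delta> (A i).
      (\<Sum>n. hausdorff_weight m (C n)) < hausdorff_content m \<delta> (A i) + e * (1/2) ^ Suc i" for i
    unfolding hausdorff_content_def INF_less_iff[symmetric] by simp
  then obtain C where C: "\<And>i. C i \<in> hausdorff_covers \<delta> (A i)"
    and le: "\<And>i. (\<Sum>n. hausdorff_weight m (C i n)) < hausdorff_content m \<delta> (A i) + e * (1/2) ^ Suc i"
    by metis
  define B where "B k = (case prod_decode k of (i, n) \<Rightarrow> C i n)" for k
  have "B \<in> hausdorff_covers \<delta> (\<Union>i. A i)"
  proof -
    have "y \<in> (\<Union>k. B k)" if y: "y \<in> A i" for y i
    proof -
      obtain n where "y \<in> C i n" using y C[of i] by (auto simp: hausdorff_covers_def)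
      then have "y \<in> B (prod_encode (i, n))" by (simp add: B_def)
      then show ?thesis by blast
    qed
    moreover have "bounded (B k) \<and> diameter (B k) \<le> \<delta>" for k
      using C by (auto simp: hausdorff_covers_def B_def split: prod.split)
    ultimately show ?thesis by (auto simp: hausdorff_covers_def)
  qed
  then have "hausdorff_content m \<delta> (\<Union>i. A i) \<le> (\<Sum>k. hausdorff_weight m (B k))"
    unfolding hausdorff_content_def by (rule INF_lower)
  also have "\<dots> = (\<Sum>k. (\<lambda>(i, n). hausdorff_weight m (C i n)) (prod_decode k))"
    by (intro suminf_cong) (simp add: B_def split: prod.split)
  also have "\<dots> = (\<Sum>i. \<Sum>n. hausdorff_weight m (C i n))"
    by (rule suminf_ennreal_2dimen) simp
  also have "\<dots> \<le> (\<Sum>i. hausdorff_content m \<delta> (A i) + e * (1/2) ^ Suc i)"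
    by (intro suminf_le less_imp_le[OF le]) auto
  also have "\<dots> = (\<Sum>i. hausdorff_content m \<delta> (A i)) + (\<Sum>i. ennreal e * ennreal ((1/2) ^ Suc i))"
    using \<open>0 < e\<close> by (subst suminf_add[symmetric])
      (auto simp del: ennreal_suminf_cmult simp add: ennreal_mult[symmetric])
  also have "\<dots> = (\<Sum>i. hausdorff_content m \<delta> (A i)) + e"
    unfolding ennreal_suminf_cmult
    by (subst suminf_ennreal_eq[OF zero_le_power power_half_series]) auto
  finally show "hausdorff_content m \<delta> (\<Union>i. A i) \<le> (\<Sum>i. hausdorff_content m \<delta> (A i)) + e" .
qed

lemma hausdorff_outer_subadditive:
  "hausdorff_outer m (\<Union>i. A i) \<le> (\<Sum>i::nat. hausdorff_outer m (A i))"
proof -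
  have "hausdorff_content m \<delta> (\<Union>i. A i) \<le> (\<Sum>i. hausdorff_outer m (A i))" if "0 < \<delta>" for \<delta>
    by (rule order_trans[OF hausdorff_content_subadditive])
       (intro suminf_le hausdorff_content_le_outer that, auto)
  then show ?thesis
    unfolding hausdorff_outer_def[of m "\<Union>i. A i"] by (intro SUP_least) auto
qed

lemma outer_measure_space_hausdorff: "outer_measure_space UNIV (hausdorff_outer m)"
  unfolding outer_measure_space_def positive_def increasing_def countably_subadditive_def
  by (auto intro: hausdorff_outer_mono hausdorff_outer_subadditive)

lemma hausdorff_outer_Un_le: "hausdorff_outer m (A \<union> B) \<le> hausdorff_outer m A + hausdorff_outer m B"
proof -
  have "hausdorff_outer m (\<Union>i. binaryset A B i) \<le> (\<Sum>i. hausdorff_outer m (binaryset A B i))"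
    by (rule hausdorff_outer_subadditive)
  then show ?thesis
    by (simp add: UN_binaryset_eq suminf_binaryset_eq)
qed

lemma hausdorff_outer_separated:
  assumes "0 < d" and d: "\<And>a b. a \<in> A \<Longrightarrow> b \<in> B \<Longrightarrow> d \<le> dist a b"
  shows "hausdorff_outer m A + hausdorff_outer m B \<le> hausdorff_outer m (A \<union> B)"
proof -
  have sep: "hausdorff_content m \<delta> A + hausdorff_content m \<delta> B \<le> hausdorff_content m \<delta> (A \<union> B)"
    if \<delta>: "0 < \<delta>" "\<delta> < d" for \<delta>
    unfolding hausdorff_content_def[of m \<delta> "A \<union> B"]
  proof (rule INF_greatest)
    fix C assume C: "C \<in> hausdorff_covers \<delta> (A \<union> B)"
    define P where "P S i = (if C i \<inter> S = {} then {} else C i)" for S i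
    have P: "P S \<in> hausdorff_covers \<delta> S" if S: "S \<subseteq> A \<union> B" for S
    proof -
      have "S \<subseteq> (\<Union>i. P S i)"
      proof
        fix y assume y: "y \<in> S"
        have "y \<in> A \<union> B" using y S by blast
        then obtain i where "y \<in> C i" using C by (auto simp: hausdorff_covers_def)
        then have "y \<in> P S i" using y by (auto simp: P_def)
        then show "y \<in> (\<Union>i. P S i)" by blast
      qed
      then show ?thesis using C \<delta> by (auto simp: hausdorff_covers_def P_def)
    qed
    have "C i \<inter> A = {} \<or> C i \<inter> B = {}" for i
    proof (rule ccontr)
      assume "\<not> ?thesis"
      then obtain a b where ab: "a \<in> C i" "a \<in> A" "b \<in> C i" "b \<in> B" by blast
      then have "dist a b \<le> diameter (C i)"
        using C by (intro diameter_bounded_bound) (auto simp: hausdorff_covers_def)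
      also have "\<dots> \<le> \<delta>" using C by (auto simp: hausdorff_covers_def)
      finally show False using d[of a b] ab \<delta> by simp
    qed
    then have le: "hausdorff_weight m (P A i) + hausdorff_weight m (P B i) \<le> hausdorff_weight m (C i)" for i
      by (metis P_def add.left_neutral add.right_neutral hausdorff_weight_def order_refl zero_le)
    have "hausdorff_content m \<delta> A + hausdorff_content m \<delta> B
        \<le> (\<Sum>i. hausdorff_weight m (P A i)) + (\<Sum>i. hausdorff_weight m (P B i))"
      unfolding hausdorff_content_def by (intro add_mono INF_lower P) auto
    also have "\<dots> = (\<Sum>i. hausdorff_weight m (P A i) + hausdorff_weight m (P B i))"
      by (rule suminf_add) auto
    also have "\<dots> \<le> (\<Sum>i. hausdorff_weight m (C i))"
      by (intro suminf_le le) auto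
    finally show "hausdorff_content m \<delta> A + hausdorff_content m \<delta> B \<le> (\<Sum>i. hausdorff_weight m (C i))" .
  qed
  have small: "hausdorff_outer m S = (SUP \<delta>\<in>{0<..<d}. hausdorff_content m \<delta> S)" for S :: "'a set"
  proof (rule antisym)
    show "hausdorff_outer m S \<le> (SUP \<delta>\<in>{0<..<d}. hausdorff_content m \<delta> S)"
      unfolding hausdorff_outer_def
    proof (rule SUP_least)
      fix \<delta> :: real assume "\<delta> \<in> {0<..}"
      then show "hausdorff_content m \<delta> S \<le> (SUP \<delta>\<in>{0<..<d}. hausdorff_content m \<delta> S)"
        using \<open>0 < d\<close> by (intro SUP_upper2[of "min \<delta> (d/2)"] hausdorff_content_antimono) auto
    qed
  qed (auto simp: hausdorff_outer_def intro!: SUP_subset_mono)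
  have "hausdorff_outer m A + hausdorff_outer m B
      = (SUP \<delta>\<in>{0<..<d}. hausdorff_content m \<delta> A + hausdorff_content m \<delta> B)"
    unfolding small
  proof (rule SUP_add_directed_ennreal[symmetric])
    fix i j assume "i \<in> {0<..<d}" "j \<in> {0<..<d}"
    then show "\<exists>k\<in>{0<..<d}. hausdorff_content m i A + hausdorff_content m j B
        \<le> hausdorff_content m k A + hausdorff_content m k B"
      by (intro bexI[of _ "min i j"] add_mono hausdorff_content_antimono) auto
  qed
  also have "\<dots> \<le> hausdorff_outer m (A \<union> B)"
    unfolding small by (intro SUP_mono) (auto intro: sep)
  finally show ?thesis .
qed

lemma hausdorff_outer_closed_split:
  assumes "closed F"
  shows "hausdorff_outer m (A \<inter> F) + hausdorff_outer m (A - F) \<le> hausdorff_outer m A"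
proof (cases "F = {} \<or> hausdorff_outer m A = top")
  case True
  then show ?thesis by auto
next
  case False
  then have ne: "F \<noteq> {}" and fin: "hausdorff_outer m A < top" by (auto simp: less_top)
  let ?H = "hausdorff_outer m"
  define D where "D n = {y \<in> A. 1 / real (n + 1) \<le> infdist y F}" for n
  define R where "R n = {y \<in> A. 1 / real (n + 2) \<le> infdist y F \<and> infdist y F < 1 / real (n + 1)}" for n
  have lip: "infdist a F - infdist b F \<le> dist a b" for a b
    using infdist_triangle[of a F b] by simp
  have part: "?H (A \<inter> F) + ?H (D n) \<le> ?H A" for n
  proof -
    have "?H (A \<inter> F) + ?H (D n) \<le> ?H ((A \<inter> F) \<union> D n)"
    proof (rule hausdorff_outer_separated)
      fix a b assume "a \<in> A \<inter> F" "b \<in> D n"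
      then show "1 / real (n + 1) \<le> dist a b"
        using lip[of b a] by (simp add: D_def dist_commute)
    qed simp
    also have "\<dots> \<le> ?H A" by (rule hausdorff_outer_mono) (auto simp: D_def)
    finally show ?thesis .
  qed
  have fam: "(\<Sum>i<N. ?H (R (2 * i + c))) \<le> ?H (\<Union>i<N. R (2 * i + c))" for N c
  proof (induction N)
    case (Suc N)
    have "?H (\<Union>i<N. R (2 * i + c)) + ?H (R (2 * N + c)) \<le> ?H ((\<Union>i<N. R (2 * i + c)) \<union> R (2 * N + c))"
    proof (cases "2 * N + c = 0")
      case True
      then show ?thesis by simp
    next
      case False
      let ?k = "real (2 * N + c)"
      have k: "?k > 0" using False by (simp only: of_nat_0_less_iff neq0_conv)
      show ?thesis
      proof (rule hausdorff_outer_separated)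
        show "0 < 1 / ?k - 1 / (?k + 1)" using k by (simp add: divide_strict_left_mono del: of_nat_add of_nat_mult)
        fix a b assume "a \<in> (\<Union>i<N. R (2 * i + c))" "b \<in> R (2 * N + c)"
        then obtain i where i: "i < N" "a \<in> R (2 * i + c)" and b: "infdist b F < 1 / (?k + 1)"
          by (auto simp: R_def add_ac)
        have "2 * i + c + 2 \<le> 2 * N + c" using i by simp
        then have "real (2 * i + c + 2) \<le> ?k" by (simp only: of_nat_le_iff)
        then have "1 / ?k \<le> 1 / real (2 * i + c + 2)" by (intro divide_left_mono) (use k in auto)
        also have "\<dots> \<le> infdist a F" using i by (simp add: R_def)
        finally show "1 / ?k - 1 / (?k + 1) \<le> dist a b" using b lip[of a b] by simp
      qed
    qed
    then show ?case using Suc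
      by (simp add: lessThan_Suc Un_commute add.commute) (meson add_left_mono order_trans)
  qed simp
  have fam': "(\<Sum>i. ?H (R (2 * i + c))) \<le> ?H A" for c
    unfolding suminf_eq_SUP
    by (intro SUP_least order_trans[OF fam] hausdorff_outer_mono) (auto simp: R_def)
  have sum_R: "(\<Sum>i<2 * N. ?H (R i)) = (\<Sum>i<N. ?H (R (2 * i + 0))) + (\<Sum>i<N. ?H (R (2 * i + 1)))" for N
    by (induction N) (simp_all add: algebra_simps)
  have "(\<Sum>i. ?H (R i)) \<le> ?H A + ?H A"
    unfolding suminf_eq_SUP
  proof (rule SUP_least)
    fix N
    have "(\<Sum>i<N. ?H (R i)) \<le> (\<Sum>i<2 * N. ?H (R i))" by (rule sum_mono2) auto
    also have "\<dots> \<le> (\<Sum>i. ?H (R (2 * i + 0))) + (\<Sum>i. ?H (R (2 * i + 1)))"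
      unfolding sum_R by (intro add_mono sum_le_suminf) auto
    also have "\<dots> \<le> ?H A + ?H A" by (intro add_mono fam')
    finally show "(\<Sum>i<N. ?H (R i)) \<le> ?H A + ?H A" .
  qed
  then have R_fin: "(\<Sum>i. ?H (R i)) < top" 
    using fin by (auto simp: top_unique less_top[symmetric])
  define q where "q i = enn2real (?H (R i))" for i
  have q: "?H (R i) = ennreal (q i)" for i
    using ennreal_suminf_lessD[OF R_fin, of i] by (simp add: q_def)
  have q_nonneg: "0 \<le> q i" for i by (simp add: q_def)
  have "summable q"
    using R_fin q_nonneg unfolding q by (intro summable_suminf_not_top) auto
  then have "(\<lambda>N. suminf q - (\<Sum>i<N. q i)) \<longlonglongrightarrow> suminf q - suminf q"
    by (intro tendsto_intros summable_LIMSEQ)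
  then have "(\<lambda>N. ennreal (suminf q - (\<Sum>i<N. q i))) \<longlonglongrightarrow> ennreal 0"
    by (intro tendsto_ennrealI) simp
  moreover have "(\<Sum>i. ?H (R (i + N))) = ennreal (suminf q - (\<Sum>i<N. q i))" for N
    unfolding q suminf_minus_initial_segment[OF \<open>summable q\<close>, symmetric]
    using \<open>summable q\<close> q_nonneg by (intro suminf_ennreal2) auto
  ultimately have tail: "(\<lambda>N. \<Sum>i. ?H (R (i + N))) \<longlonglongrightarrow> 0"
    by simp
  have "?H (A \<inter> F) + ?H (A - F) \<le> ?H A + (\<Sum>i. ?H (R (i + N)))" for N
  proof -
    have "A - F \<subseteq> D N \<union> (\<Union>i. R (i + N))"
    proof
      fix y assume y: "y \<in> A - F"
      then have pos: "0 < infdist y F"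
        using infdist_pos_not_in_closed[OF assms ne] by auto
      show "y \<in> D N \<union> (\<Union>i. R (i + N))"
      proof (cases "1 / real (N + 1) \<le> infdist y F")
        case True
        then show ?thesis using y by (auto simp: D_def)
      next
        case False
        define n where "n = (LEAST n. 1 / real (n + 1) \<le> infdist y F)"
        have ex: "\<exists>n. 1 / real (n + 1) \<le> infdist y F"
          using reals_Archimedean[OF pos] by (auto simp: inverse_eq_divide intro: less_imp_le)
        then have n: "1 / real (n + 1) \<le> infdist y F" unfolding n_def by (rule LeastI_ex)
        have "N < n"
        proof (rule ccontr)
          assume "\<not> N < n"
          then have "1 / real (N + 1) \<le> 1 / real (n + 1)" by (simp add: frac_le)
          then show False using n False by simp
        qed
        then obtain i where i: "n = Suc (i + N)" using less_iff_Suc_add by (metis add.commute)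
        have "\<not> 1 / real (i + N + 1) \<le> infdist y F"
        proof (rule not_less_Least[of "i + N" "\<lambda>n. 1 / real (n + 1) \<le> infdist y F"])
          show "i + N < (LEAST n. 1 / real (n + 1) \<le> infdist y F)"
            unfolding n_def[symmetric] using i by simp
        qed
        then have "y \<in> R (i + N)" using n i y by (auto simp: R_def add_ac)
        then show ?thesis by blast
      qed
    qed
    then have "?H (A - F) \<le> ?H (D N \<union> (\<Union>i. R (i + N)))" by (rule hausdorff_outer_mono)
    also have "\<dots> \<le> ?H (D N) + ?H (\<Union>i. R (i + N))" by (rule hausdorff_outer_Un_le)
    also have "\<dots> \<le> ?H (D N) + (\<Sum>i. ?H (R (i + N)))"
      by (intro add_left_mono hausdorff_outer_subadditive)
    finally have "?H (A \<inter> F) + ?H (A - F) \<le> (?H (A \<inter> F) + ?H (D N)) + (\<Sum>i. ?H (R (i + N)))"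
      by (simp add: add.assoc add_left_mono)
    also have "\<dots> \<le> ?H A + (\<Sum>i. ?H (R (i + N)))" by (intro add_right_mono part)
    finally show ?thesis .
  qed
  moreover have "(\<lambda>N. ?H A + (\<Sum>i. ?H (R (i + N)))) \<longlonglongrightarrow> ?H A + 0"
    by (intro tendsto_add tendsto_const tail)
  ultimately show ?thesis
    using LIMSEQ_le_const by fastforce
qed

theorem measure_space_hausdorff:
  "measure_space UNIV (sets borel) (hausdorff_outer m :: 'a::metric_space set \<Rightarrow> ennreal)"
proof -
  interpret sigma_algebra UNIV "UNIV :: 'a set set"
    using sigma_algebra_Pow[of "UNIV :: 'a set"] by simp
  let ?L = "lambda_system UNIV UNIV (hausdorff_outer m) :: 'a set set"
  have L: "measure_space UNIV ?L (hausdorff_outer m)"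
    by (rule caratheodory_lemma[OF outer_measure_space_hausdorff])
  have "F \<in> ?L" if "closed F" for F
  proof -
    have "hausdorff_outer m (F \<inter> A) + hausdorff_outer m ((UNIV - F) \<inter> A) = hausdorff_outer m A" for A
    proof (rule antisym)
      have eq: "F \<inter> A = A \<inter> F" "(UNIV - F) \<inter> A = A - F" by auto
      show "hausdorff_outer m (F \<inter> A) + hausdorff_outer m ((UNIV - F) \<inter> A) \<le> hausdorff_outer m A"
        unfolding eq by (rule hausdorff_outer_closed_split[OF that])
      have "A = (F \<inter> A) \<union> ((UNIV - F) \<inter> A)" by auto
      then show "hausdorff_outer m A \<le> hausdorff_outer m (F \<inter> A) + hausdorff_outer m ((UNIV - F) \<inter> A)"
        by (metis hausdorff_outer_Un_le)
    qed
    then show ?thesis by (simp add: lambda_system_def)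
  qed
  then have "sigma_sets UNIV (Collect closed) \<subseteq> ?L"
    using L by (intro sigma_algebra.sigma_sets_subset) (auto simp: measure_space_def)
  then have "sets borel \<subseteq> ?L"
    by (simp add: borel_eq_closed)
  then show ?thesis
    using L sets.sigma_algebra_axioms[of "borel :: 'a measure"] by (auto intro: measure_down)
qed

lemma space_hausdorff_measure [simp]: "space (hausdorff_measure m) = UNIV"
  and sets_hausdorff_measure [simp, measurable_cong]: "sets (hausdorff_measure m) = sets borel"
  unfolding hausdorff_measure_def
  by (simp_all add: sets.sigma_sets_eq[of borel, simplified])

lemma emeasure_hausdorff_measure:
  "A \<in> sets borel \<Longrightarrow> emeasure (hausdorff_measure m) A = hausdorff_outer m A"
  unfolding hausdorff_measure_def
  by (rule emeasure_measure_of_sigma) (use measure_space_hausdorff[of m] in \<open>auto simp: measure_space_def\<close>)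

definition hausdorff_on :: "nat \<Rightarrow> 'a::metric_space set \<Rightarrow> 'a measure" where
  "hausdorff_on m M = density (hausdorff_measure m) (indicator M)"

definition sum_borel_measure :: "'i set \<Rightarrow> ('i \<Rightarrow> 'a::topological_space measure) \<Rightarrow> 'a measure" where
  "sum_borel_measure I N = measure_of UNIV (sets borel) (\<lambda>A. \<Sum>i\<in>I. emeasure (N i) A)"

lemma sets_hausdorff_on [simp, measurable_cong]: "sets (hausdorff_on m M) = sets borel"
  by (simp add: hausdorff_on_def)

lemma emeasure_hausdorff_on:
  "M \<in> sets borel \<Longrightarrow> A \<in> sets borel \<Longrightarrow> emeasure (hausdorff_on m M) A = hausdorff_outer m (M \<inter> A)"
  by (simp add: hausdorff_on_def emeasure_density nn_integral_indicator
      indicator_inter_arith[symmetric] emeasure_hausdorff_measure)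

lemma emeasure_sum_borel_measure:
  assumes "\<And>i. i \<in> I \<Longrightarrow> sets (N i) = sets borel" and A: "A \<in> sets borel"
  shows "emeasure (sum_borel_measure I N) A = (\<Sum>i\<in>I. emeasure (N i) A)"
  using sum_borel_measure_def
proof (rule emeasure_measure_of)
  show "countably_additive (sets (sum_borel_measure I N)) (\<lambda>A. \<Sum>i\<in>I. emeasure (N i) A)"
    by (auto simp: countably_additive_def suminf_sum suminf_emeasure assms
        sum_borel_measure_def sets.sigma_sets_eq[of borel, simplified] intro!: sum.cong)
qed (auto simp: positive_def A sum_borel_measure_def sets.sigma_sets_eq[of borel, simplified])


section \<open>Functions of class \<open>C\<^sup>k\<close> and embedded submanifolds\<close>

text \<open>Meant for open \<open>U\<close>, where the derivative \<open>f'\<close> is unique.\<close>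

primrec Ck_on :: "nat \<Rightarrow> (real^'n) set \<Rightarrow> (real^'n \<Rightarrow> 'b::real_normed_vector) \<Rightarrow> bool" where
  "Ck_on 0 U f \<longleftrightarrow> continuous_on U f"
| "Ck_on (Suc k) U f \<longleftrightarrow>
     (\<exists>f'. (\<forall>x\<in>U. (f has_derivative f' x) (at x)) \<and> (\<forall>v. Ck_on k U (\<lambda>x. f' x v)))"

definition smooth_on :: "(real^'n) set \<Rightarrow> (real^'n \<Rightarrow> 'b::real_normed_vector) \<Rightarrow> bool" where
  "smooth_on U f \<longleftrightarrow> (\<forall>k. Ck_on k U f)"

text \<open>
  A slice chart around \<open>x\<close>: the diffeomorphism \<open>\<Phi> : U \<rightarrow> V\<close>, with inverse \<open>\<Psi>\<close>,
  straightens \<open>M\<close> to the \<open>m\<close>-dimensional coordinate subspace spanned by the axes in \<open>S\<close>.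
  The restriction of \<open>\<Psi>\<close> to that subspace is a local parametrisation of \<open>M\<close>
  with coordinates \<open>(y $ i)\<close>, \<open>i \<in> S\<close>.
\<close>

definition slice_chart ::
  "nat \<Rightarrow> (real^'n) set \<Rightarrow> real^'n \<Rightarrow> (real^'n) set \<Rightarrow> (real^'n) set \<Rightarrow>
   (real^'n \<Rightarrow> real^'n) \<Rightarrow> (real^'n \<Rightarrow> real^'n) \<Rightarrow> 'n set \<Rightarrow> bool" where
  "slice_chart m M x U V \<Phi> \<Psi> S \<longleftrightarrow>
     open U \<and> open V \<and> x \<in> U \<and> homeomorphism U V \<Phi> \<Psi> \<and> smooth_on U \<Phi> \<and> smooth_on V \<Psi> \<and>
     card S = m \<and> \<Phi> ` (M \<inter> U) = {y \<in> V. \<forall>i. i \<notin> S \<longrightarrow> y $ i = 0}"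

definition smooth_submanifold :: "nat \<Rightarrow> (real^'n) set \<Rightarrow> bool" where
  "smooth_submanifold m M \<longleftrightarrow> (\<forall>x\<in>M. \<exists>U V \<Phi> \<Psi> S. slice_chart m M x U V \<Phi> \<Psi> S)"


section \<open>The Laplace--Beltrami operator of the induced metric\<close>

definition partial_deriv :: "'n \<Rightarrow> (real^'n \<Rightarrow> 'b::real_normed_vector) \<Rightarrow> real^'n \<Rightarrow> 'b" where
  "partial_deriv i f y = vector_derivative (\<lambda>s. f (y + s *\<^sub>R axis i 1)) (at 0)"

text \<open>
  The Gram matrix \<open>g\<^sub>i\<^sub>j = \<partial>\<^sub>i\<Psi> \<bullet> \<partial>\<^sub>j\<Psi>\<close> (\<open>i, j \<in> S\<close>) of the induced metric is padded by an
  identity block outside \<open>S\<close>.  This changes neither its determinant nor the \<open>S \<times> S\<close> block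
  \<open>g\<^sup>i\<^sup>j\<close> of its inverse.
\<close>

definition induced_metric :: "(real^'n \<Rightarrow> real^'n) \<Rightarrow> 'n set \<Rightarrow> real^'n \<Rightarrow> real^'n^'n" where
  "induced_metric \<Psi> S y =
     (\<chi> i j. if i \<in> S \<and> j \<in> S then partial_deriv i \<Psi> y \<bullet> partial_deriv j \<Psi> y
            else if i = j then 1 else 0)"

definition laplace_in_chart ::
  "(real^'n \<Rightarrow> real^'n) \<Rightarrow> 'n set \<Rightarrow> (real^'n \<Rightarrow> real) \<Rightarrow> real^'n \<Rightarrow> real" where
  "laplace_in_chart \<Psi> S f y =
     1 / sqrt (det (induced_metric \<Psi> S y)) *
     (\<Sum>i\<in>S. \<Sum>j\<in>S. partial_deriv i
        (\<lambda>z. sqrt (det (induced_metric \<Psi> S z)) * matrix_inv (induced_metric \<Psi> S z) $ i $ j *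
             partial_deriv j f z) y)"

text \<open>For \<open>u\<close> of class \<open>C\<^sup>2\<close> the value at \<open>x \<in> M\<close> does not depend on the chart around \<open>x\<close>.\<close>

definition laplace_beltrami :: "nat \<Rightarrow> (real^'n) set \<Rightarrow> (real^'n \<Rightarrow> real) \<Rightarrow> real^'n \<Rightarrow> real" where
  "laplace_beltrami m M u x =
     (SOME L. \<exists>U V \<Phi> \<Psi> S. slice_chart m M x U V \<Phi> \<Psi> S \<and>
        L = laplace_in_chart \<Psi> S (u \<circ> \<Psi>) (\<Phi> x))"


section \<open>The asymptotic mean value Laplacian\<close>

definition amv_laplacian_r ::
  "'a::metric_space measure \<Rightarrow> real \<Rightarrow> ('a \<Rightarrow> real) \<Rightarrow> 'a \<Rightarrow> real" where
  "amv_laplacian_r \<nu> r u x =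
     1 / r\<^sup>2 * (1 / measure \<nu> (ball x r)) * (LINT y:ball x r|\<nu>. u y - u x)"

definition amv_laplacian_exists :: "'a::metric_space measure \<Rightarrow> ('a \<Rightarrow> real) \<Rightarrow> 'a \<Rightarrow> bool" where
  "amv_laplacian_exists \<nu> u x \<longleftrightarrow> (\<exists>L. ((\<lambda>r. amv_laplacian_r \<nu> r u x) \<longlongrightarrow> L) (at_right 0))"

definition amv_laplacian :: "'a::metric_space measure \<Rightarrow> ('a \<Rightarrow> real) \<Rightarrow> 'a \<Rightarrow> real" where
  "amv_laplacian \<nu> u x = Lim (at_right 0) (\<lambda>r. amv_laplacian_r \<nu> r u x)"

definition locally_integrable :: "'a::metric_space measure \<Rightarrow> ('a \<Rightarrow> real) \<Rightarrow> bool" where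
  "locally_integrable \<mu> u \<longleftrightarrow> (\<forall>K. compact K \<longrightarrow> set_integrable \<mu> K u)"

text \<open>
  An element of \<open>L\<^sup>1\<^sub>l\<^sub>o\<^sub>c(\<mu>)\<close> is given by a representative whose value is the limit of its mean
  values wherever that limit exists.  The first premise restricts this to the support of \<open>\<mu>\<close>:
  elsewhere there are no mean values, but the quotient below would evaluate to \<open>0\<close>.
\<close>

definition precise_representative :: "'a::metric_space measure \<Rightarrow> ('a \<Rightarrow> real) \<Rightarrow> bool" where
  "precise_representative \<mu> u \<longleftrightarrow>
     (\<forall>p L. (\<forall>r>0. emeasure \<mu> (ball p r) > 0) \<longrightarrow>
        ((\<lambda>r. 1 / measure \<mu> (ball p r) * (LINT y:ball p r|\<mu>. u y)) \<longlongrightarrow> L) (at_right 0) \<longrightarrow>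
        u p = L)"

end

theory Submission
  imports Defs
begin

text \<open>
  Let \<open>M\<close> be one of the submanifolds, of dimension \<open>m\<close>, let \<open>x \<in> M\<close>, and let \<open>\<pi>\<close> be the orthogonal
  projection onto the tangent space at \<open>x\<close>, written in an orthonormal frame.  Near \<open>x\<close> the
  submanifold is so flat that \<open>\<pi>\<close> barely distorts the Hausdorff measure: the normal part of a chord
  of \<open>M\<close> inside the ball of radius \<open>r\<close> is \<open>O(r)\<close> times the chord, hence by Pythagoras the inverse of
  \<open>\<pi>\<close> on \<open>M\<close> has Lipschitz constant \<open>1 + O(r\<^sup>2)\<close>, and the Hausdorff measure of \<open>M\<close> in the ball agrees
  with that of the flat disc up to a factor \<open>1 + O(r\<^sup>2)\<close>.  Two conclusions follow.

  First, the mass of the ball is \<open>c r\<^sup>m (1 + o(1))\<close> with \<open>c > 0\<close> depending only on \<open>m\<close>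
  (\<open>submanifold_density\<close>).  The mean value quantity of a sum of measures is the average of those of
  the summands, weighted by their masses.  Components of lowest dimension have asymptotically equal
  weights, and the weight of a component of higher dimension is of the order of the factor
  \<open>r ^ (m (J i) - m (J 1))\<close> in the hypothesis, so that it disappears in the limit
  (\<open>amv_sum_tendsto\<close>).

  Secondly, for \<open>u\<close> of class \<open>C\<^sup>2\<close> there is an expansion
  \<open>u y - u x = a \<bullet> v + q(v) + o(\<bar>v\<bar>\<^sup>2)\<close> for \<open>y \<in> M\<close> with \<open>v = \<pi> (y - x)\<close> and a quadratic form \<open>q\<close>
  (\<open>second_order_expansion\<close>).  On the flat disc the linear term integrates to zero by symmetry and
  \<open>q\<close> to \<open>c r\<^bsup>m+2\<^esup> tr q / (m + 2)\<close>.  Passing from the disc to \<open>M\<close> costs a relative error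
  \<open>O(r\<^sup>2)\<close> on an integrand of size \<open>O(r)\<close>, which is negligible against \<open>r\<^bsup>m+2\<^esup>\<close>; hence the mean value
  Laplacian is \<open>tr q / (m + 2)\<close> (\<open>amv_limit\<close>).  Finally \<open>2 tr q\<close> is the Laplace--Beltrami operator:
  in any chart, expanding the divergence form of the operator produces the second derivatives of
  \<open>u\<close> minus the Christoffel correction, which is the same trace computed in the frame
  (\<open>laplace_in_chart_orthonormal\<close>).
\<close>

section \<open>Hausdorff measure of coordinate subspaces\<close>

definition coord_space :: "'n set \<Rightarrow> (real^'n) set" where
  "coord_space S = {y. \<forall>i. i \<notin> S \<longrightarrow> y $ i = 0}"

lemma subspace_coord_space [simp]: "subspace (coord_space S)"
  by (auto simp: subspace_def coord_space_def)

lemma dim_coord_space [simp]: "dim (coord_space S) = card S"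
  using dim_substandard_cart[of S, where 'a=real] by (simp add: coord_space_def dim_vec_eq)

lemma closed_coord_space [simp]: "closed (coord_space S)"
  by (simp add: closed_subspace)

text \<open>
  Applied to a map and to its inverse, this yields every comparison of Hausdorff measures below:
  scaling, invariance under isometries, and the comparison of a submanifold with its tangent space.
\<close>

lemma hausdorff_outer_lipschitz_image:
  fixes f :: "'a::metric_space \<Rightarrow> 'b::metric_space"
  assumes L: "0 < L" and lip: "\<And>x y. x \<in> A \<Longrightarrow> y \<in> A \<Longrightarrow> dist (f x) (f y) \<le> L * dist x y"
  shows "hausdorff_outer m (f ` A) \<le> ennreal (L ^ m) * hausdorff_outer m A"
proof -
  have content: "hausdorff_content m \<delta> (f ` A) \<le> ennreal (L ^ m) * hausdorff_content m (\<delta> / L) A"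
    if "0 < \<delta>" for \<delta>
  proof -
    have "ennreal (1 / L ^ m) * hausdorff_content m \<delta> (f ` A) \<le> hausdorff_content m (\<delta> / L) A"
      unfolding hausdorff_content_def[of m "\<delta> / L"]
    proof (rule INF_greatest)
      fix C assume C: "C \<in> hausdorff_covers (\<delta> / L) A"
      define D where "D i = f ` (C i \<inter> A)" for i
      have bC: "bounded (C i)" and dC: "diameter (C i) \<le> \<delta> / L" for i
        using C by (auto simp: hausdorff_covers_def)
      have dD: "dist a b \<le> L * diameter (C i)" if "a \<in> D i" "b \<in> D i" for a b i
        using that lip diameter_bounded_bound[OF bC] L unfolding D_def
        by (auto intro!: order_trans[OF lip] mult_left_mono)
      have bD: "bounded (D i)" for i
      proof (cases "D i = {}")
        case False
        then obtain a where "a \<in> D i" by auto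
        then show ?thesis using dD[of a i] by (auto simp: bounded_def)
      qed simp
      have diamD: "diameter (D i) \<le> L * diameter (C i)" for i
      proof (cases "D i = {}")
        case True
        then show ?thesis using diameter_ge_0[OF bC] L by simp
      next
        case False
        then show ?thesis unfolding diameter_def[of "D i"]
          by (auto intro!: cSUP_least dD)
      qed
      have "D \<in> hausdorff_covers \<delta> (f ` A)"
      proof -
        have "f ` A \<subseteq> (\<Union>i. D i)"
          using C unfolding hausdorff_covers_def D_def by blast
        moreover have "diameter (D i) \<le> \<delta>" for i
        proof -
          have "L * diameter (C i) \<le> L * (\<delta> / L)" using dC L by (intro mult_left_mono) auto
          then show ?thesis using diamD[of i] L by simp
        qed
        ultimately show ?thesis using bD by (auto simp: hausdorff_covers_def)
      qed
      then have "hausdorff_content m \<delta> (f ` A) \<le> (\<Sum>i. hausdorff_weight m (D i))"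
        unfolding hausdorff_content_def by (rule INF_lower)
      also have "\<dots> \<le> (\<Sum>i. ennreal (L ^ m) * hausdorff_weight m (C i))"
      proof (intro suminf_le)
        fix i
        show "hausdorff_weight m (D i) \<le> ennreal (L ^ m) * hausdorff_weight m (C i)"
        proof (cases "D i = {}")
          case False
          then have "C i \<noteq> {}" by (auto simp: D_def)
          have "(diameter (D i) / 2) ^ m \<le> (L * diameter (C i) / 2) ^ m"
            using diamD[of i] diameter_ge_0[OF bD] by (intro power_mono) auto
          also have "\<dots> = L ^ m * (diameter (C i) / 2) ^ m"
            by (simp add: power_mult_distrib power_divide)
          finally have "unit_ball_vol (real m) * (diameter (D i) / 2) ^ m
              \<le> L ^ m * (unit_ball_vol (real m) * (diameter (C i) / 2) ^ m)"
            by (metis mult.left_commute mult_left_mono of_nat_0_le_iff unit_ball_vol_nonneg)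
          then show ?thesis using False \<open>C i \<noteq> {}\<close> L diameter_ge_0[OF bC]
            by (auto simp: hausdorff_weight_def ennreal_mult[symmetric] intro!: ennreal_leI)
        qed (simp add: hausdorff_weight_def)
      qed auto
      also have "\<dots> = ennreal (L ^ m) * (\<Sum>i. hausdorff_weight m (C i))" by simp
      finally have "ennreal (1 / L ^ m) * hausdorff_content m \<delta> (f ` A)
          \<le> ennreal (1 / L ^ m) * (ennreal (L ^ m) * (\<Sum>i. hausdorff_weight m (C i)))"
        by (intro mult_left_mono) auto
      also have "\<dots> = (\<Sum>i. hausdorff_weight m (C i))"
        using L by (simp add: mult.assoc[symmetric] ennreal_mult[symmetric])
      finally show "ennreal (1 / L ^ m) * hausdorff_content m \<delta> (f ` A) \<le> (\<Sum>i. hausdorff_weight m (C i))" .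
    qed
    then have "ennreal (L ^ m) * (ennreal (1 / L ^ m) * hausdorff_content m \<delta> (f ` A))
        \<le> ennreal (L ^ m) * hausdorff_content m (\<delta> / L) A"
      by (intro mult_left_mono) auto
    then show ?thesis
      using L by (simp add: mult.assoc[symmetric] ennreal_mult[symmetric])
  qed
  show ?thesis
    unfolding hausdorff_outer_def[of m "f ` A"]
  proof (rule SUP_least)
    fix \<delta> :: real assume "\<delta> \<in> {0<..}"
    then have "hausdorff_content m \<delta> (f ` A) \<le> ennreal (L ^ m) * hausdorff_content m (\<delta> / L) A"
      by (intro content) auto
    also have "\<dots> \<le> ennreal (L ^ m) * hausdorff_outer m A"
      using \<open>\<delta> \<in> {0<..}\<close> L by (intro mult_left_mono hausdorff_content_le_outer) auto
    finally show "hausdorff_content m \<delta> (f ` A) \<le> ennreal (L ^ m) * hausdorff_outer m A" .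
  qed
qed

lemma hausdorff_content_le_finite_cover:
  assumes "finite I" "0 \<le> \<delta>" "A \<subseteq> (\<Union>i\<in>I. C i)"
    and C: "\<And>i. i \<in> I \<Longrightarrow> bounded (C i) \<and> diameter (C i) \<le> \<delta>"
  shows "hausdorff_content m \<delta> A \<le> (\<Sum>i\<in>I. hausdorff_weight m (C i))"
proof -
  obtain h where h: "bij_betw h {0..<card I} I"
    using ex_bij_betw_nat_finite[OF \<open>finite I\<close>] by blast
  define D where "D n = (if n < card I then C (h n) else {})" for n
  have hI: "h n \<in> I" if "n < card I" for n using h that by (auto simp: bij_betw_def)
  have "D \<in> hausdorff_covers \<delta> A"
  proof -
    have "y \<in> (\<Union>n. D n)" if "y \<in> A" for y
    proof -
      obtain i where "i \<in> I" "y \<in> C i" using \<open>y \<in> A\<close> assms(3) by auto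
      moreover obtain n where "n < card I" "h n = i"
        using \<open>i \<in> I\<close> h unfolding bij_betw_def by (metis atLeastLessThan_iff imageE)
      ultimately show ?thesis by (auto simp: D_def intro!: exI[of _ n])
    qed
    then show ?thesis using C hI \<open>0 \<le> \<delta>\<close> by (auto simp: hausdorff_covers_def D_def)
  qed
  then have "hausdorff_content m \<delta> A \<le> (\<Sum>n. hausdorff_weight m (D n))"
    unfolding hausdorff_content_def by (rule INF_lower)
  also have "\<dots> = (\<Sum>n\<in>{0..<card I}. hausdorff_weight m (D n))"
    by (rule suminf_finite) (auto simp: D_def hausdorff_weight_def)
  also have "\<dots> = (\<Sum>n\<in>{0..<card I}. hausdorff_weight m (C (h n)))"
    by (rule sum.cong) (auto simp: D_def)
  also have "\<dots> = (\<Sum>i\<in>I. hausdorff_weight m (C i))"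
    by (rule sum.reindex_bij_betw[OF h])
  finally show ?thesis .
qed

text \<open>
  The disc is covered by a grid with \<open>N\<close> cells per axis.  There are \<open>N ^ card S\<close> cells, and their
  diameters are at most a constant divided by \<open>N\<close>, so the total weight is bounded independently of
  \<open>N\<close>.
\<close>

lemma hausdorff_outer_coord_disc_finite:
  "hausdorff_outer (card S) (coord_space S \<inter> ball (0 :: real^'n) 1) < \<infinity>"
proof -
  define m where "m = card S"
  let ?n = "real CARD('n)"
  let ?A = "coord_space S \<inter> ball (0 :: real^'n) 1"
  have "hausdorff_content m \<delta> ?A \<le> ennreal (unit_ball_vol (real m) * ?n ^ m)" if \<delta>: "0 < \<delta>" for \<delta>
  proof -
    obtain N :: nat where N: "2 * ?n / \<delta> < real N" using reals_Archimedean2 by blast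
    have "0 < 2 * ?n / \<delta>" using \<delta> by simp
    then have N0: "0 < real N" using N by linarith
    define I where "I = (S \<rightarrow>\<^sub>E {..<N})"
    define Q :: "('n \<Rightarrow> nat) \<Rightarrow> (real^'n) set" where
      "Q k = {y\<in>coord_space S. \<forall>i\<in>S. 2 * real (k i) / N - 1 \<le> y $ i \<and> y $ i \<le> 2 * (real (k i) + 1) / N - 1}" for k
    have finI: "finite I" unfolding I_def by (intro finite_PiE) auto
    have dQ: "norm (y - z) \<le> 2 * ?n / N" if "y \<in> Q k" "z \<in> Q k" for y z k
    proof -
      have "\<bar>(y - z) $ i\<bar> \<le> 2 / N" for i
      proof (cases "i \<in> S")
        case True
        then have "2 * real (k i) / N - 1 \<le> y $ i" "y $ i \<le> 2 * (real (k i) + 1) / N - 1"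
          "2 * real (k i) / N - 1 \<le> z $ i" "z $ i \<le> 2 * (real (k i) + 1) / N - 1"
          using that by (auto simp: Q_def)
        moreover have "2 * (real (k i) + 1) / N - 2 * real (k i) / N = 2 / N"
          by (simp add: add_divide_distrib distrib_left)
        ultimately show ?thesis by (simp add: abs_le_iff)
      next
        case False
        then show ?thesis using that N0 by (auto simp: Q_def coord_space_def)
      qed
      then have "(\<Sum>i\<in>UNIV. \<bar>(y - z) $ i\<bar>) \<le> (\<Sum>i\<in>(UNIV::'n set). 2 / N)"
        by (intro sum_mono)
      then show ?thesis using norm_le_l1_cart[of "y - z"] by (simp add: field_simps)
    qed
    have bQ: "bounded (Q k)" for k
    proof (cases "Q k = {}")
      case False
      then obtain a where "a \<in> Q k" by auto
      then show ?thesis using dQ[of a k] unfolding bounded_def dist_norm by blast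
    qed simp
    have diamQ: "diameter (Q k) \<le> 2 * ?n / N" for k
      by (rule diameter_le) (use dQ N0 in auto)
    have "2 * ?n / N \<le> \<delta>" using N N0 \<delta> by (simp add: field_simps)
    then have diamQ': "diameter (Q k) \<le> \<delta>" for k using diamQ[of k] by linarith
    have cover: "?A \<subseteq> (\<Union>k\<in>I. Q k)"
    proof
      fix y assume y: "y \<in> ?A"
      then have "norm y < 1" by auto
      then have yi: "-1 < y $ i" "y $ i < 1" for i
        using component_le_norm_cart[of y i] by auto
      define k where "k = (\<lambda>i\<in>S. nat \<lfloor>(y $ i + 1) * N / 2\<rfloor>)"
      have fl: "real (nat \<lfloor>(y $ i + 1) * N / 2\<rfloor>) \<le> (y $ i + 1) * N / 2"
        "(y $ i + 1) * N / 2 < real (nat \<lfloor>(y $ i + 1) * N / 2\<rfloor>) + 1" for i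
        using yi[of i] N0 of_int_floor_le[of "(y $ i + 1) * N / 2"] floor_correct[of "(y $ i + 1) * N / 2"]
        by (auto simp: of_nat_nat simp del: of_int_floor_le)
      have "nat \<lfloor>(y $ i + 1) * N / 2\<rfloor> < N" for i
      proof -
        have "(y $ i + 1) * N / 2 < N" using yi[of i] N0 by (simp add: field_simps)
        then have "real (nat \<lfloor>(y $ i + 1) * N / 2\<rfloor>) < real N" using fl(1)[of i] by linarith
        then show ?thesis by simp
      qed
      then have "k \<in> I" unfolding I_def k_def by auto
      moreover have "y \<in> Q k"
        using y fl N0 by (auto simp: Q_def k_def field_simps less_imp_le)
      ultimately show "y \<in> (\<Union>k\<in>I. Q k)" by blast
    qed
    have "hausdorff_content m \<delta> ?A \<le> (\<Sum>k\<in>I. hausdorff_weight m (Q k))"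
      using bQ diamQ' \<delta> by (intro hausdorff_content_le_finite_cover[OF finI _ cover]) auto
    also have "\<dots> \<le> (\<Sum>k\<in>I. ennreal (unit_ball_vol (real m) * (?n / N) ^ m))"
    proof (rule sum_mono)
      fix k
      have "(diameter (Q k) / 2) ^ m \<le> (?n / N) ^ m"
        using diamQ[of k] diameter_ge_0[OF bQ] by (intro power_mono) (simp_all add: mult.commute)
      then show "hausdorff_weight m (Q k) \<le> ennreal (unit_ball_vol (real m) * (?n / N) ^ m)"
        by (auto simp: hausdorff_weight_def intro!: ennreal_leI mult_left_mono)
    qed
    also have "\<dots> = of_nat (N ^ m) * ennreal (unit_ball_vol (real m) * (?n / N) ^ m)"
      by (simp add: I_def card_PiE m_def)
    also have "\<dots> = ennreal (real (N ^ m) * (unit_ball_vol (real m) * (?n / N) ^ m))"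
      by (subst ennreal_mult') (auto simp: ennreal_of_nat_eq_real_of_nat)
    also have "real (N ^ m) * (unit_ball_vol (real m) * (?n / N) ^ m) = unit_ball_vol (real m) * ?n ^ m"
      using N0 by (simp add: power_divide)
    finally show ?thesis .
  qed
  then have "hausdorff_outer m ?A \<le> ennreal (unit_ball_vol (real m) * ?n ^ m)"
    unfolding hausdorff_outer_def by (intro SUP_least) auto
  then show ?thesis unfolding m_def by (simp add: le_less_trans)
qed

lemma emeasure_lborel_cbox_cart:
  fixes a b :: "real^'n"
  assumes "\<And>i. a $ i \<le> b $ i"
  shows "emeasure lborel (cbox a b) = ennreal (\<Prod>i\<in>UNIV. b $ i - a $ i)"
proof -
  have "cbox a b \<noteq> {}" using assms by (auto simp: interval_ne_empty_cart)
  then have "measure lborel (cbox a b) = (\<Prod>i\<in>UNIV. b $ i - a $ i)" by (rule content_cbox_cart)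
  then show ?thesis
    using emeasure_lborel_cbox_finite[of a b] by (metis emeasure_eq_ennreal_measure infinity_ennreal_def less_irrefl)
qed

text \<open>
  A mass distribution argument with Lebesgue measure on the whole space.  A covering set of diameter
  \<open>d\<close> is replaced by a box of half-width \<open>d\<close> along the axes in \<open>S\<close> and of fixed half-width \<open>c\<close> along
  the others; its volume is a constant times the weight of the set, and the boxes cover a cube.
\<close>

lemma hausdorff_outer_coord_disc_pos:
  "0 < hausdorff_outer (card S) (coord_space S \<inter> ball (0 :: real^'n) 1)"
proof -
  define m where "m = card S"
  let ?A = "coord_space S \<inter> ball (0 :: real^'n) 1"
  \<comment> \<open>small enough for points with coordinates at most \<open>c\<close> to lie in the unit ball\<close>
  define c where "c = 1 / (real CARD('n) + 1)"
  have c: "0 < c" "real CARD('n) * c < 1" by (auto simp: c_def field_simps)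
  define Q :: "(real^'n) set" where "Q = cbox (\<chi> i. - c) (\<chi> i. c)"
  have volQ: "emeasure lborel Q = ennreal ((2 * c) ^ CARD('n))"
    using c unfolding Q_def by (subst emeasure_lborel_cbox_cart) auto
  define K where "K = 4 ^ m * (2 * c) ^ card (- S) / unit_ball_vol (real m)"
  have K: "0 < K" using c by (simp add: K_def)
  have "ennreal ((2 * c) ^ CARD('n)) \<le> ennreal K * hausdorff_content m 1 ?A"
  proof -
    have "ennreal (1 / K) * ennreal ((2 * c) ^ CARD('n)) \<le> hausdorff_content m 1 ?A"
      unfolding hausdorff_content_def
    proof (rule INF_greatest)
      fix C assume C: "C \<in> hausdorff_covers 1 ?A"
      have bC: "bounded (C k)" for k using C by (auto simp: hausdorff_covers_def)
      define p where "p k = (SOME p. p \<in> C k)" for k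
      have p: "p k \<in> C k" if "C k \<noteq> {}" for k unfolding p_def using that some_in_eq by blast
      define d where "d k = diameter (C k)" for k
      have d: "0 \<le> d k" for k using diameter_ge_0[OF bC] by (simp add: d_def)
      define lo where "lo k = (\<chi> i. if i \<in> S then p k $ i - d k else - c)" for k
      define up where "up k = (\<chi> i. if i \<in> S then p k $ i + d k else c)" for k
      define B where "B k = (if C k = {} then {} else cbox (lo k) (up k))" for k
      have cover: "Q \<subseteq> (\<Union>k. B k)"
      proof
        fix y assume "y \<in> Q"
        then have yc: "\<bar>y $ i\<bar> \<le> c" for i
          by (auto simp: Q_def mem_box_cart abs_le_iff minus_le_iff)
        define z :: "real^'n" where "z = (\<chi> i. if i \<in> S then y $ i else 0)"
        have "norm z \<le> (\<Sum>i\<in>UNIV. \<bar>z $ i\<bar>)" by (rule norm_le_l1_cart)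
        also have "\<dots> \<le> (\<Sum>i\<in>(UNIV :: 'n set). c)"
          by (intro sum_mono) (use yc c in \<open>auto simp: z_def\<close>)
        also have "\<dots> < 1" using c by simp
        finally have "z \<in> ?A" by (auto simp: coord_space_def z_def)
        then obtain k where k: "z \<in> C k" using C by (auto simp: hausdorff_covers_def)
        have zp: "\<bar>z $ i - p k $ i\<bar> \<le> d k" for i
        proof -
          have "\<bar>(z - p k) $ i\<bar> \<le> norm (z - p k)" by (rule component_le_norm_cart)
          also have "\<dots> \<le> d k"
            using diameter_bounded_bound[OF bC k p] k unfolding d_def dist_norm by auto
          finally show ?thesis by simp
        qed
        have near: "\<bar>y $ i - p k $ i\<bar> \<le> d k" if "i \<in> S" for i
          using that zp[of i] by (simp add: z_def)
        have "lo k $ i \<le> y $ i \<and> y $ i \<le> up k $ i" for i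
        proof (cases "i \<in> S")
          case True
          then show ?thesis using near[OF True] unfolding lo_def up_def by (simp; linarith)
        next
          case False
          then show ?thesis using yc[of i] unfolding lo_def up_def by (simp; linarith)
        qed
        then have "y \<in> B k"
          using k by (auto simp: B_def mem_box_cart)
        then show "y \<in> (\<Union>k. B k)" by blast
      qed
      have volB: "emeasure lborel (B k) \<le> ennreal K * hausdorff_weight m (C k)" for k
      proof (cases "C k = {}")
        case False
        have le: "lo k $ i \<le> up k $ i" for i using d[of k] c by (auto simp: lo_def up_def)
        have "emeasure lborel (B k) = ennreal (\<Prod>i\<in>UNIV. up k $ i - lo k $ i)"
          using le False by (simp add: B_def emeasure_lborel_cbox_cart)
        also have "(\<Prod>i\<in>UNIV. up k $ i - lo k $ i) = (\<Prod>i\<in>UNIV. if i \<in> S then 2 * d k else 2 * c)"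
          by (rule prod.cong) (auto simp: lo_def up_def)
        also have "\<dots> = (2 * d k) ^ m * (2 * c) ^ card (- S)"
          by (subst prod.If_cases) (auto simp: m_def)
        also have "\<dots> = K * (unit_ball_vol (real m) * (d k / 2) ^ m)"
          using less_imp_neq[OF unit_ball_vol_pos[OF of_nat_0_le_iff, of m]]
          by (simp add: K_def power_divide power_mult_distrib field_simps)
             (simp add: power_mult_distrib[symmetric])
        also have "ennreal \<dots> = ennreal K * hausdorff_weight m (C k)"
          using False K d[of k] by (simp add: hausdorff_weight_def ennreal_mult d_def)
        finally show ?thesis by simp
      qed (simp add: B_def)
      have "emeasure lborel Q \<le> emeasure lborel (\<Union>k. B k)"
        using cover by (intro emeasure_mono) (auto simp: B_def)
      also have "\<dots> \<le> (\<Sum>k. emeasure lborel (B k))"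
        by (intro emeasure_subadditive_countably) (auto simp: B_def)
      also have "\<dots> \<le> (\<Sum>k. ennreal K * hausdorff_weight m (C k))"
        by (intro suminf_le volB) auto
      also have "\<dots> = ennreal K * (\<Sum>k. hausdorff_weight m (C k))" by simp
      finally have "ennreal (1 / K) * ennreal ((2 * c) ^ CARD('n))
          \<le> ennreal (1 / K) * (ennreal K * (\<Sum>k. hausdorff_weight m (C k)))"
        unfolding volQ by (intro mult_left_mono) auto
      also have "\<dots> = (\<Sum>k. hausdorff_weight m (C k))"
        using K by (simp add: mult.assoc[symmetric] ennreal_mult[symmetric])
      finally show "ennreal (1 / K) * ennreal ((2 * c) ^ CARD('n)) \<le> (\<Sum>k. hausdorff_weight m (C k))" .
    qed
    then have "ennreal K * (ennreal (1 / K) * ennreal ((2 * c) ^ CARD('n))) \<le> ennreal K * hausdorff_content m 1 ?A"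
      by (intro mult_left_mono) auto
    then show ?thesis using K by (simp add: mult.assoc[symmetric] ennreal_mult[symmetric])
  qed
  moreover have "0 < ennreal ((2 * c) ^ CARD('n))" using c by simp
  ultimately have "hausdorff_content m 1 ?A \<noteq> 0" by (auto simp: zero_less_iff_neq_zero)
  then have "0 < hausdorff_content m 1 ?A" by (simp add: zero_less_iff_neq_zero)
  also have "\<dots> \<le> hausdorff_outer m ?A" by (rule hausdorff_content_le_outer) simp
  finally show ?thesis by (simp add: m_def)
qed

text \<open>
  The value is the volume of the unit ball in dimension \<open>card S\<close>; it is kept as an abstract positive
  constant because it cancels in all mean values.
\<close>

definition disc_vol :: "'n::finite set \<Rightarrow> real" where
  "disc_vol S = enn2real (hausdorff_outer (card S) (coord_space S \<inter> ball 0 1))"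

lemma disc_vol_pos: "0 < disc_vol S"
  using hausdorff_outer_coord_disc_pos[of S] hausdorff_outer_coord_disc_finite[of S]
  by (simp add: disc_vol_def enn2real_positive_iff)

lemma hausdorff_outer_scaled:
  fixes A :: "'a::real_normed_vector set"
  assumes "0 < r"
  shows "hausdorff_outer m ((\<lambda>y. r *\<^sub>R y) ` A) = ennreal (r ^ m) * hausdorff_outer m A"
proof (rule antisym)
  show "hausdorff_outer m ((\<lambda>y. r *\<^sub>R y) ` A) \<le> ennreal (r ^ m) * hausdorff_outer m A"
    using assms by (intro hausdorff_outer_lipschitz_image) (auto simp: dist_norm scaleR_diff_right[symmetric])
  have "(\<lambda>y. (1 / r) *\<^sub>R y) ` (\<lambda>y. r *\<^sub>R y) ` A = A"
    using assms by (auto simp: image_image)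
  then have "hausdorff_outer m A \<le> ennreal ((1 / r) ^ m) * hausdorff_outer m ((\<lambda>y. r *\<^sub>R y) ` A)"
    using hausdorff_outer_lipschitz_image[of "1 / r" "(\<lambda>y. r *\<^sub>R y) ` A" "\<lambda>y. (1 / r) *\<^sub>R y" m] assms
    by (auto simp: dist_norm scaleR_diff_right[symmetric])
  then have "ennreal (r ^ m) * hausdorff_outer m A
      \<le> ennreal (r ^ m) * (ennreal ((1 / r) ^ m) * hausdorff_outer m ((\<lambda>y. r *\<^sub>R y) ` A))"
    by (intro mult_left_mono) auto
  also have "\<dots> = hausdorff_outer m ((\<lambda>y. r *\<^sub>R y) ` A)"
    using assms by (simp add: mult.assoc[symmetric] ennreal_mult[symmetric] power_mult_distrib[symmetric])
  finally show "ennreal (r ^ m) * hausdorff_outer m A \<le> hausdorff_outer m ((\<lambda>y. r *\<^sub>R y) ` A)" .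
qed

lemma hausdorff_outer_coord_disc:
  assumes "0 < r"
  shows "hausdorff_outer (card S) (coord_space S \<inter> ball (0 :: real^'n) r) = ennreal (r ^ card S * disc_vol S)"
proof -
  have "coord_space S \<inter> ball (0 :: real^'n) r = (\<lambda>y. r *\<^sub>R y) ` (coord_space S \<inter> ball 0 1)"
  proof (intro set_eqI iffI)
    fix y :: "real^'n" assume "y \<in> coord_space S \<inter> ball 0 r"
    then show "y \<in> (\<lambda>y. r *\<^sub>R y) ` (coord_space S \<inter> ball 0 1)"
      using assms by (intro image_eqI[of _ _ "(1 / r) *\<^sub>R y"]) (auto simp: coord_space_def)
  qed (use assms in \<open>auto simp: coord_space_def\<close>)
  moreover have "hausdorff_outer (card S) (coord_space S \<inter> ball (0 :: real^'n) 1) = ennreal (disc_vol S)"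
    using hausdorff_outer_coord_disc_finite[of S] by (simp add: disc_vol_def)
  ultimately show ?thesis
    using assms disc_vol_pos[of S]
    by (simp add: hausdorff_outer_scaled ennreal_mult less_imp_le)
qed

text \<open>
  Charts of different submanifolds through one point may straighten them to different coordinate
  subspaces.  This makes their densities comparable.
\<close>

lemma disc_vol_cong_card:
  fixes S S' :: "'n::finite set"
  assumes "card S = card S'"
  shows "disc_vol S = disc_vol S'"
proof -
  have le: "hausdorff_outer (card S) (coord_space S' \<inter> ball (0 :: real^'n) 1)
      \<le> hausdorff_outer (card S) (coord_space S \<inter> ball (0 :: real^'n) 1)"
    if "card S = card S'" for S S' :: "'n set"
  proof -
    have "dim (coord_space S) = dim (coord_space S')" using that by simp
    then obtain f g where f: "linear f" "f ` coord_space S = coord_space S'"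
      "\<And>x. x \<in> coord_space S \<Longrightarrow> norm (f x) = norm x"
      using isometries_subspaces[OF subspace_coord_space subspace_coord_space] by metis
    have sub: "coord_space S' \<inter> ball 0 1 \<subseteq> f ` (coord_space S \<inter> ball 0 1)"
    proof
      fix y assume y: "y \<in> coord_space S' \<inter> ball 0 1"
      then obtain x where "x \<in> coord_space S" "y = f x" using f(2) by (metis IntD1 imageE)
      then show "y \<in> f ` (coord_space S \<inter> ball 0 1)" using y f(3) by auto
    qed
    have "hausdorff_outer (card S) (coord_space S' \<inter> ball (0 :: real^'n) 1)
        \<le> hausdorff_outer (card S) (f ` (coord_space S \<inter> ball 0 1))"
      by (rule hausdorff_outer_mono[OF sub])
    also have "\<dots> \<le> ennreal (1 ^ card S) * hausdorff_outer (card S) (coord_space S \<inter> ball 0 1)"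
    proof (rule hausdorff_outer_lipschitz_image)
      fix a b :: "real^'n" assume "a \<in> coord_space S \<inter> ball 0 1" "b \<in> coord_space S \<inter> ball 0 1"
      then have "a - b \<in> coord_space S" by (simp add: subspace_diff)
      then show "dist (f a) (f b) \<le> 1 * dist a b"
        using f(3)[of "a - b"] by (simp add: dist_norm linear_diff[OF f(1)])
    qed simp
    finally show ?thesis by simp
  qed
  show ?thesis using le[OF assms] le[OF assms[symmetric]] assms by (simp add: disc_vol_def antisym)
qed

section \<open>Moments of coordinate discs\<close>

abbreviation coord_measure :: "'n set \<Rightarrow> (real^'n) measure" where
  "coord_measure S \<equiv> hausdorff_on (card S) (coord_space S)"

lemma emeasure_coord_measure:
  "A \<in> sets borel \<Longrightarrow> emeasure (coord_measure S) A = hausdorff_outer (card S) (coord_space S \<inter> A)"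
  by (rule emeasure_hausdorff_on) auto

lemma emeasure_coord_measure_ball:
  "0 < r \<Longrightarrow> emeasure (coord_measure S) (ball 0 r) = ennreal (r ^ card S * disc_vol S)"
  by (simp add: emeasure_coord_measure hausdorff_outer_coord_disc)

lemma measure_coord_measure_ball:
  "0 < r \<Longrightarrow> measure (coord_measure S) (ball 0 r) = r ^ card S * disc_vol S"
  using disc_vol_pos[of S] by (simp add: measure_def emeasure_coord_measure_ball less_imp_le)

lemma space_hausdorff_on [simp]: "space (hausdorff_on m M) = UNIV"
  by (simp add: hausdorff_on_def)

lemma AE_coord_measure: "AE y in coord_measure S. y \<in> coord_space S"
  by (rule AE_I[of _ _ "- coord_space S"]) (auto simp: emeasure_coord_measure)

lemma set_integrable_continuous_bounded:
  fixes g :: "'a::euclidean_space \<Rightarrow> real"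
  assumes N: "sets N = sets borel" and A: "A \<in> sets borel" "bounded A" "emeasure N A < \<infinity>"
    and g: "continuous_on UNIV g"
  shows "set_integrable N A g"
proof -
  have "compact (closure A)" using A by (simp add: compact_closure)
  then have "compact (g ` closure A)" using g by (blast intro: compact_continuous_image continuous_on_subset)
  then obtain B where B: "\<And>y. y \<in> closure A \<Longrightarrow> norm (g y) \<le> B"
    using compact_imp_bounded by (metis bounded_iff imageI)
  have gm: "g \<in> borel_measurable N"
    using borel_measurable_continuous_onI[OF g] measurable_cong_sets[OF N refl] by blast
  show ?thesis unfolding set_integrable_def
    by (rule integrableI_bounded_set_indicator[where B=B])
       (use A gm N B closure_subset in \<open>auto intro!: AE_I2\<close>)
qed

lemma set_integrable_coord:
  fixes g :: "real^'n \<Rightarrow> real"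
  assumes "0 < r" "continuous_on UNIV g"
  shows "set_integrable (coord_measure S) (ball 0 r) g"
  by (rule set_integrable_continuous_bounded) (use assms in \<open>auto simp: emeasure_coord_measure_ball\<close>)

text \<open>
  An isometric involution of the subspace preserves its Hausdorff measure.  The involutions used
  are the point reflection, the reflection of one axis and the exchange of two axes; they determine
  the first and second moments of a disc up to a single constant.
\<close>

lemma coord_integral_involution:
  fixes f :: "real^'n \<Rightarrow> real^'n" and g :: "real^'n \<Rightarrow> real"
  assumes lin: "linear f" and nm: "\<And>y. norm (f y) = norm y" and inv: "\<And>y. f (f y) = y"
    and pres: "\<And>y. y \<in> coord_space S \<Longrightarrow> f y \<in> coord_space S" and g: "g \<in> borel_measurable borel"
  shows "(LINT y:ball 0 r|coord_measure S. g (f y)) = (LINT y:ball 0 r|coord_measure S. g y)"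
proof -
  let ?\<tau> = "coord_measure S"
  have cont: "continuous_on UNIV f" using lin by (simp add: linear_continuous_on linear_linear)
  then have fm: "f \<in> measurable ?\<tau> borel"
    using borel_measurable_continuous_onI[OF cont] by simp
  have le: "hausdorff_outer (card S) (f ` B) \<le> hausdorff_outer (card S) B" for B
    using hausdorff_outer_lipschitz_image[of 1 B f "card S"] nm
    by (simp add: dist_norm linear_diff[OF lin, symmetric])
  have eq: "hausdorff_outer (card S) (f ` B) = hausdorff_outer (card S) B" for B
    using le[of B] le[of "f ` B"] inv by (simp add: image_image antisym)
  have "distr ?\<tau> borel f = ?\<tau>"
  proof (rule measure_eqI)
    fix A assume "A \<in> sets (distr ?\<tau> borel f)"
    then have A: "A \<in> sets borel" by simp
    have fA: "f -` A \<in> sets borel"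
      using measurable_sets[OF fm A] by simp
    have "f ` (coord_space S \<inter> f -` A) = coord_space S \<inter> A"
    proof (intro set_eqI iffI)
      fix y assume "y \<in> coord_space S \<inter> A"
      then show "y \<in> f ` (coord_space S \<inter> f -` A)"
        using pres inv by (intro image_eqI[of _ _ "f y"]) auto
    qed (use pres in auto)
    then have "hausdorff_outer (card S) (coord_space S \<inter> f -` A) = hausdorff_outer (card S) (coord_space S \<inter> A)"
      using eq by metis
    then show "emeasure (distr ?\<tau> borel f) A = emeasure ?\<tau> A"
      using A fA fm by (simp add: emeasure_distr emeasure_coord_measure)
  qed simp
  then have "(LINT y:ball 0 r|?\<tau>. g y) = (LINT y:ball 0 r|distr ?\<tau> borel f. g y)"
    by simp
  also have "\<dots> = (LINT y:ball 0 r|?\<tau>. g (f y))"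
    unfolding set_lebesgue_integral_def
    using g by (subst integral_distr[OF fm]) (auto simp: nm indicator_def intro!: Bochner_Integration.integral_cong)
  finally show ?thesis by simp
qed

lemma set_integral_uminus_real:
  fixes g :: "'a \<Rightarrow> real"
  shows "(LINT y:A|N. - g y) = - (LINT y:A|N. g y)"
  by (simp add: set_lebesgue_integral_def)

lemma borel_measurable_component [measurable]: "(\<lambda>v::real^'n. v $ i) \<in> borel_measurable borel"
  by (intro borel_measurable_continuous_onI continuous_intros)

lemma coord_first_moment: fixes S :: "'n::finite set" shows "(LINT v:ball 0 r|coord_measure S. v $ i) = 0"
  using coord_integral_involution[of uminus S "\<lambda>v. v $ i" r]
  by (simp add: set_integral_uminus_real linear_iff coord_space_def)

lemma coord_mixed_moment:
  fixes S :: "'n::finite set"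
  assumes "i \<noteq> j"
  shows "(LINT v:ball 0 r|coord_measure S. v $ i * v $ j) = 0"
proof -
  let ?f = "\<lambda>y :: real^'n. \<chi> k. if k = i then - y $ k else y $ k"
  have "norm (?f y) = norm y" for y
    unfolding norm_vec_def by (intro L2_set_cong) auto
  moreover have "linear ?f"
    by (auto simp: linear_iff vec_eq_iff)
  ultimately have "(LINT v:ball 0 r|coord_measure S. ?f v $ i * ?f v $ j)
      = (LINT v:ball 0 r|coord_measure S. v $ i * v $ j)"
    by (intro coord_integral_involution) (auto simp: coord_space_def vec_eq_iff)
  then show ?thesis using assms by (simp add: set_integral_uminus_real)
qed

lemma coord_second_moment_swap:
  fixes S :: "'n::finite set"
  assumes "i \<in> S" "j \<in> S"
  shows "(LINT v:ball 0 r|coord_measure S. (v $ i)\<^sup>2) = (LINT v:ball 0 r|coord_measure S. (v $ j)\<^sup>2)"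
proof -
  let ?f = "\<lambda>y :: real^'n. \<chi> k. y $ Transposition.transpose i j k"
  have "norm (?f y) = norm y" for y
    using sum.reindex_bij_betw[of "Transposition.transpose i j" UNIV UNIV "\<lambda>k. (norm (y $ k))\<^sup>2"]
    by (simp add: norm_vec_def L2_set_def)
  moreover have "linear ?f"
    by (auto simp: linear_iff vec_eq_iff)
  moreover have "?f y \<in> coord_space S" if "y \<in> coord_space S" for y
    using that assms by (auto simp: coord_space_def Transposition.transpose_def)
  ultimately have "(LINT v:ball 0 r|coord_measure S. (?f v $ j)\<^sup>2)
      = (LINT v:ball 0 r|coord_measure S. (v $ j)\<^sup>2)"
    by (intro coord_integral_involution) (auto simp: vec_eq_iff)
  then show ?thesis by simp
qed

lemma tendsto_at_right_continuous:
  fixes f :: "real \<Rightarrow> real"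
  assumes "continuous_on UNIV f" "f a = b"
  shows "(f \<longlongrightarrow> b) (at_right a)"
  using assms tendsto_within_subset[where f=f and S=UNIV and T="{a<..}"] by (auto simp: continuous_on_def)

text \<open>
  On the shell between the radii \<open>r\<close> and \<open>s\<close> the integrand lies between \<open>r\<^sup>2\<close> and \<open>s\<^sup>2\<close>, so the
  derivative of the moment is \<open>r\<^sup>2\<close> times the derivative of the mass \<open>r\<^sup>m \<cdot> disc_vol S\<close>.  The right
  hand side has the same derivative and the same limit at \<open>0\<close>.
\<close>

lemma coord_radial_moment:
  fixes S :: "'n::finite set"
  assumes "0 < r"
  shows "(LINT v:ball 0 r|coord_measure S. (norm v)\<^sup>2) = real (card S) * disc_vol S * r ^ (card S + 2) / (real (card S) + 2)"
proof -
  let ?\<tau> = "coord_measure S"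
  define m where "m = card S"
  define V where "V r = r ^ m * disc_vol S" for r :: real
  define I where "I r = (LINT v:ball 0 r|?\<tau>. (norm v)\<^sup>2)" for r
  define G where "G r = real m * disc_vol S * r ^ (m + 2) / (real m + 2)" for r :: real
  have int: "set_integrable ?\<tau> (ball 0 r) (\<lambda>v. (norm v)\<^sup>2)" if "0 < r" for r
    by (rule set_integrable_coord[OF that]) (intro continuous_intros)
  have intc: "set_integrable ?\<tau> (ball 0 r) (\<lambda>v. c)" if "0 < r" for r and c :: real
    by (rule set_integrable_coord[OF that]) (intro continuous_intros)
  have V: "(LINT v:ball 0 r|?\<tau>. c) = c * V r" if "0 < r" for r c
    using that by (simp add: set_lebesgue_integral_def measure_coord_measure_ball V_def m_def)
  have diff: "(LINT v:ball 0 s - ball 0 r|?\<tau>. h v) = (LINT v:ball 0 s|?\<tau>. h v) - (LINT v:ball 0 r|?\<tau>. h v)"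
    if "0 < r" "r \<le> s" "set_integrable ?\<tau> (ball 0 s) h" "set_integrable ?\<tau> (ball 0 r) h" for r s and h :: "real^'n \<Rightarrow> real"
  proof -
    have "(LINT v:ball 0 s|?\<tau>. h v) - (LINT v:ball 0 r|?\<tau>. h v)
        = (LINT v|?\<tau>. indicator (ball 0 s) v *\<^sub>R h v - indicator (ball 0 r) v *\<^sub>R h v)"
      using that by (simp add: set_lebesgue_integral_def set_integrable_def)
    also have "\<dots> = (LINT v:ball 0 s - ball 0 r|?\<tau>. h v)"
      unfolding set_lebesgue_integral_def
      using that by (intro Bochner_Integration.integral_cong) (auto simp: indicator_def)
    finally show ?thesis by simp
  qed
  have bnd: "r\<^sup>2 * (V s - V r) \<le> I s - I r \<and> I s - I r \<le> s\<^sup>2 * (V s - V r)" if "0 < r" "r \<le> s" for r s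
  proof -
    have s: "0 < s" using that by simp
    have ints: "set_integrable ?\<tau> (ball 0 s - ball 0 r) h" if "set_integrable ?\<tau> (ball 0 s) h" for h :: "real^'n \<Rightarrow> real"
      using that by (rule set_integrable_subset) auto
    have c: "(LINT v:ball 0 s - ball 0 r|?\<tau>. c) = c * (V s - V r)" for c
      using that s by (subst diff) (auto simp: V intc right_diff_distrib)
    have I: "(LINT v:ball 0 s - ball 0 r|?\<tau>. (norm v)\<^sup>2) = I s - I r"
      unfolding I_def using that s by (subst diff) (auto simp: int)
    have "(LINT v:ball 0 s - ball 0 r|?\<tau>. r\<^sup>2) \<le> (LINT v:ball 0 s - ball 0 r|?\<tau>. (norm v)\<^sup>2)"
      using that s by (intro set_integral_mono ints intc int power_mono) auto
    moreover have "(LINT v:ball 0 s - ball 0 r|?\<tau>. (norm v)\<^sup>2) \<le> (LINT v:ball 0 s - ball 0 r|?\<tau>. s\<^sup>2)"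
      using that s by (intro set_integral_mono ints intc int power_mono) auto
    ultimately show ?thesis unfolding c I by simp
  qed
  have Vmono: "V r \<le> V s" if "0 < r" "r \<le> s" for r s
    using that disc_vol_pos[of S] by (auto simp: V_def intro!: mult_right_mono power_mono)
  have dV: "(V has_real_derivative real m * r ^ (m - 1) * disc_vol S) (at r)" for r
    unfolding V_def by (auto intro!: derivative_eq_intros)
  have dI: "(I has_real_derivative r\<^sup>2 * (real m * r ^ (m - 1) * disc_vol S)) (at r)" if "0 < r" for r
  proof -
    have key: "\<bar>I s - I r - r\<^sup>2 * (V s - V r)\<bar> \<le> \<bar>s\<^sup>2 - r\<^sup>2\<bar> * \<bar>V s - V r\<bar>" if "0 < s" for s
    proof (cases "r \<le> s")
      case True
      then have "0 \<le> s\<^sup>2 - r\<^sup>2" using \<open>0 < r\<close> by (simp add: power_mono)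
      then show ?thesis using bnd[OF \<open>0 < r\<close> True] Vmono[OF \<open>0 < r\<close> True] by (simp add: algebra_simps)
    next
      case False
      then have "s\<^sup>2 - r\<^sup>2 \<le> 0" using that by (simp add: power_mono)
      then show ?thesis using bnd[OF that, of r] Vmono[OF that, of r] False by (simp add: algebra_simps)
    qed
    have "((\<lambda>s. (s\<^sup>2 - r\<^sup>2) * ((V s - V r) / (s - r))) \<longlongrightarrow> (r\<^sup>2 - r\<^sup>2) * (real m * r ^ (m - 1) * disc_vol S)) (at r)"
      using dV[of r, unfolded has_field_derivative_iff] by (intro tendsto_intros) auto
    then have z: "((\<lambda>s. (s\<^sup>2 - r\<^sup>2) * ((V s - V r) / (s - r))) \<longlongrightarrow> 0) (at r)" by simp
    have "((\<lambda>s. (I s - I r) / (s - r) - r\<^sup>2 * ((V s - V r) / (s - r))) \<longlongrightarrow> 0) (at r)"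
    proof (rule Lim_null_comparison[OF _ tendsto_norm_zero[OF z]])
      have "eventually (\<lambda>s. s \<in> {0<..}) (at r)"
        using \<open>0 < r\<close> by (intro eventually_at_in_open') auto
      then show "eventually (\<lambda>s. norm ((I s - I r) / (s - r) - r\<^sup>2 * ((V s - V r) / (s - r)))
          \<le> norm ((s\<^sup>2 - r\<^sup>2) * ((V s - V r) / (s - r)))) (at r)"
      proof eventually_elim
        case (elim s)
        have "norm ((I s - I r) / (s - r) - r\<^sup>2 * ((V s - V r) / (s - r)))
            = \<bar>I s - I r - r\<^sup>2 * (V s - V r)\<bar> / \<bar>s - r\<bar>"
          by (simp add: diff_divide_distrib[symmetric])
        also have "\<dots> \<le> \<bar>s\<^sup>2 - r\<^sup>2\<bar> * \<bar>V s - V r\<bar> / \<bar>s - r\<bar>"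
          using key elim by (intro divide_right_mono) auto
        finally show ?case by (simp add: abs_mult)
      qed
    qed
    moreover have "((\<lambda>s. r\<^sup>2 * ((V s - V r) / (s - r))) \<longlongrightarrow> r\<^sup>2 * (real m * r ^ (m - 1) * disc_vol S)) (at r)"
      using dV[of r, unfolded has_field_derivative_iff] by (intro tendsto_intros)
    from tendsto_add[OF calculation this] have "((\<lambda>s. (I s - I r) / (s - r)) \<longlongrightarrow> 0 + r\<^sup>2 * (real m * r ^ (m - 1) * disc_vol S)) (at r)"
      by simp
    then show ?thesis by (simp add: has_field_derivative_iff)
  qed
  have dG: "(G has_real_derivative r\<^sup>2 * (real m * r ^ (m - 1) * disc_vol S)) (at r)" if "0 < r" for r
  proof -
    have "(G has_real_derivative real m * disc_vol S * (real (m + 2) * r ^ (m + 1)) / (real m + 2)) (at r)"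
      unfolding G_def using DERIV_pow[of "m + 2" r]
      by (intro DERIV_cdivide DERIV_cmult) (simp add: numeral_eq_Suc)
    moreover have "real m * disc_vol S * (real (m + 2) * r ^ (m + 1)) / (real m + 2) = r\<^sup>2 * (real m * r ^ (m - 1) * disc_vol S)"
      by (cases m) (auto simp: field_simps power2_eq_square)
    ultimately show ?thesis by simp
  qed
  have "\<exists>c. \<forall>r\<in>{0<..}. I r - G r = c"
  proof (rule has_field_derivative_zero_constant)
    fix r :: real assume "r \<in> {0<..}"
    then show "((\<lambda>r. I r - G r) has_real_derivative 0) (at r within {0<..})"
      using DERIV_diff[OF dI dG, of r] by (auto intro: has_field_derivative_at_within)
  qed auto
  then obtain c where c: "\<And>r. 0 < r \<Longrightarrow> I r - G r = c" by auto
  have "((\<lambda>r. I r - G r) \<longlongrightarrow> 0 - 0) (at_right 0)"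
  proof (intro tendsto_diff)
    show "(I \<longlongrightarrow> 0) (at_right 0)"
    proof (rule Lim_null_comparison)
      show "eventually (\<lambda>r. norm (I r) \<le> r\<^sup>2 * V r) (at_right 0)"
      proof (rule eventually_at_rightI[of 0 1])
        fix r :: real assume "r \<in> {0<..<1}"
        then have r: "0 < r" by simp
        have "0 \<le> I r" unfolding I_def set_lebesgue_integral_def by (auto intro!: integral_nonneg_AE)
        moreover have "I r \<le> (LINT v:ball 0 r|?\<tau>. r\<^sup>2)"
          unfolding I_def using r by (intro set_integral_mono intc int power_mono) auto
        ultimately show "norm (I r) \<le> r\<^sup>2 * V r" using V[OF r] by simp
      qed simp
      show "((\<lambda>r. r\<^sup>2 * V r) \<longlongrightarrow> 0) (at_right 0)"
        unfolding V_def by (intro tendsto_at_right_continuous continuous_intros) simp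
    qed
    show "(G \<longlongrightarrow> 0) (at_right 0)"
      unfolding G_def by (intro tendsto_at_right_continuous continuous_intros) auto
  qed
  moreover have "((\<lambda>r. I r - G r) \<longlongrightarrow> c) (at_right 0)"
    by (rule tendsto_eventually) (auto simp: c intro!: eventually_at_rightI[of 0 1])
  ultimately have "c = 0" using tendsto_unique[of "at_right (0::real)"] by fastforce
  then show ?thesis using c[OF assms] by (simp add: I_def G_def m_def)
qed

lemma coord_second_moment:
  fixes S :: "'n::finite set"
  assumes "0 < r" "i \<in> S"
  shows "(LINT v:ball 0 r|coord_measure S. (v $ i)\<^sup>2) = disc_vol S * r ^ (card S + 2) / (real (card S) + 2)"
proof -
  let ?\<tau> = "coord_measure S"
  have meas: "(\<lambda>v. indicator (ball 0 r) v *\<^sub>R h v) \<in> borel_measurable ?\<tau>"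
    if "continuous_on UNIV h" for h :: "real^'n \<Rightarrow> real"
    using set_integrable_coord[OF assms(1) that] by (auto simp: set_integrable_def)
  have "(\<Sum>j\<in>S. (LINT v:ball 0 r|?\<tau>. (v $ j)\<^sup>2)) = (LINT v|?\<tau>. (\<Sum>j\<in>S. indicator (ball 0 r) v *\<^sub>R (v $ j)\<^sup>2))"
    unfolding set_lebesgue_integral_def
  proof (rule Bochner_Integration.integral_sum[symmetric])
    fix j
    show "integrable ?\<tau> (\<lambda>v. indicator (ball 0 r) v *\<^sub>R (v $ j)\<^sup>2)"
      unfolding set_integrable_def[symmetric]
      by (rule set_integrable_coord[OF assms(1)]) (intro continuous_intros)

  qed
  also have "\<dots> = (LINT v:ball 0 r|?\<tau>. (norm v)\<^sup>2)"
    unfolding set_lebesgue_integral_def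
  proof (rule integral_cong_AE)
    show "AE v in ?\<tau>. (\<Sum>j\<in>S. indicator (ball 0 r) v *\<^sub>R (v $ j)\<^sup>2) = indicator (ball 0 r) v *\<^sub>R (norm v)\<^sup>2"
      using AE_coord_measure
    proof eventually_elim
      case (elim v)
      have "(norm v)\<^sup>2 = (\<Sum>j\<in>UNIV. (v $ j)\<^sup>2)"
        by (simp add: norm_vec_def L2_set_def sum_nonneg)
      also have "\<dots> = (\<Sum>j\<in>S. (v $ j)\<^sup>2)"
        using elim by (intro sum.mono_neutral_right) (auto simp: coord_space_def)
      finally show ?case by (simp add: sum_distrib_left)
    qed
    show "(\<lambda>v. indicator (ball 0 r) v *\<^sub>R (norm v)\<^sup>2) \<in> borel_measurable ?\<tau>"
      by (rule meas) (intro continuous_intros)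
    show "(\<lambda>v. \<Sum>j\<in>S. indicator (ball 0 r) v *\<^sub>R (v $ j)\<^sup>2) \<in> borel_measurable ?\<tau>"
      by (intro borel_measurable_sum meas continuous_intros)
  qed
  also have "\<dots> = real (card S) * disc_vol S * r ^ (card S + 2) / (real (card S) + 2)"
    by (rule coord_radial_moment[OF assms(1)])
  also have "(\<Sum>j\<in>S. (LINT v:ball 0 r|?\<tau>. (v $ j)\<^sup>2)) = real (card S) * (LINT v:ball 0 r|?\<tau>. (v $ i)\<^sup>2)"
    using coord_second_moment_swap[OF _ assms(2)] by simp
  finally have "real (card S) * (LINT v:ball 0 r|?\<tau>. (v $ i)\<^sup>2)
      = real (card S) * (disc_vol S * r ^ (card S + 2) / (real (card S) + 2))" by simp
  moreover have "real (card S) \<noteq> 0" using assms(2) by (auto simp: card_gt_0_iff)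
  ultimately show ?thesis by (metis mult_left_cancel)
qed

section \<open>Asymptotic mean values on nearly flat sets\<close>

text \<open>
  The map \<open>\<pi>\<close> stands for the orthogonal projection to the tangent space at \<open>x\<close>, written in coordinates
  of an orthonormal frame.  It is \<open>1\<close>-Lipschitz, by \<open>flat\<close> its inverse on the part of \<open>M\<close> in the ball
  of radius \<open>r\<close> has a Lipschitz constant \<open>1 + O(r\<^sup>2)\<close>, and by \<open>onto\<close> its image contains a
  neighbourhood of \<open>0\<close>.
\<close>

locale nearly_flat =
  fixes M :: "(real^'n) set" and x :: "real^'n" and S :: "'n set"
    and \<pi> :: "real^'n \<Rightarrow> real^'n" and C \<epsilon> \<eta> :: real
  assumes closed_M: "closed M" and x_in: "x \<in> M"
    and lin: "linear \<pi>" and \<pi>_in: "\<pi> w \<in> coord_space S" and \<pi>_le: "norm (\<pi> w) \<le> norm w"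
    and \<epsilon>: "0 < \<epsilon>" "(C * \<epsilon>)\<^sup>2 \<le> 1 / 2" and \<eta>: "0 < \<eta>"
    and flat: "\<lbrakk>r \<le> \<epsilon>; y \<in> M \<inter> cball x r; y' \<in> M \<inter> cball x r\<rbrakk>
        \<Longrightarrow> (1 - (C * r)\<^sup>2) * (norm (y - y'))\<^sup>2 \<le> (norm (\<pi> (y - y')))\<^sup>2"
    and onto: "\<lbrakk>v \<in> coord_space S; norm v < \<eta>\<rbrakk> \<Longrightarrow> \<exists>y\<in>M \<inter> cball x \<epsilon>. \<pi> (y - x) = v"
begin

abbreviation "\<nu> \<equiv> hausdorff_on (card S) M"

lemma C_small:
  assumes "0 \<le> r" "r \<le> \<epsilon>"
  shows "(C * r)\<^sup>2 \<le> 1 / 2"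
proof -
  have "(C * r)\<^sup>2 \<le> (C * \<epsilon>)\<^sup>2"
    using assms by (auto simp: power_mult_distrib intro!: mult_left_mono power_mono)
  then show ?thesis using \<epsilon> by simp
qed

lemma continuous_proj: "continuous_on UNIV (\<lambda>y. \<pi> (y - x))"
proof -
  have "continuous_on UNIV \<pi>" using lin by (simp add: linear_continuous_on linear_linear)
  from continuous_on_compose2[OF this, of UNIV "\<lambda>y. y - x"] show ?thesis
    by (simp add: continuous_on_diff)
qed

lemma emeasure_\<nu>: "A \<in> sets borel \<Longrightarrow> emeasure \<nu> A = hausdorff_outer (card S) (M \<inter> A)"
  using closed_M by (intro emeasure_hausdorff_on) auto

text \<open>
  For \<open>c = (C * r)\<^sup>2 \<le> 1 / 2\<close> one has \<open>(1 + c)\<^sup>2 (1 - c) \<ge> 1\<close>, so \<open>1 + c\<close> is a Lipschitz constant of the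
  inverse projection; as a polynomial in \<open>r\<close> it is easier to expand than the optimal constant.
\<close>

lemma preimage_le:
  assumes "0 < r" "r \<le> \<epsilon>"
  shows "hausdorff_outer (card S) (M \<inter> (ball x r \<inter> {y. \<pi> (y - x) \<in> A}))
    \<le> ennreal ((1 + (C * r)\<^sup>2) ^ card S) * hausdorff_outer (card S) (coord_space S \<inter> (ball 0 r \<inter> A))"
proof -
  let ?B = "M \<inter> (ball x r \<inter> {y. \<pi> (y - x) \<in> A})"
  let ?p = "\<lambda>y. \<pi> (y - x)"
  define c where "c = (C * r)\<^sup>2"
  have c: "0 \<le> c" "c \<le> 1 / 2" using C_small[of r] assms by (auto simp: c_def)
  have "0 \<le> c * (1 - c - c\<^sup>2)"
  proof (intro mult_nonneg_nonneg c)
    have "c\<^sup>2 \<le> (1 / 2)\<^sup>2" using c by (intro power_mono) auto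
    then show "0 \<le> 1 - c - c\<^sup>2" using c by (simp add: power2_eq_square)
  qed
  then have lam: "1 \<le> (1 + c)\<^sup>2 * (1 - c)" by (simp add: power2_eq_square algebra_simps)
  have expand: "norm (y - y') \<le> (1 + c) * norm (?p y - ?p y')" if "y \<in> ?B" "y' \<in> ?B" for y y'
  proof -
    have p: "?p y - ?p y' = \<pi> (y - y')" by (simp add: linear_diff[OF lin, symmetric])
    have "(norm (y - y'))\<^sup>2 \<le> (1 + c)\<^sup>2 * (1 - c) * (norm (y - y'))\<^sup>2"
      using mult_right_mono[OF lam, of "(norm (y - y'))\<^sup>2"] by simp
    also have "\<dots> \<le> (1 + c)\<^sup>2 * (norm (\<pi> (y - y')))\<^sup>2"
      unfolding mult.assoc using flat[of r y y'] that assms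
      by (intro mult_left_mono) (auto simp: c_def)
    also have "\<dots> = ((1 + c) * norm (?p y - ?p y'))\<^sup>2" by (simp add: p power_mult_distrib)
    finally show ?thesis using c by (simp add: power2_le_iff_abs_le)
  qed
  have inj: "inj_on ?p ?B"
  proof (rule inj_onI)
    fix y y' assume "y \<in> ?B" "y' \<in> ?B" "?p y = ?p y'"
    then show "y = y'" using expand[of y y'] by simp
  qed
  define g where "g = inv_into ?B ?p"
  have g: "g (?p y) = y" if "y \<in> ?B" for y
    unfolding g_def using inv_into_f_f[OF inj that] .
  have "?B = g ` ?p ` ?B" using g by (force simp: image_image)
  then have "hausdorff_outer (card S) ?B = hausdorff_outer (card S) (g ` ?p ` ?B)" by simp
  also have "\<dots> \<le> ennreal ((1 + c) ^ card S) * hausdorff_outer (card S) (?p ` ?B)"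
  proof (rule hausdorff_outer_lipschitz_image)
    fix v w assume "v \<in> ?p ` ?B" "w \<in> ?p ` ?B"
    then obtain y y' where y: "y \<in> ?B" "v = ?p y" "y' \<in> ?B" "w = ?p y'" by blast
    then show "dist (g v) (g w) \<le> (1 + c) * dist v w"
      using expand[OF y(1,3)] by (simp only: g dist_norm)
  qed (use c in simp)
  also have "\<dots> \<le> ennreal ((1 + c) ^ card S) * hausdorff_outer (card S) (coord_space S \<inter> (ball 0 r \<inter> A))"
  proof (intro mult_left_mono hausdorff_outer_mono subsetI)
    fix v assume "v \<in> ?p ` ?B"
    then obtain y where y: "y \<in> ?B" "v = ?p y" by blast
    then have "norm v \<le> norm (y - x)" by (simp add: \<pi>_le)
    also have "\<dots> < r" using y by (simp add: dist_norm norm_minus_commute)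
    finally show "v \<in> coord_space S \<inter> (ball 0 r \<inter> A)" using y \<pi>_in by auto
  qed simp
  finally show ?thesis by (simp add: c_def)
qed

lemma emeasure_ball_le:
  assumes "0 < r" "r \<le> \<epsilon>"
  shows "emeasure \<nu> (ball x r) \<le> ennreal ((1 + (C * r)\<^sup>2) ^ card S * (r ^ card S * disc_vol S))"
  using preimage_le[OF assms, of UNIV] assms disc_vol_pos[of S]
  by (simp add: emeasure_\<nu> hausdorff_outer_coord_disc ennreal_mult less_imp_le)

lemma emeasure_ball_finite:
  assumes "0 < r" "r \<le> \<epsilon>"
  shows "emeasure \<nu> (ball x r) < \<infinity>"
  using emeasure_ball_le[OF assms] by (simp add: le_less_trans)

lemma measure_ball_le:
  assumes "0 < r" "r \<le> \<epsilon>"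
  shows "measure \<nu> (ball x r) \<le> (1 + (C * r)\<^sup>2) ^ card S * (r ^ card S * disc_vol S)"
  unfolding measure_def
  using emeasure_ball_le[OF assms] assms disc_vol_pos[of S] by (intro enn2real_leI) auto

text \<open>
  A preimage of \<open>v\<close> at distance \<open>d\<close> from \<open>x\<close> satisfies \<open>(1 - (C * d)\<^sup>2) d\<^sup>2 \<le> \<bar>v\<bar>\<^sup>2\<close>.  A crude use of this
  inequality gives \<open>d \<le> 2 r\<close>, which allows to replace \<open>C * d\<close> by \<open>2 * C * r\<close>; then a small
  \<open>v\<close> forces \<open>d < r\<close>.
\<close>

lemma disc_subset_projection:
  assumes "0 < r" "r \<le> \<epsilon>" "r \<le> \<eta>" "(2 * C * r)\<^sup>2 \<le> 1"
  shows "coord_space S \<inter> ball 0 (r * (1 - (2 * C * r)\<^sup>2)) \<subseteq> (\<lambda>y. \<pi> (y - x)) ` (M \<inter> ball x r)"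
proof
  define c where "c = (2 * C * r)\<^sup>2"
  have c: "0 \<le> c" "c \<le> 1" using assms by (auto simp: c_def)
  fix v assume "v \<in> coord_space S \<inter> ball 0 (r * (1 - (2 * C * r)\<^sup>2))"
  then have v: "v \<in> coord_space S" "norm v < r * (1 - c)" by (auto simp: c_def)
  have "r * (1 - c) \<le> r * 1" using c assms by (intro mult_left_mono) auto
  then have vr: "norm v < r" using v by simp
  obtain y where y: "y \<in> M" "y \<in> cball x \<epsilon>" "\<pi> (y - x) = v"
    using onto[OF v(1)] vr assms by auto
  define d where "d = norm (y - x)"
  have d: "0 \<le> d" "d \<le> \<epsilon>" using y by (auto simp: d_def dist_norm norm_minus_commute)
  have fl: "(1 - (C * d)\<^sup>2) * d\<^sup>2 \<le> (norm v)\<^sup>2"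
    using flat[of d y x] d y x_in by (simp add: d_def dist_norm norm_minus_commute)
  have "d < r"
  proof (rule ccontr)
    assume "\<not> d < r"
    then have "r \<le> d" by simp
    have "1 / 2 * d\<^sup>2 \<le> (1 - (C * d)\<^sup>2) * d\<^sup>2"
      using C_small[OF d] by (intro mult_right_mono) auto
    then have "d\<^sup>2 \<le> 2 * (norm v)\<^sup>2" using fl by simp
    also have "\<dots> \<le> 2 * r\<^sup>2" using vr assms by (intro mult_left_mono power_mono) auto
    also have "\<dots> \<le> (2 * r)\<^sup>2" by (simp add: power2_eq_square)
    finally have "d \<le> 2 * r" by (rule power2_le_imp_le) (use \<open>0 < r\<close> in simp)
    then have "d\<^sup>2 \<le> (2 * r)\<^sup>2" using d(1) by (rule power_mono)
    from mult_left_mono[OF this, of "C\<^sup>2"] have cd: "(C * d)\<^sup>2 \<le> c"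
      by (simp add: c_def power_mult_distrib)
    have "(r * (1 - c))\<^sup>2 = r\<^sup>2 * ((1 - c) * (1 - c))" by (simp add: power2_eq_square)
    also have "\<dots> \<le> r\<^sup>2 * (1 - c)" using c by (intro mult_left_mono) (auto intro: mult_left_le)
    also have "\<dots> \<le> d\<^sup>2 * (1 - (C * d)\<^sup>2)"
      using \<open>r \<le> d\<close> assms c cd by (intro mult_mono power_mono) auto
    also have "\<dots> \<le> (norm v)\<^sup>2" using fl by (simp add: mult.commute)
    finally have "r * (1 - c) \<le> norm v" using c assms by (simp add: power2_le_iff_abs_le)
    then show False using v by simp
  qed
  then show "v \<in> (\<lambda>y. \<pi> (y - x)) ` (M \<inter> ball x r)"
    using y by (auto simp: d_def dist_norm norm_minus_commute)
qed

lemma measure_ball_ge: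
  assumes "0 < r" "r \<le> \<epsilon>" "r \<le> \<eta>" "(2 * C * r)\<^sup>2 < 1"
  shows "(1 - (2 * C * r)\<^sup>2) ^ card S * (r ^ card S * disc_vol S) \<le> measure \<nu> (ball x r)"
proof -
  let ?s = "r * (1 - (2 * C * r)\<^sup>2)"
  have s: "0 < ?s" using assms by simp
  have "ennreal (?s ^ card S * disc_vol S) = hausdorff_outer (card S) (coord_space S \<inter> ball 0 ?s)"
    using s by (simp add: hausdorff_outer_coord_disc)
  also have "\<dots> \<le> hausdorff_outer (card S) ((\<lambda>y. \<pi> (y - x)) ` (M \<inter> ball x r))"
    using assms by (intro hausdorff_outer_mono disc_subset_projection) auto
  also have "\<dots> \<le> ennreal (1 ^ card S) * hausdorff_outer (card S) (M \<inter> ball x r)"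
    by (rule hausdorff_outer_lipschitz_image)
      (auto simp: dist_norm linear_diff[OF lin, symmetric] \<pi>_le)
  finally have "ennreal (?s ^ card S * disc_vol S) \<le> emeasure \<nu> (ball x r)"
    by (simp add: emeasure_\<nu>)
  also have "\<dots> = ennreal (measure \<nu> (ball x r))"
    using emeasure_ball_finite[OF assms(1,2)] by (intro emeasure_eq_ennreal_measure) auto
  finally show ?thesis by (simp add: power_mult_distrib ac_simps)
qed

text \<open>
  The push-forward of the measure under the projection is dominated by a multiple of the flat measure.
  This compares integrals of nonnegative functions, whence the shift of \<open>g\<close> by \<open>K\<close>; the price is
  \<open>K\<close> times the difference of the total masses.
\<close>

lemma integral_projection_le:
  fixes g :: "real^'n \<Rightarrow> real"
  assumes r: "0 < r" "r \<le> \<epsilon>" and g: "continuous_on UNIV g" and K: "\<And>v. norm v < r \<Longrightarrow> \<bar>g v\<bar> \<le> K"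
  shows "(LINT y:ball x r|\<nu>. g (\<pi> (y - x)))
    \<le> (1 + (C * r)\<^sup>2) ^ card S * (LINT v:ball 0 r|coord_measure S. g v)
      + K * ((1 + (C * r)\<^sup>2) ^ card S * (r ^ card S * disc_vol S) - measure \<nu> (ball x r))"
proof -
  let ?p = "\<lambda>y. \<pi> (y - x)"
  let ?\<tau> = "coord_measure S"
  define L where "L = (1 + (C * r)\<^sup>2) ^ card S"
  have L: "0 \<le> L" by (simp add: L_def)
  define h where "h v = g v + K" for v
  have ch: "continuous_on UNIV h" unfolding h_def by (intro continuous_intros g)
  have pm: "?p \<in> borel_measurable borel" by (intro borel_measurable_continuous_onI continuous_proj)
  have im: "indicator (ball x r) \<in> borel_measurable \<nu>"
    by (intro borel_measurable_indicator) simp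
  have pv: "?p \<in> measurable \<nu> borel" using pm by simp
  have hm [measurable]: "h \<in> borel_measurable borel" by (intro borel_measurable_continuous_onI ch)
  define N where "N = distr (density \<nu> (indicator (ball x r))) borel ?p"
  define T where "T = scale_measure (ennreal L) (density ?\<tau> (indicator (ball 0 r)))"
  have NT: "N \<le> T"
  proof (subst le_measure)
    show "\<forall>A\<in>sets N. emeasure N A \<le> emeasure T A"
    proof
      fix A assume "A \<in> sets N"
      then have A: "A \<in> sets borel" by (simp add: N_def)
      have pA: "?p -` A \<in> sets borel" using measurable_sets[OF pm A] by simp
      have "emeasure N A = emeasure (density \<nu> (indicator (ball x r))) (?p -` A)"
        unfolding N_def using A pm by (subst emeasure_distr) (auto simp: measurable_density_eq1 cong: measurable_cong_sets)
      also have "\<dots> = emeasure \<nu> (ball x r \<inter> ?p -` A)"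
        using pA by (simp add: emeasure_restricted)
      also have "\<dots> \<le> ennreal L * hausdorff_outer (card S) (coord_space S \<inter> (ball 0 r \<inter> A))"
        using preimage_le[OF r, of A] pA by (simp add: emeasure_\<nu> L_def vimage_def)
      also have "\<dots> = ennreal L * emeasure (density ?\<tau> (indicator (ball 0 r))) A"
        using A by (simp add: emeasure_restricted emeasure_coord_measure)
      finally show "emeasure N A \<le> emeasure T A" by (simp add: T_def)
    qed
  qed (simp add: N_def T_def)
  have nn: "(\<integral>\<^sup>+ y. ennreal (indicator (ball x r) y *\<^sub>R h (?p y)) \<partial>\<nu>)
      \<le> ennreal L * (\<integral>\<^sup>+ v. ennreal (indicator (ball 0 r) v *\<^sub>R h v) \<partial>?\<tau>)"
  proof -
    have "(\<integral>\<^sup>+ y. ennreal (indicator (ball x r) y *\<^sub>R h (?p y)) \<partial>\<nu>)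
        = (\<integral>\<^sup>+ y. indicator (ball x r) y * ennreal (h (?p y)) \<partial>\<nu>)"
      by (intro nn_integral_cong) (simp add: indicator_def)
    also have "\<dots> = (\<integral>\<^sup>+ y. ennreal (h (?p y)) \<partial>density \<nu> (indicator (ball x r)))"
      using pv im by (subst nn_integral_density) auto
    also have "\<dots> = (\<integral>\<^sup>+ v. ennreal (h v) \<partial>N)"
      unfolding N_def using pv by (subst nn_integral_distr) auto
    also have "\<dots> \<le> (\<integral>\<^sup>+ v. ennreal (h v) \<partial>T)"
      using NT by (intro nn_integral_mono_measure) (simp_all add: N_def T_def)
    also have "\<dots> = ennreal L * (\<integral>\<^sup>+ v. ennreal (h v) \<partial>density ?\<tau> (indicator (ball 0 r)))"
      unfolding T_def by (rule nn_integral_scale_measure) simp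
    also have "(\<integral>\<^sup>+ v. ennreal (h v) \<partial>density ?\<tau> (indicator (ball 0 r)))
        = (\<integral>\<^sup>+ v. indicator (ball 0 r) v * ennreal (h v) \<partial>?\<tau>)"
      using borel_measurable_indicator[of "ball 0 r" ?\<tau>] by (subst nn_integral_density) auto
    also have "\<dots> = (\<integral>\<^sup>+ v. ennreal (indicator (ball 0 r) v *\<^sub>R h v) \<partial>?\<tau>)"
      by (intro nn_integral_cong) (simp add: indicator_def)
    finally show ?thesis .
  qed
  have int\<nu>: "set_integrable \<nu> (ball x r) (\<lambda>y. f (?p y))" if "continuous_on UNIV f" for f :: "real^'n \<Rightarrow> real"
    using emeasure_ball_finite[OF r] continuous_on_compose2[OF that continuous_proj]
    by (intro set_integrable_continuous_bounded) auto
  have int\<tau>: "set_integrable ?\<tau> (ball 0 r) f" if "continuous_on UNIV f" for f :: "real^'n \<Rightarrow> real"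
    by (rule set_integrable_coord[OF r(1) that])
  have h0: "0 \<le> h v" if "norm v < r" for v using K[OF that] by (simp add: h_def)
  have "norm (?p y) < r" if "y \<in> ball x r" for y
    using \<pi>_le[of "y - x"] that by (simp add: dist_norm norm_minus_commute)
  then have hp0: "0 \<le> h (?p y)" if "y \<in> ball x r" for y using h0 that by blast
  have "ennreal (LINT y:ball x r|\<nu>. h (?p y)) = (\<integral>\<^sup>+ y. ennreal (indicator (ball x r) y *\<^sub>R h (?p y)) \<partial>\<nu>)"
    unfolding set_lebesgue_integral_def using int\<nu>[OF ch] hp0
    by (intro nn_integral_eq_integral[symmetric]) (auto simp: set_integrable_def indicator_def)
  also note nn
  also have "(\<integral>\<^sup>+ v. ennreal (indicator (ball 0 r) v *\<^sub>R h v) \<partial>?\<tau>) = ennreal (LINT v:ball 0 r|?\<tau>. h v)"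
    unfolding set_lebesgue_integral_def using int\<tau>[OF ch] h0
    by (intro nn_integral_eq_integral) (auto simp: set_integrable_def indicator_def)
  also have "ennreal L * ennreal (LINT v:ball 0 r|?\<tau>. h v) = ennreal (L * (LINT v:ball 0 r|?\<tau>. h v))"
    by (rule ennreal_mult'[OF L, symmetric])
  finally have "(LINT y:ball x r|\<nu>. h (?p y)) \<le> L * (LINT v:ball 0 r|?\<tau>. h v)"
  proof (subst (asm) ennreal_le_iff)
    have "0 \<le> (LINT v:ball 0 r|?\<tau>. h v)"
      unfolding set_lebesgue_integral_def using h0
      by (intro integral_nonneg_AE) (auto simp: indicator_def)
    then show "0 \<le> L * (LINT v:ball 0 r|?\<tau>. h v)" using L by simp
  qed
  moreover have "(LINT y:ball x r|\<nu>. h (?p y)) = (LINT y:ball x r|\<nu>. g (?p y)) + K * measure \<nu> (ball x r)"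
    unfolding h_def using int\<nu>[OF g] int\<nu>[of "\<lambda>_. K"]
    by (subst set_integral_add) (auto simp: set_lebesgue_integral_def)
  moreover have "(LINT v:ball 0 r|?\<tau>. h v) = (LINT v:ball 0 r|?\<tau>. g v) + K * (r ^ card S * disc_vol S)"
    unfolding h_def using int\<tau>[OF g] int\<tau>[of "\<lambda>_. K"] r
    by (subst set_integral_add) (auto simp: set_lebesgue_integral_def measure_coord_measure_ball)
  ultimately show ?thesis by (simp add: L_def algebra_simps)
qed

lemma small_radius:
  assumes "0 < d"
  shows "eventually (\<lambda>r. 0 < r \<and> r \<le> \<epsilon> \<and> r \<le> \<eta> \<and> (2 * C * r)\<^sup>2 < 1 \<and> r < d) (at_right 0)"
proof -
  have "((\<lambda>r. (2 * C * r)\<^sup>2) \<longlongrightarrow> 0) (at_right 0)"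
    by (intro tendsto_at_right_continuous continuous_intros) simp
  then have "eventually (\<lambda>r. (2 * C * r)\<^sup>2 < 1) (at_right 0)" by (rule order_tendstoD) simp
  moreover have "eventually (\<lambda>r. r \<in> {0<..<min (min \<epsilon> \<eta>) d}) (at_right 0)"
    using \<epsilon> \<eta> assms by (intro eventually_at_rightI[of 0 "min (min \<epsilon> \<eta>) d"]) auto
  ultimately show ?thesis by eventually_elim auto
qed

lemma density_limit: "((\<lambda>r. measure \<nu> (ball x r) / r ^ card S) \<longlongrightarrow> disc_vol S) (at_right 0)"
proof (rule tendsto_sandwich)
  have lim: "((\<lambda>r. (1 + a * (b * r)\<^sup>2) ^ card S * disc_vol S) \<longlongrightarrow> disc_vol S) (at_right 0)" for a b :: real
    by (intro tendsto_at_right_continuous continuous_intros) simp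
  show "((\<lambda>r. (1 - (2 * C * r)\<^sup>2) ^ card S * disc_vol S) \<longlongrightarrow> disc_vol S) (at_right 0)"
    using lim[of "- 1" "2 * C"] by simp
  show "((\<lambda>r. (1 + (C * r)\<^sup>2) ^ card S * disc_vol S) \<longlongrightarrow> disc_vol S) (at_right 0)"
    using lim[of 1 C] by simp
  show "eventually (\<lambda>r. (1 - (2 * C * r)\<^sup>2) ^ card S * disc_vol S \<le> measure \<nu> (ball x r) / r ^ card S) (at_right 0)"
    using small_radius[OF zero_less_one]
  proof eventually_elim
    case (elim r)
    then show ?case using measure_ball_ge[of r] by (simp add: pos_le_divide_eq mult_ac)
  qed
  show "eventually (\<lambda>r. measure \<nu> (ball x r) / r ^ card S \<le> (1 + (C * r)\<^sup>2) ^ card S * disc_vol S) (at_right 0)"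
    using small_radius[OF zero_less_one]
  proof eventually_elim
    case (elim r)
    then show ?case using measure_ball_le[of r] by (simp add: pos_divide_le_eq mult_ac)
  qed
qed

end

lemma set_integral_sum_real:
  fixes f :: "'i \<Rightarrow> 'a \<Rightarrow> real"
  assumes "\<And>i. i \<in> I \<Longrightarrow> set_integrable N A (f i)"
  shows "(LINT y:A|N. \<Sum>i\<in>I. f i y) = (\<Sum>i\<in>I. LINT y:A|N. f i y)"
  using assms by (simp add: set_lebesgue_integral_def set_integrable_def sum_distrib_left)

lemma coord_quadratic_integral:
  fixes S :: "'n::finite set" and a :: "'n \<Rightarrow> real" and q :: "'n \<Rightarrow> 'n \<Rightarrow> real"
  assumes r: "0 < r"
  shows "(LINT v:ball 0 r|coord_measure S. (\<Sum>i\<in>S. a i * v $ i) + (\<Sum>i\<in>S. \<Sum>j\<in>S. q i j * (v $ i * v $ j)))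
    = (\<Sum>i\<in>S. q i i) * (disc_vol S * r ^ (card S + 2) / (real (card S) + 2))"
proof -
  let ?\<tau> = "coord_measure S"
  have i1: "set_integrable ?\<tau> (ball 0 r) (\<lambda>v. a i * v $ i)" for i
    by (rule set_integrable_coord[OF r]) (intro continuous_intros)
  have i2: "set_integrable ?\<tau> (ball 0 r) (\<lambda>v. q i j * (v $ i * v $ j))" for i j
    by (rule set_integrable_coord[OF r]) (intro continuous_intros)
  have i3: "set_integrable ?\<tau> (ball 0 r) (\<lambda>v. \<Sum>j\<in>S. q i j * (v $ i * v $ j))" for i
    by (rule set_integrable_coord[OF r]) (intro continuous_intros)
  have i4: "set_integrable ?\<tau> (ball 0 r) (\<lambda>v. \<Sum>i\<in>S. a i * v $ i)"
    "set_integrable ?\<tau> (ball 0 r) (\<lambda>v. \<Sum>i\<in>S. \<Sum>j\<in>S. q i j * (v $ i * v $ j))"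
    by (rule set_integrable_coord[OF r], intro continuous_intros)+
  have inner: "(\<Sum>j\<in>S. q i j * (LINT v:ball 0 r|?\<tau>. v $ i * v $ j))
      = q i i * (disc_vol S * r ^ (card S + 2) / (real (card S) + 2))" if "i \<in> S" for i
  proof -
    have "(\<Sum>j\<in>S. q i j * (LINT v:ball 0 r|?\<tau>. v $ i * v $ j))
        = (\<Sum>j\<in>S. if j = i then q i i * (LINT v:ball 0 r|?\<tau>. v $ i * v $ i) else 0)"
      by (intro sum.cong refl) (simp add: coord_mixed_moment)
    also have "\<dots> = q i i * (LINT v:ball 0 r|?\<tau>. v $ i * v $ i)"
      using that by simp
    finally show ?thesis using coord_second_moment[OF r that] by (simp add: power2_eq_square)
  qed
  show ?thesis
    unfolding sum_distrib_right
    by (simp add: set_integral_add(2)[OF i4] set_integral_sum_real i1 i2 i3 coord_first_moment inner)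
qed

context nearly_flat
begin

text \<open>
  The one-sided estimate for \<open>g\<close> and for \<open>- g\<close>, with the lower bound for the mass of the ball.  Both
  parenthesised differences are \<open>O(r\<^sup>2)\<close>.
\<close>

lemma integral_projection_error:
  fixes g :: "real^'n \<Rightarrow> real"
  assumes r: "0 < r" "r \<le> \<epsilon>" "r \<le> \<eta>" "(2 * C * r)\<^sup>2 < 1"
    and g: "continuous_on UNIV g" and K: "\<And>v. norm v < r \<Longrightarrow> \<bar>g v\<bar> \<le> K"
  shows "\<bar>(LINT y:ball x r|\<nu>. g (\<pi> (y - x))) - (LINT v:ball 0 r|coord_measure S. g v)\<bar>
    \<le> ((1 + (C * r)\<^sup>2) ^ card S - 1) * \<bar>LINT v:ball 0 r|coord_measure S. g v\<bar>
      + K * (r ^ card S * disc_vol S) * ((1 + (C * r)\<^sup>2) ^ card S - (1 - (2 * C * r)\<^sup>2) ^ card S)"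
proof -
  define L where "L = (1 + (C * r)\<^sup>2) ^ card S"
  define I where "I = (LINT v:ball 0 r|coord_measure S. g v)"
  have L: "1 \<le> L" unfolding L_def by (intro one_le_power) simp
  have K0: "0 \<le> K" using K[of 0] r by (smt (verit) abs_ge_zero norm_zero)
  have "K * ((1 - (2 * C * r)\<^sup>2) ^ card S * (r ^ card S * disc_vol S)) \<le> K * measure \<nu> (ball x r)"
    using r K0 by (intro mult_left_mono measure_ball_ge) auto
  then have rest: "K * (L * (r ^ card S * disc_vol S) - measure \<nu> (ball x r))
      \<le> K * (r ^ card S * disc_vol S) * (L - (1 - (2 * C * r)\<^sup>2) ^ card S)"
    by (simp add: algebra_simps)
  have up: "(LINT y:ball x r|\<nu>. g (\<pi> (y - x))) \<le> L * I + K * (L * (r ^ card S * disc_vol S) - measure \<nu> (ball x r))"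
    unfolding L_def I_def by (rule integral_projection_le[OF r(1,2) g K])
  have "(LINT y:ball x r|\<nu>. - g (\<pi> (y - x)))
      \<le> L * (LINT v:ball 0 r|coord_measure S. - g v) + K * (L * (r ^ card S * disc_vol S) - measure \<nu> (ball x r))"
    unfolding L_def using K by (intro integral_projection_le[OF r(1,2)] continuous_intros g) auto
  then have low: "- (LINT y:ball x r|\<nu>. g (\<pi> (y - x)))
      \<le> - (L * I) + K * (L * (r ^ card S * disc_vol S) - measure \<nu> (ball x r))"
    by (simp add: set_integral_uminus_real I_def)
  have "\<bar>L * I - I\<bar> = (L - 1) * \<bar>I\<bar>"
    using L abs_mult[of "L - 1" I] by (simp add: left_diff_distrib)
  then show ?thesis using up low rest unfolding L_def[symmetric] I_def[symmetric] by linarith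
qed

text \<open>
  For \<open>r \<le> 1\<close> the function \<open>g\<close> is bounded by a constant times \<open>r\<close> on the ball, so \<open>integral_projection_error\<close> replaces its integral
  over \<open>M\<close> by the one over the flat disc with an error \<open>o(r\<^bsup>m+2\<^esup>)\<close>; there only the diagonal of \<open>q\<close>
  survives.
\<close>

theorem amv_limit:
  fixes a :: "'n \<Rightarrow> real" and q :: "'n \<Rightarrow> 'n \<Rightarrow> real" and u :: "real^'n \<Rightarrow> real"
  defines "g \<equiv> \<lambda>v. (\<Sum>i\<in>S. a i * v $ i) + (\<Sum>i\<in>S. \<Sum>j\<in>S. q i j * (v $ i * v $ j))"
  assumes u: "continuous_on UNIV u"
    and expansion: "\<And>e. 0 < e \<Longrightarrow> \<exists>d>0. \<forall>y\<in>M. dist x y < d \<longrightarrow>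
        \<bar>u y - u x - g (\<pi> (y - x))\<bar> \<le> e * (dist x y)\<^sup>2"
  shows "((\<lambda>r. amv_laplacian_r \<nu> r u x) \<longlongrightarrow> (\<Sum>i\<in>S. q i i) / (real (card S) + 2)) (at_right 0)"
proof -
  let ?m = "card S"
  let ?\<tau> = "coord_measure S"
  let ?p = "\<lambda>y. \<pi> (y - x)"
  define T where "T = (\<Sum>i\<in>S. q i i) * (disc_vol S / (real ?m + 2))"
  define D where "D r = (1 + (C * r)\<^sup>2) ^ ?m - (1 - (2 * C * r)\<^sup>2) ^ ?m" for r
  define K where "K = (\<Sum>i\<in>S. \<bar>a i\<bar>) + (\<Sum>i\<in>S. \<Sum>j\<in>S. \<bar>q i j\<bar>)"
  have cg: "continuous_on UNIV g" unfolding g_def by (intro continuous_intros)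
  have gI: "(LINT v:ball 0 r|?\<tau>. g v) = T * r ^ (?m + 2)" if "0 < r" for r
    using coord_quadratic_integral[OF that, where S=S and a=a and q=q] by (simp add: g_def T_def)
  have gK: "\<bar>g v\<bar> \<le> K * r" if v: "norm v < r" and "r \<le> 1" for v r
  proof -
    have c: "\<bar>v $ i\<bar> \<le> r" for i using component_le_norm_cart[of v i] v by simp
    have r0: "0 \<le> r" using v norm_ge_zero[of v] by linarith
    have cc: "\<bar>v $ i * v $ j\<bar> \<le> r" for i j
    proof -
      have "\<bar>v $ i\<bar> * \<bar>v $ j\<bar> \<le> r * 1" using c[of i] c[of j] r0 \<open>r \<le> 1\<close> by (intro mult_mono) auto
      then show ?thesis by (simp add: abs_mult)
    qed
    have "\<bar>\<Sum>i\<in>S. a i * v $ i\<bar> \<le> (\<Sum>i\<in>S. \<bar>a i\<bar> * r)"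
      by (rule order_trans[OF sum_abs]) (auto simp: abs_mult intro!: sum_mono mult_left_mono c)
    moreover have "\<bar>\<Sum>i\<in>S. \<Sum>j\<in>S. q i j * (v $ i * v $ j)\<bar> \<le> (\<Sum>i\<in>S. \<Sum>j\<in>S. \<bar>q i j\<bar> * r)"
      by (rule order_trans[OF sum_abs] sum_mono)+
         (simp add: abs_mult[of "q _ _"] mult_left_mono cc)
    ultimately have "\<bar>g v\<bar> \<le> (\<Sum>i\<in>S. \<bar>a i\<bar> * r) + (\<Sum>i\<in>S. \<Sum>j\<in>S. \<bar>q i j\<bar> * r)"
      unfolding g_def by linarith
    then show ?thesis by (simp add: K_def sum_distrib_right distrib_right)
  qed
  have D0: "((\<lambda>r. D r / r) \<longlongrightarrow> 0) (at_right 0)"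
  proof -
    have "(D has_real_derivative 0) (at 0)"
      unfolding D_def by (auto intro!: derivative_eq_intros)
    then have "((\<lambda>r. (D r - D 0) / (r - 0)) \<longlongrightarrow> 0) (at 0)" by (simp add: has_field_derivative_iff)
    then have "((\<lambda>r. D r / r) \<longlongrightarrow> 0) (at 0)" by (simp add: D_def)
    then show ?thesis by (simp add: filterlim_at_split)
  qed
  have P0: "((\<lambda>r. (1 + (C * r)\<^sup>2) ^ ?m - 1) \<longlongrightarrow> 0) (at_right 0)"
    by (intro tendsto_at_right_continuous continuous_intros) simp
  have model: "((\<lambda>r. (LINT y:ball x r|\<nu>. g (?p y)) / r ^ (?m + 2) - T) \<longlongrightarrow> 0) (at_right 0)"
  proof (rule Lim_null_comparison)
    have "((\<lambda>r. ((1 + (C * r)\<^sup>2) ^ ?m - 1) * \<bar>T\<bar> + K * disc_vol S * (D r / r)) \<longlongrightarrow> 0 * \<bar>T\<bar> + K * disc_vol S * 0) (at_right 0)"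
      by (intro tendsto_intros D0 P0)
    then show "((\<lambda>r. ((1 + (C * r)\<^sup>2) ^ ?m - 1) * \<bar>T\<bar> + K * disc_vol S * (D r / r)) \<longlongrightarrow> 0) (at_right 0)"
      by simp
    show "eventually (\<lambda>r. norm ((LINT y:ball x r|\<nu>. g (?p y)) / r ^ (?m + 2) - T)
        \<le> ((1 + (C * r)\<^sup>2) ^ ?m - 1) * \<bar>T\<bar> + K * disc_vol S * (D r / r)) (at_right 0)"
      using small_radius[OF zero_less_one]
    proof eventually_elim
      case (elim r)
      then have r: "0 < r" "r \<le> \<epsilon>" "r \<le> \<eta>" "(2 * C * r)\<^sup>2 < 1" "r \<le> 1" by auto
      let ?R = "r ^ (?m + 2)"
      have R: "0 < ?R" using r by simp
      have "\<bar>(LINT y:ball x r|\<nu>. g (?p y)) - T * ?R\<bar>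
          \<le> ((1 + (C * r)\<^sup>2) ^ ?m - 1) * \<bar>T * ?R\<bar> + (K * r) * (r ^ ?m * disc_vol S) * D r"
        using integral_projection_error[OF r(1-4) cg gK[OF _ r(5)]] unfolding gI[OF r(1)] D_def by blast
      also have "\<dots> = (((1 + (C * r)\<^sup>2) ^ ?m - 1) * \<bar>T\<bar> + K * disc_vol S * (D r / r)) * ?R"
        using r by (simp add: abs_mult field_simps power2_eq_square)
      finally have "\<bar>(LINT y:ball x r|\<nu>. g (?p y)) - T * ?R\<bar> / ?R
          \<le> ((1 + (C * r)\<^sup>2) ^ ?m - 1) * \<bar>T\<bar> + K * disc_vol S * (D r / r)"
        using R by (simp only: pos_divide_le_eq)
      moreover have "(LINT y:ball x r|\<nu>. g (?p y)) / ?R - T = ((LINT y:ball x r|\<nu>. g (?p y)) - T * ?R) / ?R"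
        using r by (simp add: diff_divide_distrib)
      ultimately show ?case using R by (simp only: real_norm_def abs_divide abs_of_pos)
    qed
  qed
  have remainder: "((\<lambda>r. ((LINT y:ball x r|\<nu>. u y - u x) - (LINT y:ball x r|\<nu>. g (?p y))) / r ^ (?m + 2)) \<longlongrightarrow> 0) (at_right 0)"
  proof (rule tendstoI)
    fix e :: real assume "0 < e"
    define e' where "e' = e / (2 * disc_vol S)"
    have e': "0 < e'" using \<open>0 < e\<close> disc_vol_pos[of S] by (simp add: e'_def)
    obtain d where d: "0 < d" "\<And>y. y \<in> M \<Longrightarrow> dist x y < d \<Longrightarrow> \<bar>u y - u x - g (?p y)\<bar> \<le> e' * (dist x y)\<^sup>2"
      using expansion[OF e'] by blast
    have "eventually (\<lambda>r. measure \<nu> (ball x r) / r ^ ?m < 2 * disc_vol S) (at_right 0)"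
      using disc_vol_pos[of S] by (intro order_tendstoD(2)[OF density_limit]) simp
    then show "eventually (\<lambda>r. dist (((LINT y:ball x r|\<nu>. u y - u x) - (LINT y:ball x r|\<nu>. g (?p y))) / r ^ (?m + 2)) 0 < e) (at_right 0)"
      using small_radius[OF d(1)]
    proof eventually_elim
      case (elim r)
      then have r: "0 < r" "r \<le> \<epsilon>" "r < d" by auto
      have i1: "set_integrable \<nu> (ball x r) (\<lambda>y. u y - u x)"
        using emeasure_ball_finite[OF r(1,2)]
        by (intro set_integrable_continuous_bounded continuous_intros u) auto
      have i2: "set_integrable \<nu> (ball x r) (\<lambda>y. g (?p y))"
        using emeasure_ball_finite[OF r(1,2)] continuous_on_compose2[OF cg continuous_proj]
        by (intro set_integrable_continuous_bounded) auto
      have i3: "set_integrable \<nu> (ball x r) (\<lambda>y. e' * r\<^sup>2)"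
        using emeasure_ball_finite[OF r(1,2)]
        by (intro set_integrable_continuous_bounded) (auto intro!: continuous_intros)
      have "norm ((LINT y:ball x r|\<nu>. u y - u x) - (LINT y:ball x r|\<nu>. g (?p y)))
          = norm (LINT y|\<nu>. indicator (ball x r) y *\<^sub>R ((u y - u x) - g (?p y)))"
        by (subst set_integral_diff(2)[OF i1 i2, symmetric]) (simp add: set_lebesgue_integral_def)
      also have "\<dots> \<le> (LINT y|\<nu>. norm (indicator (ball x r) y *\<^sub>R ((u y - u x) - g (?p y))))"
        by (rule integral_norm_bound)
      also have "\<dots> \<le> (LINT y|\<nu>. indicator (ball x r) y *\<^sub>R (e' * r\<^sup>2))"
      proof (rule integral_mono_AE)
        show "integrable \<nu> (\<lambda>y. norm (indicator (ball x r) y *\<^sub>R ((u y - u x) - g (?p y))))"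
          using set_integral_diff(1)[OF i1 i2] unfolding set_integrable_def by (rule integrable_norm)
        show "integrable \<nu> (\<lambda>y. indicator (ball x r) y *\<^sub>R (e' * r\<^sup>2))"
          using i3 by (simp add: set_integrable_def)
        have "AE y in \<nu>. y \<in> M"
          using closed_M by (intro AE_I[of _ _ "- M"]) (auto simp: emeasure_\<nu>)
        then show "AE y in \<nu>. norm (indicator (ball x r) y *\<^sub>R ((u y - u x) - g (?p y)))
            \<le> indicator (ball x r) y *\<^sub>R (e' * r\<^sup>2)"
        proof eventually_elim
          case (elim y)
          show ?case
          proof (cases "y \<in> ball x r")
            case True
            then have "\<bar>u y - u x - g (?p y)\<bar> \<le> e' * (dist x y)\<^sup>2"
              using d(2)[OF elim] r by simp
            also have "\<dots> \<le> e' * r\<^sup>2"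
              using True e' by (intro mult_left_mono power_mono) auto
            finally show ?thesis using True by simp
          qed simp
        qed
      qed
      also have "\<dots> = e' * r\<^sup>2 * measure \<nu> (ball x r)" by simp
      finally have "norm ((LINT y:ball x r|\<nu>. u y - u x) - (LINT y:ball x r|\<nu>. g (?p y))) / r ^ (?m + 2)
          \<le> e' * r\<^sup>2 * measure \<nu> (ball x r) / r ^ (?m + 2)"
        using r by (intro divide_right_mono) auto
      also have "\<dots> = e' * (measure \<nu> (ball x r) / r ^ ?m)"
        using r by (simp add: power_add field_simps power2_eq_square)
      also have "\<dots> < e' * (2 * disc_vol S)"
        using elim e' by (intro mult_strict_left_mono) auto
      also have "\<dots> = e" using disc_vol_pos[of S] by (simp add: e'_def)
      finally show ?case using r by (simp add: dist_norm)
    qed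
  qed
  have "((\<lambda>r. (LINT y:ball x r|\<nu>. u y - u x) / r ^ (?m + 2) - T) \<longlongrightarrow> 0) (at_right 0)"
    using tendsto_add[OF model remainder] by (simp add: diff_divide_distrib)
  then have "((\<lambda>r. (LINT y:ball x r|\<nu>. u y - u x) / r ^ (?m + 2)) \<longlongrightarrow> T) (at_right 0)"
    by (simp add: LIM_zero_iff)
  then have "((\<lambda>r. ((LINT y:ball x r|\<nu>. u y - u x) / r ^ (?m + 2)) / (measure \<nu> (ball x r) / r ^ ?m)) \<longlongrightarrow> T / disc_vol S) (at_right 0)"
    using disc_vol_pos[of S] by (intro tendsto_divide density_limit) auto
  moreover have "T / disc_vol S = (\<Sum>i\<in>S. q i i) / (real ?m + 2)"
    using disc_vol_pos[of S] by (simp add: T_def)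
  moreover have "eventually (\<lambda>r. ((LINT y:ball x r|\<nu>. u y - u x) / r ^ (?m + 2)) / (measure \<nu> (ball x r) / r ^ ?m)
      = amv_laplacian_r \<nu> r u x) (at_right 0)"
    using small_radius[OF zero_less_one]
    by eventually_elim (simp add: amv_laplacian_r_def power_add field_simps power2_eq_square)
  ultimately show ?thesis by (auto elim: Lim_transform_eventually)
qed

end

section \<open>Second order calculus at a point\<close>

text \<open>
  Here \<open>f'' v \<xi>\<close> is the derivative in direction \<open>\<xi>\<close> of the directional derivative \<open>\<lambda>w. f' w v\<close>.  Second
  derivatives are required at the single point \<open>p\<close>, which suffices for the Taylor formula and for
  their symmetry, and is stable under composition.
\<close>

definition twice_derivative ::
  "(real^'n \<Rightarrow> 'b::real_normed_vector) \<Rightarrow> (real^'n \<Rightarrow> real^'n \<Rightarrow> 'b) \<Rightarrow> (real^'n \<Rightarrow> real^'n \<Rightarrow> 'b) \<Rightarrow> real^'n \<Rightarrow> bool" where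
  "twice_derivative f f' f'' p \<longleftrightarrow>
     (\<forall>\<^sub>F w in nhds p. (f has_derivative f' w) (at w)) \<and>
     (\<forall>v. ((\<lambda>w. f' w v) has_derivative f'' v) (at p))"

lemma twice_derivativeD1: "twice_derivative f f' f'' p \<Longrightarrow> (f has_derivative f' p) (at p)"
  unfolding twice_derivative_def using eventually_nhds_x_imp_x by blast

lemma twice_derivativeD2: "twice_derivative f f' f'' p \<Longrightarrow> ((\<lambda>w. f' w v) has_derivative f'' v) (at p)"
  by (simp add: twice_derivative_def)

lemma twice_derivative_linear1: "twice_derivative f f' f'' p \<Longrightarrow> linear (f' p)"
  using twice_derivativeD1 has_derivative_bounded_linear bounded_linear.linear by blast

lemma twice_derivative_linear2: "twice_derivative f f' f'' p \<Longrightarrow> linear (f'' v)"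
  using twice_derivativeD2 has_derivative_bounded_linear bounded_linear.linear by blast

lemma twice_derivative_ball:
  assumes "twice_derivative f f' f'' p"
  obtains e where "0 < e" "\<And>w. w \<in> ball p e \<Longrightarrow> (f has_derivative f' w) (at w)"
  using assms unfolding twice_derivative_def eventually_nhds_metric
  by (metis dist_commute mem_ball)

lemma Ck_on_2_imp_twice_derivative:
  assumes "Ck_on 2 U f" "open U" "p \<in> U"
  obtains f' f'' where "twice_derivative f f' f'' p"
proof -
  obtain f' where f': "\<And>w. w \<in> U \<Longrightarrow> (f has_derivative f' w) (at w)"
    and f'': "\<And>v. \<exists>f''. \<forall>w\<in>U. ((\<lambda>w. f' w v) has_derivative f'' w) (at w)"
    using assms(1) by (simp add: numeral_2_eq_2) blast
  have "\<forall>v. \<exists>D. ((\<lambda>w. f' w v) has_derivative D) (at p)" using f'' assms(3) by blast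
  then obtain f'' where f'': "\<And>v. ((\<lambda>w. f' w v) has_derivative f'' v) (at p)" by metis
  have "eventually (\<lambda>w. w \<in> U) (nhds p)" using assms by (simp add: eventually_nhds_in_open)
  then have "eventually (\<lambda>w. (f has_derivative f' w) (at w)) (nhds p)"
    by eventually_elim (rule f')
  then show ?thesis using that f'' unfolding twice_derivative_def by blast
qed

lemma linear_axis_expand:
  fixes L :: "real^'n \<Rightarrow> 'b::real_normed_vector"
  assumes "linear L"
  shows "L v = (\<Sum>i\<in>UNIV. v $ i *\<^sub>R L (axis i 1))"
proof -
  have "v = (\<Sum>i\<in>UNIV. v $ i *\<^sub>R axis i 1)"
    using basis_expansion[of v] by (simp add: scalar_mult_eq_scaleR)
  then have "L v = L (\<Sum>i\<in>UNIV. v $ i *\<^sub>R axis i 1)" by simp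
  then show ?thesis by (simp add: linear_sum[OF assms] linear_cmul[OF assms])
qed

lemma twice_derivative_first_order:
  fixes f :: "real^'n \<Rightarrow> 'b::real_normed_vector"
  assumes tw: "twice_derivative f f' f'' p" and "0 < e"
  obtains d where "0 < d" "\<And>\<xi>. norm \<xi> < d \<Longrightarrow> (f has_derivative f' (p + \<xi>)) (at (p + \<xi>))"
    "\<And>\<xi>. norm \<xi> < d \<Longrightarrow> norm (f' (p + \<xi>) v - f' p v - f'' v \<xi>) \<le> e * norm \<xi>"
proof -
  obtain d1 where d1: "0 < d1" "\<And>w. w \<in> ball p d1 \<Longrightarrow> (f has_derivative f' w) (at w)"
    using twice_derivative_ball[OF tw] by blast
  obtain d2 where d2: "0 < d2" "\<And>y. norm (y - p) < d2 \<Longrightarrow> norm (f' y v - f' p v - f'' v (y - p)) \<le> e * norm (y - p)"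
    using twice_derivativeD2[OF tw, of v] \<open>0 < e\<close> unfolding has_derivative_at_alt by metis
  show ?thesis
  proof (rule that[of "min d1 d2"])
    fix \<xi> :: "real^'n" assume "norm \<xi> < min d1 d2"
    then show "(f has_derivative f' (p + \<xi>)) (at (p + \<xi>))"
      "norm (f' (p + \<xi>) v - f' p v - f'' v \<xi>) \<le> e * norm \<xi>"
      using d1(2)[of "p + \<xi>"] d2(2)[of "p + \<xi>"] by (auto simp: dist_norm)
  qed (use d1 d2 in simp)
qed

lemma twice_derivative_basis_estimate:
  fixes f :: "real^'n \<Rightarrow> 'b::real_normed_vector"
  assumes tw: "twice_derivative f f' f'' p" and "0 < e"
  obtains d where "0 < d" "\<And>\<xi>. norm \<xi> < d \<Longrightarrow> (f has_derivative f' (p + \<xi>)) (at (p + \<xi>))"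
    "\<And>\<xi> i. norm \<xi> < d \<Longrightarrow> norm (f' (p + \<xi>) (axis i 1) - f' p (axis i 1) - f'' (axis i 1) \<xi>) \<le> e * norm \<xi>"
proof -
  have "\<exists>d>0. \<forall>\<xi>. norm \<xi> < d \<longrightarrow> (f has_derivative f' (p + \<xi>)) (at (p + \<xi>)) \<and>
      norm (f' (p + \<xi>) (axis i 1) - f' p (axis i 1) - f'' (axis i 1) \<xi>) \<le> e * norm \<xi>" for i
    using twice_derivative_first_order[OF tw \<open>0 < e\<close>, of "axis i 1"] by metis
  then obtain d where d: "\<And>i. 0 < d i" "\<And>i \<xi>. norm \<xi> < d i \<Longrightarrow> (f has_derivative f' (p + \<xi>)) (at (p + \<xi>)) \<and>
      norm (f' (p + \<xi>) (axis i 1) - f' p (axis i 1) - f'' (axis i 1) \<xi>) \<le> e * norm \<xi>"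
    by metis
  show ?thesis
  proof (rule that[of "Min (range d)"])
    show "0 < Min (range d)" using d(1) by (subst Min_gr_iff) auto
    fix \<xi> :: "real^'n" assume "norm \<xi> < Min (range d)"
    then have small: "norm \<xi> < d i" for i by (meson Min_le finite_imageI finite less_le_trans rangeI)
    then show "(f has_derivative f' (p + \<xi>)) (at (p + \<xi>))" using d(2) by blast
    show "norm (f' (p + \<xi>) (axis i 1) - f' p (axis i 1) - f'' (axis i 1) \<xi>) \<le> e * norm \<xi>" for i
      using d(2) small by blast
  qed
qed

text \<open>
  At distance \<open>\<rho>\<close> from \<open>p\<close> the derivative differs from \<open>f' p\<close> by \<open>O(\<rho>)\<close>; the claim is the mean value
  inequality for \<open>f - f' p\<close>.
\<close>

lemma twice_derivative_quadratic_remainder: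
  fixes f :: "real^'n \<Rightarrow> 'b::real_normed_vector"
  assumes tw: "twice_derivative f f' f'' p"
  obtains C d where "0 \<le> C" "0 < d"
    "\<And>\<rho> w w'. \<rho> \<le> d \<Longrightarrow> w \<in> cball p \<rho> \<Longrightarrow> w' \<in> cball p \<rho> \<Longrightarrow>
      norm (f w - f w' - f' p (w - w')) \<le> C * \<rho> * norm (w - w')"
proof -
  obtain d where d: "0 < d" "\<And>\<xi>. norm \<xi> < d \<Longrightarrow> (f has_derivative f' (p + \<xi>)) (at (p + \<xi>))"
    "\<And>\<xi> i. norm \<xi> < d \<Longrightarrow> norm (f' (p + \<xi>) (axis i 1) - f' p (axis i 1) - f'' (axis i 1) \<xi>) \<le> 1 * norm \<xi>"
    using twice_derivative_basis_estimate[OF tw zero_less_one] by metis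
  have bl: "bounded_linear (f'' v)" for v
    using twice_derivativeD2[OF tw] by (rule has_derivative_bounded_linear)
  define C where "C = (\<Sum>i\<in>UNIV. onorm (f'' (axis i 1)) + 1)"
  have C: "0 \<le> C" unfolding C_def by (intro sum_nonneg add_nonneg_nonneg onorm_pos_le bl) auto
  have lp: "linear (f' p)" by (rule twice_derivative_linear1[OF tw])
  have dev: "norm (f' w h - f' p h) \<le> C * norm (w - p) * norm h" if "norm (w - p) < d" for w h
  proof -
    have lw: "linear (f' w)" using d(2)[of "w - p"] that
      by (simp add: has_derivative_bounded_linear bounded_linear.linear)
    have e: "norm (f' w (axis i 1) - f' p (axis i 1)) \<le> (onorm (f'' (axis i 1)) + 1) * norm (w - p)" for i
    proof -
      have "norm (f' w (axis i 1) - f' p (axis i 1)) \<le> norm (f'' (axis i 1) (w - p)) + 1 * norm (w - p)"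
        using d(3)[of "w - p" i] that norm_triangle_sub[of "f' w (axis i 1) - f' p (axis i 1)" "f'' (axis i 1) (w - p)"]
        by simp
      also have "\<dots> \<le> onorm (f'' (axis i 1)) * norm (w - p) + 1 * norm (w - p)"
        using onorm[OF bl] by (intro add_mono) auto
      finally show ?thesis by (simp add: distrib_right)
    qed
    have "f' w h - f' p h = (\<Sum>i\<in>UNIV. h $ i *\<^sub>R (f' w (axis i 1) - f' p (axis i 1)))"
      by (subst linear_axis_expand[OF lw], subst linear_axis_expand[OF lp])
        (simp add: scaleR_diff_right sum_subtractf)
    also have "norm \<dots> \<le> (\<Sum>i\<in>UNIV. norm h * ((onorm (f'' (axis i 1)) + 1) * norm (w - p)))"
      by (rule order_trans[OF norm_sum])
        (auto intro!: sum_mono mult_mono e component_le_norm_cart)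
    also have "\<dots> = C * norm (w - p) * norm h"
      by (simp add: C_def sum_distrib_left sum_distrib_right mult_ac)
    finally show ?thesis .
  qed
  show ?thesis
  proof (rule that[OF C, of "d / 2"])
    fix \<rho> :: real and w w' :: "real^'n" assume \<rho>: "\<rho> \<le> d / 2" and w: "w \<in> cball p \<rho>" "w' \<in> cball p \<rho>"
    have "norm ((f w - f' p w) - (f w' - f' p w')) \<le> (C * \<rho>) * norm (w - w')"
    proof (rule differentiable_bound[where S="cball p \<rho>" and f'="\<lambda>z h. f' z h - f' p h"])
      fix z assume "z \<in> cball p \<rho>"
      then have z: "norm (z - p) \<le> \<rho>" by (simp add: dist_norm norm_minus_commute)
      then have zd: "norm (z - p) < d" using \<rho> d(1) by linarith
      have "((\<lambda>z. f z - f' p z) has_derivative (\<lambda>h. f' z h - f' p h)) (at z)"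
        using d(2)[OF zd] lp by (intro has_derivative_diff linear_imp_has_derivative) auto
      then show "((\<lambda>z. f z - f' p z) has_derivative (\<lambda>h. f' z h - f' p h)) (at z within cball p \<rho>)"
        by (rule has_derivative_at_withinI)
      show "onorm (\<lambda>h. f' z h - f' p h) \<le> C * \<rho>"
      proof (rule onorm_bound)
        show "0 \<le> C * \<rho>" using C z norm_ge_zero[of "z - p"] by (metis mult_nonneg_nonneg order_trans)
        fix h
        have "norm (f' z h - f' p h) \<le> C * norm (z - p) * norm h" by (rule dev[OF zd])
        also have "\<dots> \<le> C * \<rho> * norm h" using z C by (intro mult_right_mono mult_left_mono) auto
        finally show "norm (f' z h - f' p h) \<le> C * \<rho> * norm h" .
      qed
    qed (use w in auto)
    moreover have "(f w - f' p w) - (f w' - f' p w') = f w - f w' - f' p (w - w')"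
      by (simp add: linear_diff[OF lp])
    ultimately show "norm (f w - f w' - f' p (w - w')) \<le> C * \<rho> * norm (w - w')" by simp
  qed (use d in simp)
qed

text \<open>
  Along the segment \<open>s \<mapsto> p + s z\<close> the derivative of the remainder is \<open>o(\<bar>z\<bar>\<^sup>2)\<close>, because the first
  derivative is differentiable at \<open>p\<close>.
\<close>

lemma taylor_second_order:
  fixes h :: "real^'n \<Rightarrow> real"
  assumes tw: "twice_derivative h h' h'' p" and "0 < e"
  obtains d where "0 < d" "\<And>z. norm z < d \<Longrightarrow>
    \<bar>h (p + z) - h p - h' p z - (\<Sum>i\<in>UNIV. \<Sum>j\<in>UNIV. z $ i * z $ j * h'' (axis j 1) (axis i 1)) / 2\<bar> \<le> e * (norm z)\<^sup>2"
proof -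
  define e' where "e' = e / real CARD('n)"
  have e': "0 < e'" using \<open>0 < e\<close> by (simp add: e'_def)
  obtain d where d: "0 < d" "\<And>\<xi>. norm \<xi> < d \<Longrightarrow> (h has_derivative h' (p + \<xi>)) (at (p + \<xi>))"
    "\<And>\<xi> i. norm \<xi> < d \<Longrightarrow> norm (h' (p + \<xi>) (axis i 1) - h' p (axis i 1) - h'' (axis i 1) \<xi>) \<le> e' * norm \<xi>"
    using twice_derivative_basis_estimate[OF tw e'] by metis
  have l'': "linear (h'' v)" for v
    by (rule twice_derivative_linear2[OF tw])
  have lp: "linear (h' p)" by (rule twice_derivative_linear1[OF tw])
  show ?thesis
  proof (rule that[OF d(1)])
    fix z :: "real^'n" assume z: "norm z < d"
    define B where "B = (\<Sum>j\<in>UNIV. z $ j * h'' (axis j 1) z)"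
    have B: "B = (\<Sum>i\<in>UNIV. \<Sum>j\<in>UNIV. z $ i * z $ j * h'' (axis j 1) (axis i 1))"
    proof -
      have "h'' (axis j 1) z = (\<Sum>i\<in>UNIV. z $ i * h'' (axis j 1) (axis i 1))" for j
        using linear_axis_expand[OF l'', of "axis j 1" z] by simp
      then have "B = (\<Sum>j\<in>UNIV. \<Sum>i\<in>UNIV. z $ i * z $ j * h'' (axis j 1) (axis i 1))"
        by (simp add: B_def sum_distrib_left mult_ac)
      then show ?thesis by (subst sum.swap)
    qed
    define \<phi> where "\<phi> s = h (p + s *\<^sub>R z) - s * h' p z - s\<^sup>2 / 2 * B" for s :: real
    have small: "norm (s *\<^sub>R z) < d" if "0 \<le> s" "s \<le> 1" for s
      using mult_left_le_one_le[of "norm z" s] that z by simp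
    have "norm (\<phi> 1 - \<phi> 0) \<le> (e * (norm z)\<^sup>2) * norm (1 - 0 :: real)"
    proof (rule differentiable_bound[where S="{0..1}" and f'="\<lambda>s t. t * (h' (p + s *\<^sub>R z) z - h' p z - s * B)"])
      fix s :: real assume s: "s \<in> {0..1}"
      have "(h has_derivative h' (p + s *\<^sub>R z)) (at (p + s *\<^sub>R z))" using small d(2) s by simp
      then have "((\<lambda>s. h (p + s *\<^sub>R z)) has_derivative (\<lambda>t. h' (p + s *\<^sub>R z) (t *\<^sub>R z))) (at s)"
        by (rule has_derivative_compose[rotated]) (auto intro!: derivative_eq_intros)
      then have "(\<phi> has_derivative (\<lambda>t. h' (p + s *\<^sub>R z) (t *\<^sub>R z) - t * h' p z - t * s * B)) (at s)"
        unfolding \<phi>_def by (auto intro!: derivative_eq_intros)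
      moreover have ls: "linear (h' (p + s *\<^sub>R z))"
        using small d(2) s by (meson atLeastAtMost_iff has_derivative_bounded_linear bounded_linear.linear)
      then have "h' (p + s *\<^sub>R z) (t *\<^sub>R z) = t * h' (p + s *\<^sub>R z) z" for t
        by (simp add: linear_cmul)
      then have "(\<lambda>t. h' (p + s *\<^sub>R z) (t *\<^sub>R z) - t * h' p z - t * s * B)
          = (\<lambda>t. t * (h' (p + s *\<^sub>R z) z - h' p z - s * B))"
        by (simp add: fun_eq_iff right_diff_distrib)
      ultimately show "(\<phi> has_derivative (\<lambda>t. t * (h' (p + s *\<^sub>R z) z - h' p z - s * B))) (at s within {0..1})"
        by (simp add: has_derivative_at_withinI)
      have "h' (p + s *\<^sub>R z) z - h' p z - s * B
          = (\<Sum>j\<in>UNIV. z $ j * (h' (p + s *\<^sub>R z) (axis j 1) - h' p (axis j 1) - h'' (axis j 1) (s *\<^sub>R z)))"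
        unfolding B_def linear_axis_expand[OF ls, of z] linear_axis_expand[OF lp, of z]
        by (simp add: linear_cmul[OF l''] sum_distrib_left right_diff_distrib sum_subtractf mult_ac)
      also have "\<bar>\<dots>\<bar> \<le> (\<Sum>j\<in>(UNIV::'n set). norm z * (e' * norm z))"
      proof (rule order_trans[OF sum_abs sum_mono])
        fix j
        have "\<bar>h' (p + s *\<^sub>R z) (axis j 1) - h' p (axis j 1) - h'' (axis j 1) (s *\<^sub>R z)\<bar> \<le> e' * norm (s *\<^sub>R z)"
          using d(3)[OF small] s by simp
        also have "\<dots> \<le> e' * norm z" using s e' mult_left_le_one_le[of "norm z" s] by (intro mult_left_mono) auto
        finally show "\<bar>z $ j * (h' (p + s *\<^sub>R z) (axis j 1) - h' p (axis j 1) - h'' (axis j 1) (s *\<^sub>R z))\<bar>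
            \<le> norm z * (e' * norm z)"
          unfolding abs_mult by (intro mult_mono component_le_norm_cart) auto
      qed
      also have "\<dots> = e * (norm z)\<^sup>2" by (simp add: e'_def power2_eq_square)
      finally have bd: "\<bar>h' (p + s *\<^sub>R z) z - h' p z - s * B\<bar> \<le> e * (norm z)\<^sup>2" .
      show "onorm (\<lambda>t. t * (h' (p + s *\<^sub>R z) z - h' p z - s * B)) \<le> e * (norm z)\<^sup>2"
        using \<open>0 < e\<close> mult_left_mono[OF bd, of "\<bar>t\<bar>" for t]
        by (intro onorm_bound) (auto simp: abs_mult mult_ac)
    qed auto
    moreover have "\<phi> 1 - \<phi> 0 = h (p + z) - h p - h' p z - B / 2" by (simp add: \<phi>_def)
    ultimately show "\<bar>h (p + z) - h p - h' p z - (\<Sum>i\<in>UNIV. \<Sum>j\<in>UNIV. z $ i * z $ j * h'' (axis j 1) (axis i 1)) / 2\<bar>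
        \<le> e * (norm z)\<^sup>2"
      by (simp add: B)
  qed
qed

text \<open>
  The mean value theorem in direction \<open>v\<close> turns the second difference into a difference of values of
  \<open>\<lambda>w. f' w v\<close>, which is differentiable at \<open>p\<close>.  The quotient is symmetric in \<open>v\<close> and \<open>w\<close>, hence so is
  its limit.
\<close>

lemma second_difference_limit:
  fixes f :: "real^'n \<Rightarrow> real"
  assumes tw: "twice_derivative f f' f'' p"
  shows "((\<lambda>s. (f (p + s *\<^sub>R v + s *\<^sub>R w) - f (p + s *\<^sub>R v) - f (p + s *\<^sub>R w) + f p) / s\<^sup>2) \<longlongrightarrow> f'' v w) (at_right 0)"
proof (rule tendstoI)
  fix e :: real assume "0 < e"
  let ?n = "norm v + norm w + 1"
  have n: "0 < ?n" by (simp add: add_nonneg_pos)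
  define e' where "e' = e / (3 * ?n)"
  have e': "0 < e'" using \<open>0 < e\<close> n by (simp add: e'_def)
  obtain d where d: "0 < d" "\<And>\<xi>. norm \<xi> < d \<Longrightarrow> (f has_derivative f' (p + \<xi>)) (at (p + \<xi>))"
    "\<And>\<xi>. norm \<xi> < d \<Longrightarrow> norm (f' (p + \<xi>) v - f' p v - f'' v \<xi>) \<le> e' * norm \<xi>"
    using twice_derivative_first_order[OF tw e', of v] by metis
  have l'': "linear (f'' v)"
    by (rule twice_derivative_linear2[OF tw])
  show "eventually (\<lambda>s. dist ((f (p + s *\<^sub>R v + s *\<^sub>R w) - f (p + s *\<^sub>R v) - f (p + s *\<^sub>R w) + f p) / s\<^sup>2) (f'' v w) < e) (at_right 0)"
  proof (rule eventually_at_rightI[of 0 "d / ?n"])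
    fix s assume "s \<in> {0<..<d / ?n}"
    then have s: "0 < s" "s * ?n < d" using n by (auto simp: pos_less_divide_eq)
    have small: "norm (t *\<^sub>R v + c *\<^sub>R w) \<le> s * (norm v + norm w)" "norm (t *\<^sub>R v + c *\<^sub>R w) < d"
      if "0 \<le> t" "t \<le> s" "0 \<le> c" "c \<le> s" for t c
    proof -
      have "norm (t *\<^sub>R v + c *\<^sub>R w) \<le> t * norm v + c * norm w"
        using norm_triangle_ineq[of "t *\<^sub>R v" "c *\<^sub>R w"] that by simp
      also have "\<dots> \<le> s * norm v + s * norm w" using that by (intro add_mono mult_right_mono) auto
      finally show *: "norm (t *\<^sub>R v + c *\<^sub>R w) \<le> s * (norm v + norm w)" by (simp add: distrib_left)
      also have "\<dots> < d" using s by (simp add: distrib_left)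
      finally show "norm (t *\<^sub>R v + c *\<^sub>R w) < d" .
    qed
    have der: "((\<lambda>t. f (p + (t *\<^sub>R v + c *\<^sub>R w))) has_real_derivative f' (p + (t *\<^sub>R v + c *\<^sub>R w)) v) (at t)"
      if "0 \<le> t" "t \<le> s" "0 \<le> c" "c \<le> s" for t c
    proof -
      have "(f has_derivative f' (p + (t *\<^sub>R v + c *\<^sub>R w))) (at (p + (t *\<^sub>R v + c *\<^sub>R w)))"
        using small d(2) that by blast
      then have "((\<lambda>t. f (p + (t *\<^sub>R v + c *\<^sub>R w))) has_derivative (\<lambda>\<tau>. f' (p + (t *\<^sub>R v + c *\<^sub>R w)) (\<tau> *\<^sub>R v))) (at t)"
        by (rule has_derivative_compose[rotated]) (auto intro!: derivative_eq_intros)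
      moreover have "linear (f' (p + (t *\<^sub>R v + c *\<^sub>R w)))"
        using small d(2) that by (meson has_derivative_bounded_linear bounded_linear.linear)
      ultimately show ?thesis
        by (simp add: has_field_derivative_def linear_cmul mult_commute_abs)
    qed
    define g where "g t = f (p + (t *\<^sub>R v + s *\<^sub>R w)) - f (p + (t *\<^sub>R v + 0 *\<^sub>R w))" for t
    have "(g has_real_derivative f' (p + (t *\<^sub>R v + s *\<^sub>R w)) v - f' (p + (t *\<^sub>R v + 0 *\<^sub>R w)) v) (at t)"
      if "0 \<le> t" "t \<le> s" for t
      unfolding g_def using that s by (intro DERIV_diff der) auto
    then obtain t where t: "0 < t" "t < s"
      and mv: "g s - g 0 = (s - 0) * (f' (p + (t *\<^sub>R v + s *\<^sub>R w)) v - f' (p + (t *\<^sub>R v + 0 *\<^sub>R w)) v)"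
      using MVT2[OF s(1), of g "\<lambda>t. f' (p + (t *\<^sub>R v + s *\<^sub>R w)) v - f' (p + (t *\<^sub>R v + 0 *\<^sub>R w)) v"] by blast
    let ?a = "t *\<^sub>R v + s *\<^sub>R w" and ?b = "t *\<^sub>R v + 0 *\<^sub>R w"
    have est: "\<bar>f' (p + \<xi>) v - f' p v - f'' v \<xi>\<bar> \<le> e' * (s * (norm v + norm w))"
      if "\<xi> = ?a \<or> \<xi> = ?b" for \<xi>
    proof -
      have "norm \<xi> < d" "norm \<xi> \<le> s * (norm v + norm w)" using small[of t s] small[of t 0] t s that by auto
      then show ?thesis using d(3)[of \<xi>] e' by (smt (verit) mult_left_mono real_norm_def)
    qed
    have lin: "f'' v ?a - f'' v ?b = s * f'' v w" by (simp add: linear_add[OF l''] linear_cmul[OF l''])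
    have "\<bar>(f' (p + ?a) v - f' (p + ?b) v) - s * f'' v w\<bar> \<le> 2 * (e' * (s * (norm v + norm w)))"
      using est[OF disjI1[OF refl]] est[OF disjI2[OF refl]] lin by linarith
    also have "\<dots> \<le> 2 * (e' * (s * ?n))" using e' s by (intro mult_left_mono) auto
    also have "\<dots> = 2 / 3 * e * s"
    proof -
      have "e / (3 * X) * X = e / 3" if "0 < X" for X :: real using that by simp
      from this[OF n] have "e' * ?n = e / 3" unfolding e'_def .
      then show ?thesis by (metis (no_types, lifting) mult.assoc mult.commute times_divide_eq_left times_divide_eq_right)
    qed
    also have "\<dots> < e * s" using \<open>0 < e\<close> s by simp
    finally have main: "\<bar>(f' (p + ?a) v - f' (p + ?b) v) - s * f'' v w\<bar> < e * s" .
    have "f (p + s *\<^sub>R v + s *\<^sub>R w) - f (p + s *\<^sub>R v) - f (p + s *\<^sub>R w) + f p = g s - g 0"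
      by (simp add: g_def add_ac)
    then have "(f (p + s *\<^sub>R v + s *\<^sub>R w) - f (p + s *\<^sub>R v) - f (p + s *\<^sub>R w) + f p) / s\<^sup>2 - f'' v w
        = ((f' (p + ?a) v - f' (p + ?b) v) - s * f'' v w) / s"
      using s mv by (simp add: power2_eq_square diff_divide_distrib)
    then have "dist ((f (p + s *\<^sub>R v + s *\<^sub>R w) - f (p + s *\<^sub>R v) - f (p + s *\<^sub>R w) + f p) / s\<^sup>2) (f'' v w)
        = \<bar>(f' (p + ?a) v - f' (p + ?b) v) - s * f'' v w\<bar> / s"
      using s by (simp add: dist_real_def)
    also have "\<dots> < e" using main s by (simp add: pos_divide_less_eq)
    finally show "dist ((f (p + s *\<^sub>R v + s *\<^sub>R w) - f (p + s *\<^sub>R v) - f (p + s *\<^sub>R w) + f p) / s\<^sup>2) (f'' v w) < e" .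
  qed (use d n in simp)
qed

lemma twice_derivative_inner:
  fixes f :: "real^'n \<Rightarrow> 'b::real_inner"
  assumes "twice_derivative f f' f'' p"
  shows "twice_derivative (\<lambda>w. c \<bullet> f w) (\<lambda>w v. c \<bullet> f' w v) (\<lambda>v \<xi>. c \<bullet> f'' v \<xi>) p"
  using assms unfolding twice_derivative_def
  by (auto elim!: eventually_mono intro!: has_derivative_inner_right)

lemma twice_derivative_diff:
  assumes "twice_derivative f f' f'' p" "twice_derivative g g' g'' p"
  shows "twice_derivative (\<lambda>w. f w - g w) (\<lambda>w v. f' w v - g' w v) (\<lambda>v \<xi>. f'' v \<xi> - g'' v \<xi>) p"
proof -
  have "eventually (\<lambda>w. (f has_derivative f' w) (at w) \<and> (g has_derivative g' w) (at w)) (nhds p)"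
    using assms unfolding twice_derivative_def by (auto intro: eventually_conj)
  then show ?thesis using assms unfolding twice_derivative_def
    by (auto elim!: eventually_mono intro!: has_derivative_diff)
qed

lemma second_derivative_symmetric:
  fixes f :: "real^'n \<Rightarrow> 'b::real_inner"
  assumes tw: "twice_derivative f f' f'' p"
  shows "f'' v w = f'' w v"
proof -
  have "c \<bullet> f'' v w = c \<bullet> f'' w v" for c
  proof -
    note l = second_difference_limit[OF twice_derivative_inner[OF tw], of c]
    show ?thesis
      using l[of v w] l[of w v] by (intro tendsto_unique[of "at_right 0"]) (simp_all add: algebra_simps)
  qed
  then show ?thesis by (metis inner_commute vector_eq_rdot)
qed

text \<open>
  The first derivative of the composition is written as a sum of products of partial derivatives of \<open>u\<close>
  along \<open>\<Psi>\<close> with components of \<open>\<Psi>'\<close>, to which the product rule applies.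
\<close>

lemma twice_derivative_compose:
  fixes u :: "real^'n \<Rightarrow> real" and \<Psi> :: "real^'n \<Rightarrow> real^'n"
  assumes u: "twice_derivative u u' u'' (\<Psi> p)" and \<Psi>: "twice_derivative \<Psi> \<Psi>' \<Psi>'' p"
  obtains F'' where "twice_derivative (u \<circ> \<Psi>) (\<lambda>w v. u' (\<Psi> w) (\<Psi>' w v)) F'' p"
proof -
  have d\<Psi>: "(\<Psi> has_derivative \<Psi>' p) (at p)" by (rule twice_derivativeD1[OF \<Psi>])
  then have "isCont \<Psi> p" by (rule has_derivative_continuous)
  then have "filterlim \<Psi> (nhds (\<Psi> p)) (nhds p)"
    by (simp add: continuous_within tendsto_at_iff_tendsto_nhds)
  then have eu: "eventually (\<lambda>w. (u has_derivative u' (\<Psi> w)) (at (\<Psi> w))) (nhds p)"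
    using u unfolding twice_derivative_def filterlim_iff by blast
  have ev: "eventually (\<lambda>w. ((u \<circ> \<Psi>) has_derivative (\<lambda>v. u' (\<Psi> w) (\<Psi>' w v))) (at w)) (nhds p)"
  proof -
    have "eventually (\<lambda>w. (\<Psi> has_derivative \<Psi>' w) (at w)) (nhds p)"
      using \<Psi> by (simp add: twice_derivative_def)
    with eu show ?thesis
    proof eventually_elim
      case (elim w)
      show ?case using diff_chain_at[OF elim(2,1)] by (simp add: o_def)
    qed
  qed
  have "\<exists>D. ((\<lambda>w. u' (\<Psi> w) (\<Psi>' w v)) has_derivative D) (at p)" for v
  proof -
    have comp: "((\<lambda>w. u' (\<Psi> w) (axis k 1)) has_derivative (\<lambda>h. u'' (axis k 1) (\<Psi>' p h))) (at p)" for k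
      using diff_chain_at[OF d\<Psi> twice_derivativeD2[OF u, of "axis k 1"]] by (simp add: o_def)
    have cmp: "((\<lambda>w. \<Psi>' w v $ k) has_derivative (\<lambda>h. \<Psi>'' v h $ k)) (at p)" for k
      using bounded_linear.has_derivative[OF bounded_linear_vec_nth twice_derivativeD2[OF \<Psi>]] .
    have der: "((\<lambda>w. \<Sum>k\<in>UNIV. \<Psi>' w v $ k * u' (\<Psi> w) (axis k 1)) has_derivative
        (\<lambda>h. \<Sum>k\<in>UNIV. \<Psi>' p v $ k * u'' (axis k 1) (\<Psi>' p h) + \<Psi>'' v h $ k * u' (\<Psi> p) (axis k 1))) (at p)"
      by (intro has_derivative_sum has_derivative_mult comp cmp)
    have sums: "eventually (\<lambda>w. (\<Sum>k\<in>UNIV. \<Psi>' w v $ k * u' (\<Psi> w) (axis k 1)) = u' (\<Psi> w) (\<Psi>' w v)) (nhds p)"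
      using eu
    proof eventually_elim
      case (elim w)
      then have "linear (u' (\<Psi> w))" by (simp add: has_derivative_bounded_linear bounded_linear.linear)
      then show ?case by (subst (2) linear_axis_expand) auto
    qed
    from sums have at_eq: "eventually (\<lambda>w. (\<Sum>k\<in>UNIV. \<Psi>' w v $ k * u' (\<Psi> w) (axis k 1)) = u' (\<Psi> w) (\<Psi>' w v)) (at p)"
      unfolding eventually_at_filter by (rule eventually_mono) simp
    have "((\<lambda>w. u' (\<Psi> w) (\<Psi>' w v)) has_derivative
        (\<lambda>h. \<Sum>k\<in>UNIV. \<Psi>' p v $ k * u'' (axis k 1) (\<Psi>' p h) + \<Psi>'' v h $ k * u' (\<Psi> p) (axis k 1))) (at p)"
      by (rule has_derivative_transform_eventually[OF der at_eq]) (use eventually_nhds_x_imp_x[OF sums] in simp_all)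
    then show ?thesis by blast
  qed
  then obtain F'' where "\<And>v. ((\<lambda>w. u' (\<Psi> w) (\<Psi>' w v)) has_derivative F'' v) (at p)" by metis
  then show ?thesis using that ev by (auto simp: twice_derivative_def)
qed

section \<open>The Laplace--Beltrami operator at a point\<close>

lemma partial_deriv_eq:
  assumes "(f has_derivative f') (at y)"
  shows "partial_deriv i f y = f' (axis i 1)"
proof -
  have "((\<lambda>s. f (y + s *\<^sub>R axis i 1)) has_derivative (\<lambda>s. f' (s *\<^sub>R axis i 1))) (at 0)"
  proof (rule has_derivative_compose[where f="\<lambda>s. y + s *\<^sub>R axis i 1" and f'="\<lambda>s. s *\<^sub>R axis i 1" and g=f and g'=f'])
    show "((\<lambda>s. y + s *\<^sub>R axis i 1) has_derivative (\<lambda>s. s *\<^sub>R axis i 1)) (at 0)"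
      by (auto intro!: derivative_eq_intros)
    show "(f has_derivative f') (at (y + 0 *\<^sub>R axis i 1))" using assms by simp
  qed
  moreover have "linear f'" using assms has_derivative_bounded_linear bounded_linear.linear by blast
  ultimately show ?thesis
    by (simp add: partial_deriv_def vector_derivative_at has_vector_derivative_def linear_cmul)
qed

lemma has_derivative_det:
  fixes A :: "'a::real_normed_vector \<Rightarrow> real^'n^'n"
  assumes "\<And>a b. ((\<lambda>z. A z $ a $ b) has_derivative dA a b) (at p)"
  shows "((\<lambda>z. det (A z)) has_derivative
    (\<lambda>\<xi>. \<Sum>\<sigma> | \<sigma> permutes UNIV. of_int (sign \<sigma>) * (\<Sum>i\<in>UNIV. dA i (\<sigma> i) \<xi> * (\<Prod>j\<in>UNIV - {i}. A p $ j $ \<sigma> j)))) (at p)"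
  unfolding det_def by (intro has_derivative_sum has_derivative_mult_right has_derivative_prod assms)

text \<open>
  In the Leibniz expansion of the derivative only the identity permutation contributes: any other one
  moves at least two points, and a product with one factor removed still contains an off-diagonal
  entry of the identity matrix.
\<close>

lemma has_derivative_det_at_id:
  fixes A :: "'a::real_normed_vector \<Rightarrow> real^'n^'n"
  assumes dA: "\<And>a b. ((\<lambda>z. A z $ a $ b) has_derivative dA a b) (at p)" and id: "A p = mat 1"
  shows "((\<lambda>z. det (A z)) has_derivative (\<lambda>\<xi>. \<Sum>i\<in>UNIV. dA i i \<xi>)) (at p)"
proof -
  have "(\<Sum>\<sigma> | \<sigma> permutes UNIV. of_int (sign \<sigma>) * (\<Sum>i\<in>UNIV. dA i (\<sigma> i) \<xi> * (\<Prod>j\<in>UNIV - {i}. A p $ j $ \<sigma> j)))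
      = (\<Sum>i\<in>UNIV. dA i i \<xi>)" for \<xi>
  proof -
    have "(\<Sum>\<sigma> | \<sigma> permutes (UNIV::'n set). of_int (sign \<sigma>) * (\<Sum>i\<in>UNIV. dA i (\<sigma> i) \<xi> * (\<Prod>j\<in>UNIV - {i}. A p $ j $ \<sigma> j)))
        = (\<Sum>\<sigma>\<in>{id}. of_int (sign \<sigma>) * (\<Sum>i\<in>UNIV. dA i (\<sigma> i) \<xi> * (\<Prod>j\<in>UNIV - {i}. A p $ j $ \<sigma> j)))"
    proof (rule sum.mono_neutral_right)
      show "\<forall>\<sigma>\<in>{\<sigma>. \<sigma> permutes UNIV} - {id}.
          of_int (sign \<sigma>) * (\<Sum>i\<in>UNIV. dA i (\<sigma> i) \<xi> * (\<Prod>j\<in>UNIV - {i}. A p $ j $ \<sigma> j)) = 0"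
      proof
        fix \<sigma> assume \<sigma>: "\<sigma> \<in> {\<sigma>. \<sigma> permutes (UNIV :: 'n set)} - {id}"
        then have inj: "inj \<sigma>" using permutes_inj by blast
        obtain k where k: "\<sigma> k \<noteq> k" using \<sigma> by (metis DiffD2 eq_id_iff singletonI)
        have "\<exists>j\<in>UNIV - {i}. A p $ j $ \<sigma> j = 0" for i
        proof (cases "k = i")
          case False
          then show ?thesis using k by (intro bexI[of _ k]) (auto simp: id mat_def)
        next
          case True
          \<comment> \<open>a permutation cannot move exactly one point\<close>
          have "\<sigma> (\<sigma> k) \<noteq> \<sigma> k" using k inj by (meson injD)
          then show ?thesis using k True by (intro bexI[of _ "\<sigma> k"]) (auto simp: id mat_def)
        qed
        then have prod0: "(\<Prod>j\<in>UNIV - {i}. A p $ j $ \<sigma> j) = 0" for i by (intro prod_zero) auto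
        then show "of_int (sign \<sigma>) * (\<Sum>i\<in>UNIV. dA i (\<sigma> i) \<xi> * (\<Prod>j\<in>UNIV - {i}. A p $ j $ \<sigma> j)) = 0"
          unfolding prod0 by simp
      qed
    qed (auto simp: permutes_id)
    also have "\<dots> = (\<Sum>i\<in>UNIV. dA i i \<xi>)" by (simp add: id mat_def sign_id)
    finally show ?thesis .
  qed
  then show ?thesis using has_derivative_det[OF dA] by simp
qed

text \<open>
  Jacobi's formula, reduced to the previous case by factoring out \<open>det (A p)\<close>.
\<close>

lemma has_derivative_det_invertible:
  fixes A :: "'a::real_normed_vector \<Rightarrow> real^'n^'n"
  assumes dA: "\<And>a b. ((\<lambda>z. A z $ a $ b) has_derivative dA a b) (at p)" and inv: "B ** A p = mat 1"
  shows "((\<lambda>z. det (A z)) has_derivative (\<lambda>\<xi>. det (A p) * (\<Sum>a\<in>UNIV. \<Sum>b\<in>UNIV. B $ a $ b * dA b a \<xi>))) (at p)"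
proof -
  have dB: "((\<lambda>z. (B ** A z) $ a $ c) has_derivative (\<lambda>\<xi>. \<Sum>b\<in>UNIV. B $ a $ b * dA b c \<xi>)) (at p)" for a c
    unfolding matrix_matrix_mult_def
    by (simp, intro has_derivative_sum has_derivative_mult_right dA)
  have "det B * det (A p) = 1" using inv by (metis det_I det_mul)
  moreover have "det (A p) * det (B ** A z) = (det B * det (A p)) * det (A z)" for z by (simp add: det_mul)
  ultimately have eq: "det (A p) * det (B ** A z) = det (A z)" for z by simp
  show ?thesis
    using has_derivative_mult_right[OF has_derivative_det_at_id[OF dB inv], of "det (A p)"] by (simp only: eq)
qed

lemma
  fixes A :: "real^'n^'n"
  assumes "invertible A"
  shows matrix_inv_right: "A ** matrix_inv A = mat 1"
    and matrix_inv_left: "matrix_inv A ** A = mat 1"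
  using someI_ex[OF assms[unfolded invertible_def]] by (simp_all add: matrix_inv_def)

lemma matrix_inv_cramer:
  fixes A :: "real^'n^'n"
  assumes "det A \<noteq> 0"
  shows "matrix_inv A $ i $ j = det (\<chi> a b. if b = i then axis j 1 $ a else A $ a $ b) / det A"
proof -
  have "invertible A" using assms by (simp add: invertible_det_nz)
  then have "A ** matrix_inv A = mat 1" by (rule matrix_inv_right)
  then have "A *v (matrix_inv A *v axis j 1) = axis j 1" by (simp add: matrix_vector_mul_assoc)
  then have "matrix_inv A *v axis j 1 = (\<chi> k. det (\<chi> a b. if b = k then axis j 1 $ a else A $ a $ b) / det A)"
    using cramer[OF assms] by blast
  then have "(matrix_inv A *v axis j 1) $ i = det (\<chi> a b. if b = i then axis j 1 $ a else A $ a $ b) / det A"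
    by simp
  then show ?thesis by (simp add: matrix_vector_mult_basis column_def)
qed

text \<open>
  Cramer's rule shows that the entries of the inverse are differentiable; the formula then follows by
  differentiating \<open>A ** matrix_inv A = mat 1\<close>.
\<close>

lemma has_derivative_matrix_inv:
  fixes A :: "'a::real_normed_vector \<Rightarrow> real^'n^'n"
  assumes dA: "\<And>a b. ((\<lambda>z. A z $ a $ b) has_derivative dA a b) (at p)" and nz: "det (A p) \<noteq> 0"
  shows "((\<lambda>z. matrix_inv (A z) $ i $ j) has_derivative
    (\<lambda>\<xi>. - (\<Sum>a\<in>UNIV. \<Sum>b\<in>UNIV. matrix_inv (A p) $ i $ a * dA a b \<xi> * matrix_inv (A p) $ b $ j))) (at p)"
proof -
  let ?I = "\<lambda>z. matrix_inv (A z)"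
  have ddet: "((\<lambda>z. det (A z)) has_derivative (\<lambda>\<xi>. \<Sum>\<sigma> | \<sigma> permutes UNIV. of_int (sign \<sigma>) * (\<Sum>i\<in>UNIV. dA i (\<sigma> i) \<xi> * (\<Prod>j\<in>UNIV - {i}. A p $ j $ \<sigma> j)))) (at p)"
    by (rule has_derivative_det[OF dA])
  have "isCont (\<lambda>z. det (A z)) p" using ddet by (rule has_derivative_continuous)
  then have ev: "eventually (\<lambda>z. det (A z) \<noteq> 0) (at p)"
    using nz by (simp add: isCont_def tendsto_imp_eventually_ne)
  have "\<exists>D. ((\<lambda>z. ?I z $ i $ j) has_derivative D) (at p)" for i j
  proof -
    have D: "((\<lambda>z. (\<chi> a b. if b = i then axis j 1 $ a else A z $ a $ b) $ a $ b) has_derivative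
        (if b = i then (\<lambda>\<xi>. 0) else dA a b)) (at p)" for a b
      using dA by (cases "b = i") auto
    have "\<exists>D. ((\<lambda>z. det (\<chi> a b. if b = i then axis j 1 $ a else A z $ a $ b)) has_derivative D) (at p)"
      by (intro exI) (rule has_derivative_det, rule D)
    then have "\<exists>D. ((\<lambda>z. det (\<chi> a b. if b = i then axis j 1 $ a else A z $ a $ b) / det (A z)) has_derivative D) (at p)"
      using has_derivative_divide[OF _ ddet nz] by blast
    then obtain D where D: "((\<lambda>z. det (\<chi> a b. if b = i then axis j 1 $ a else A z $ a $ b) / det (A z)) has_derivative D) (at p)" by blast
    have "((\<lambda>z. ?I z $ i $ j) has_derivative D) (at p)"
    proof (rule has_derivative_transform_eventually[OF D])
      show "eventually (\<lambda>z. det (\<chi> a b. if b = i then axis j 1 $ a else A z $ a $ b) / det (A z) = ?I z $ i $ j) (at p)"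
        using ev by eventually_elim (simp add: matrix_inv_cramer)
    qed (simp_all add: matrix_inv_cramer nz)
    then show ?thesis by blast
  qed
  then obtain dI where dI: "\<And>i j. ((\<lambda>z. ?I z $ i $ j) has_derivative dI i j) (at p)" by metis
  have prod: "(\<Sum>b\<in>UNIV. A p $ a $ b * dI b c \<xi> + dA a b \<xi> * ?I p $ b $ c) = 0" for a c \<xi>
  proof -
    have "((\<lambda>z. \<Sum>b\<in>UNIV. A z $ a $ b * ?I z $ b $ c) has_derivative
        (\<lambda>\<xi>. \<Sum>b\<in>UNIV. A p $ a $ b * dI b c \<xi> + dA a b \<xi> * ?I p $ b $ c)) (at p)"
      by (intro has_derivative_sum has_derivative_mult dA dI)
    moreover have eq: "(\<Sum>b\<in>UNIV. A z $ a $ b * ?I z $ b $ c) = mat 1 $ a $ c" if "det (A z) \<noteq> 0" for z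
    proof -
      have "A z ** ?I z = mat 1" using that by (simp add: invertible_det_nz matrix_inv_right)
      then show ?thesis by (simp add: matrix_matrix_mult_def vec_eq_iff)
    qed
    ultimately have "((\<lambda>z. mat 1 $ a $ c :: real) has_derivative
        (\<lambda>\<xi>. \<Sum>b\<in>UNIV. A p $ a $ b * dI b c \<xi> + dA a b \<xi> * ?I p $ b $ c)) (at p)"
      using ev nz by (elim has_derivative_transform_eventually) (auto elim: eventually_mono)
    then have "(\<lambda>\<xi>. \<Sum>b\<in>UNIV. A p $ a $ b * dI b c \<xi> + dA a b \<xi> * ?I p $ b $ c) = (\<lambda>\<xi>. 0)"
      using has_derivative_unique has_derivative_const by blast
    then show ?thesis by metis
  qed
  have "dI i j \<xi> = - (\<Sum>a\<in>UNIV. \<Sum>b\<in>UNIV. ?I p $ i $ a * dA a b \<xi> * ?I p $ b $ j)" for \<xi>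
  proof -
    have IA: "(\<Sum>a\<in>UNIV. ?I p $ i $ a * A p $ a $ b) = (if i = b then 1 else 0)" for b
    proof -
      have "?I p ** A p = mat 1" using nz by (simp add: invertible_det_nz matrix_inv_left)
      then show ?thesis by (simp add: matrix_matrix_mult_def vec_eq_iff mat_def)
    qed
    have "0 = (\<Sum>a\<in>UNIV. ?I p $ i $ a * (\<Sum>b\<in>UNIV. A p $ a $ b * dI b j \<xi> + dA a b \<xi> * ?I p $ b $ j))"
      by (simp add: prod)
    also have "\<dots> = (\<Sum>a\<in>UNIV. \<Sum>b\<in>UNIV. (?I p $ i $ a * A p $ a $ b) * dI b j \<xi>)
        + (\<Sum>a\<in>UNIV. \<Sum>b\<in>UNIV. ?I p $ i $ a * dA a b \<xi> * ?I p $ b $ j)"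
      by (simp add: sum_distrib_left distrib_left sum.distrib mult.assoc)
    also have "(\<Sum>a\<in>UNIV. \<Sum>b\<in>UNIV. (?I p $ i $ a * A p $ a $ b) * dI b j \<xi>)
        = (\<Sum>b\<in>UNIV. (\<Sum>a\<in>UNIV. ?I p $ i $ a * A p $ a $ b) * dI b j \<xi>)"
      by (subst sum.swap) (simp add: sum_distrib_right)
    also have "\<dots> = (\<Sum>b\<in>UNIV. if i = b then dI b j \<xi> else 0)"
      unfolding IA by (rule sum.cong) auto
    also have "\<dots> = dI i j \<xi>" by simp
    finally show ?thesis by simp
  qed
  then show ?thesis using dI[of i j] by presburger
qed

text \<open>
  With \<open>k\<close> the inverse metric and \<open>P i a b = \<partial>\<^sub>i\<partial>\<^sub>a\<Psi> \<bullet> \<partial>\<^sub>b\<Psi>\<close> a Christoffel symbol of the first kind,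
  \<open>P i a b + P i b a\<close> is the derivative \<open>\<partial>\<^sub>i g\<^sub>a\<^sub>b\<close> of the metric.  The left-hand side collects the terms
  that arise when the density and the inverse metric in the divergence form are differentiated;
  by symmetry the terms from the density cancel half of those from the inverse metric.
\<close>

lemma christoffel_contraction:
  fixes k :: "'i \<Rightarrow> 'i \<Rightarrow> real"
  assumes k: "\<And>i j. k i j = k j i" and P: "\<And>i a b. P i a b = P a i b"
  shows "(\<Sum>i\<in>S. \<Sum>j\<in>S. \<Sum>a\<in>S. \<Sum>b\<in>S. (k i j * k a b / 2 - k i a * k b j) * (P i a b + P i b a) * F j)
    = - (\<Sum>i\<in>S. \<Sum>j\<in>S. \<Sum>a\<in>S. \<Sum>b\<in>S. k i a * k b j * P i a b * F j)"
proof -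
  define Q where "Q = (\<Sum>i\<in>S. \<Sum>j\<in>S. \<Sum>a\<in>S. \<Sum>b\<in>S. k i j * k a b * P i a b * F j)"
  have Q2: "(\<Sum>i\<in>S. \<Sum>j\<in>S. \<Sum>a\<in>S. \<Sum>b\<in>S. k i j * k a b * P i b a * F j) = Q"
    unfolding Q_def
  proof (rule sum.cong[OF refl], rule sum.cong[OF refl])
    fix i j
    have "(\<Sum>a\<in>S. \<Sum>b\<in>S. k i j * k a b * P i b a * F j) = (\<Sum>a\<in>S. \<Sum>b\<in>S. k i j * k b a * P i a b * F j)"
      by (rule sum.swap)
    also have "\<dots> = (\<Sum>a\<in>S. \<Sum>b\<in>S. k i j * k a b * P i a b * F j)"
    proof (intro sum.cong refl)
      show "k i j * k b a * P i a b * F j = k i j * k a b * P i a b * F j" for a b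
        by (simp add: k[of a b])
    qed
    finally show "(\<Sum>a\<in>S. \<Sum>b\<in>S. k i j * k a b * P i b a * F j) = (\<Sum>a\<in>S. \<Sum>b\<in>S. k i j * k a b * P i a b * F j)" .
  qed
  have "Q = (\<Sum>b\<in>S. \<Sum>j\<in>S. \<Sum>i\<in>S. \<Sum>a\<in>S. k b j * k i a * P b i a * F j)"
    by (simp add: Q_def)
  also have "\<dots> = (\<Sum>b\<in>S. \<Sum>i\<in>S. \<Sum>j\<in>S. \<Sum>a\<in>S. k b j * k i a * P b i a * F j)"
    by (rule sum.cong[OF refl], rule sum.swap)
  also have "\<dots> = (\<Sum>i\<in>S. \<Sum>b\<in>S. \<Sum>j\<in>S. \<Sum>a\<in>S. k b j * k i a * P b i a * F j)"
    by (rule sum.swap)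
  also have "\<dots> = (\<Sum>i\<in>S. \<Sum>j\<in>S. \<Sum>b\<in>S. \<Sum>a\<in>S. k b j * k i a * P b i a * F j)"
    by (rule sum.cong[OF refl], rule sum.swap)
  also have "\<dots> = (\<Sum>i\<in>S. \<Sum>j\<in>S. \<Sum>a\<in>S. \<Sum>b\<in>S. k b j * k i a * P b i a * F j)"
    by (rule sum.cong[OF refl], rule sum.cong[OF refl], rule sum.swap)
  also have "\<dots> = (\<Sum>i\<in>S. \<Sum>j\<in>S. \<Sum>a\<in>S. \<Sum>b\<in>S. k i a * k b j * P i b a * F j)"
  proof (intro sum.cong refl)
    show "k b j * k i a * P b i a * F j = k i a * k b j * P i b a * F j" for i j a b
      by (simp add: P[of b i])
  qed
  finally have Q3: "(\<Sum>i\<in>S. \<Sum>j\<in>S. \<Sum>a\<in>S. \<Sum>b\<in>S. k i a * k b j * P i b a * F j) = Q" by simp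
  have "(\<Sum>i\<in>S. \<Sum>j\<in>S. \<Sum>a\<in>S. \<Sum>b\<in>S. (k i j * k a b / 2 - k i a * k b j) * (P i a b + P i b a) * F j)
      = (Q + (\<Sum>i\<in>S. \<Sum>j\<in>S. \<Sum>a\<in>S. \<Sum>b\<in>S. k i j * k a b * P i b a * F j)) / 2
        - (\<Sum>i\<in>S. \<Sum>j\<in>S. \<Sum>a\<in>S. \<Sum>b\<in>S. k i a * k b j * P i a b * F j)
        - (\<Sum>i\<in>S. \<Sum>j\<in>S. \<Sum>a\<in>S. \<Sum>b\<in>S. k i a * k b j * P i b a * F j)"
    unfolding Q_def sum.distrib[symmetric] sum_divide_distrib sum_subtractf[symmetric]
    by (intro sum.cong refl) (simp add: field_simps)
  then show ?thesis unfolding Q2 Q3 by simp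
qed

lemma sum_coord_support:
  fixes g :: "'n::finite \<Rightarrow> real"
  assumes "\<And>a. a \<notin> S \<Longrightarrow> g a = 0"
  shows "(\<Sum>a\<in>UNIV. g a) = (\<Sum>a\<in>S. g a)"
  using assms by (intro sum.mono_neutral_right) auto

lemma linear_coord_expand:
  fixes L :: "real^'n \<Rightarrow> 'b::real_normed_vector"
  assumes "linear L" "v \<in> coord_space S"
  shows "L v = (\<Sum>i\<in>S. v $ i *\<^sub>R L (axis i 1))"
proof -
  have "L v = (\<Sum>i\<in>UNIV. v $ i *\<^sub>R L (axis i 1))" by (rule linear_axis_expand[OF assms(1)])
  also have "\<dots> = (\<Sum>i\<in>S. v $ i *\<^sub>R L (axis i 1))"
    using assms(2) by (intro sum.mono_neutral_right) (auto simp: coord_space_def)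
  finally show ?thesis .
qed

text \<open>
  The vectors \<open>l s\<close> are coordinate vectors of a frame that is orthonormal for the induced metric
  at \<open>p\<close>, and \<open>\<Sum>t\<in>S. f' p (l t) *\<^sub>R \<Psi>' p (l t)\<close> is the gradient of \<open>f\<close> as a tangent vector.  Since
  the inverse metric is \<open>\<Sum>s\<in>S. l s $ i * l s $ j\<close>, the formula is
  \<open>g\<^sup>i\<^sup>j (\<partial>\<^sub>i\<partial>\<^sub>j f - \<Gamma>\<^sup>k\<^sub>i\<^sub>j \<partial>\<^sub>k f)\<close> written in this frame.
\<close>

theorem laplace_in_chart_orthonormal:
  fixes \<Psi> :: "real^'n \<Rightarrow> real^'n" and f :: "real^'n \<Rightarrow> real" and l :: "'n \<Rightarrow> real^'n"
  assumes \<Psi>: "twice_derivative \<Psi> \<Psi>' \<Psi>'' p" and f: "twice_derivative f f' f'' p"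
    and l: "\<And>s. s \<in> S \<Longrightarrow> l s \<in> coord_space S"
    and on: "\<And>s t. s \<in> S \<Longrightarrow> t \<in> S \<Longrightarrow> \<Psi>' p (l s) \<bullet> \<Psi>' p (l t) = (if s = t then 1 else 0)"
  shows "laplace_in_chart \<Psi> S f p =
    (\<Sum>s\<in>S. \<Sum>i\<in>S. \<Sum>j\<in>S. l s $ i * l s $ j *
      (f'' (axis j 1) (axis i 1) - (\<Sum>t\<in>S. f' p (l t) *\<^sub>R \<Psi>' p (l t)) \<bullet> \<Psi>'' (axis j 1) (axis i 1)))"
proof -
  let ?e = "\<lambda>i. axis i 1 :: real^'n"
  let ?G = "induced_metric \<Psi> S"
  define dG where "dG a b \<xi> = (if a \<in> S \<and> b \<in> S
      then \<Psi>' p (?e a) \<bullet> \<Psi>'' (?e b) \<xi> + \<Psi>'' (?e a) \<xi> \<bullet> \<Psi>' p (?e b) else 0)" for a b \<xi>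
  have ev\<Psi>: "eventually (\<lambda>z. (\<Psi> has_derivative \<Psi>' z) (at z)) (nhds p)"
    and evf: "eventually (\<lambda>z. (f has_derivative f' z) (at z)) (nhds p)"
    using \<Psi> f by (auto simp: twice_derivative_def)
  have lin\<Psi>: "linear (\<Psi>' p)" and linf: "linear (f' p)"
    using \<Psi> f by (auto intro: twice_derivative_linear1)
  have G_eq: "?G z $ a $ b = (if a \<in> S \<and> b \<in> S then \<Psi>' z (?e a) \<bullet> \<Psi>' z (?e b) else if a = b then 1 else 0)"
    if "(\<Psi> has_derivative \<Psi>' z) (at z)" for z a b
    using that by (simp add: induced_metric_def partial_deriv_eq)
  have Gp: "?G p $ a $ b = (if a \<in> S \<and> b \<in> S then \<Psi>' p (?e a) \<bullet> \<Psi>' p (?e b) else if a = b then 1 else 0)" for a b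
    by (rule G_eq[OF twice_derivativeD1[OF \<Psi>]])
  have derG: "((\<lambda>z. ?G z $ a $ b) has_derivative dG a b) (at p)" for a b
  proof (rule has_derivative_transform_eventually)
    show "((\<lambda>z. if a \<in> S \<and> b \<in> S then \<Psi>' z (?e a) \<bullet> \<Psi>' z (?e b) else if a = b then 1 else 0) has_derivative dG a b) (at p)"
      using has_derivative_inner[OF twice_derivativeD2[OF \<Psi>, of "?e a"] twice_derivativeD2[OF \<Psi>, of "?e b"]]
      by (cases "a \<in> S \<and> b \<in> S") (auto simp: dG_def[abs_def])
    have "eventually (\<lambda>z. (\<Psi> has_derivative \<Psi>' z) (at z)) (at p)"
      using ev\<Psi> unfolding eventually_at_filter by (rule eventually_mono) simp
    then show "eventually (\<lambda>z. (if a \<in> S \<and> b \<in> S then \<Psi>' z (?e a) \<bullet> \<Psi>' z (?e b) else if a = b then 1 else 0) = ?G z $ a $ b) (at p)"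
      by eventually_elim (simp add: G_eq)
  qed (simp_all add: Gp)
  \<comment> \<open>the frame, padded to a basis, transforms the padded metric into the identity\<close>
  define Y :: "real^'n^'n" where "Y = (\<chi> a s. if s \<in> S then l s $ a else if a = s then 1 else 0)"
  have l0: "l s $ a = 0" if "s \<in> S" "a \<notin> S" for s a using l[OF that(1)] that(2) by (simp add: coord_space_def)
  have frame: "\<Psi>' p (l s) = (\<Sum>a\<in>S. l s $ a *\<^sub>R \<Psi>' p (?e a))" if "s \<in> S" for s
    by (rule linear_coord_expand[OF lin\<Psi> l[OF that]])
  have GY: "(?G p ** Y) $ a $ t = (if t \<in> S then if a \<in> S then \<Psi>' p (?e a) \<bullet> \<Psi>' p (l t) else 0 else if a = t then 1 else 0)" for a t
  proof -
    have "(?G p ** Y) $ a $ t = (\<Sum>b\<in>UNIV. ?G p $ a $ b * Y $ b $ t)" by (simp add: matrix_matrix_mult_def)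
    also have "\<dots> = (if t \<in> S then if a \<in> S then \<Psi>' p (?e a) \<bullet> \<Psi>' p (l t) else 0 else if a = t then 1 else 0)"
    proof (cases "t \<in> S")
      case True
      have "(\<Sum>b\<in>UNIV. ?G p $ a $ b * Y $ b $ t) = (\<Sum>b\<in>S. ?G p $ a $ b * l t $ b)"
        using True l0 by (subst sum_coord_support[of S]) (auto simp: Y_def)
      also have "\<dots> = (if a \<in> S then \<Psi>' p (?e a) \<bullet> \<Psi>' p (l t) else 0)"
      proof (cases "a \<in> S")
        case aS: True
        then show ?thesis using True by (simp add: Gp frame inner_sum_right mult.commute)
      next
        case False
        then have "?G p $ a $ b * l t $ b = 0" if "b \<in> S" for b using that by (auto simp: Gp)
        then have "(\<Sum>b\<in>S. ?G p $ a $ b * l t $ b) = 0" by (intro sum.neutral) blast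
        then show ?thesis using False by simp
      qed
      finally show ?thesis using True by simp
    next
      case False
      have "(\<Sum>b\<in>UNIV. ?G p $ a $ b * Y $ b $ t) = (\<Sum>b\<in>UNIV. if b = t then ?G p $ a $ b else 0)"
        using False by (intro sum.cong) (auto simp: Y_def)
      also have "\<dots> = ?G p $ a $ t" by simp
      finally show ?thesis using False by (simp add: Gp)
    qed
    finally show ?thesis .
  qed
  have YT: "(transpose Y ** Z) $ s $ t = (\<Sum>a\<in>UNIV. Y $ a $ s * Z $ a $ t)" for Z :: "real^'n^'n" and s t
    by (simp add: matrix_matrix_mult_def transpose_def)
  have "(transpose Y ** (?G p ** Y)) $ s $ t = mat 1 $ s $ t" for s t
  proof -
    have "(transpose Y ** (?G p ** Y)) $ s $ t = (\<Sum>a\<in>UNIV. Y $ a $ s * (?G p ** Y) $ a $ t)"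
      by (rule YT)
    also have "\<dots> = mat 1 $ s $ t"
    proof (cases "s \<in> S")
      case True
      have "(\<Sum>a\<in>UNIV. Y $ a $ s * (?G p ** Y) $ a $ t) = (\<Sum>a\<in>S. l s $ a * (?G p ** Y) $ a $ t)"
        using True l0 by (subst sum_coord_support[of S]) (auto simp: Y_def)
      also have "\<dots> = mat 1 $ s $ t"
      proof (cases "t \<in> S")
        case tS: True
        have "(\<Sum>a\<in>S. l s $ a * (?G p ** Y) $ a $ t) = \<Psi>' p (l s) \<bullet> \<Psi>' p (l t)"
          using tS True by (simp add: GY frame[OF True] inner_sum_left)
        then show ?thesis using on[OF True tS] by (simp add: mat_def)
      next
        case False
        then have "l s $ a * (?G p ** Y) $ a $ t = 0" if "a \<in> S" for a using that by (auto simp: GY)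
        then have "(\<Sum>a\<in>S. l s $ a * (?G p ** Y) $ a $ t) = 0" by (intro sum.neutral) blast
        then show ?thesis using False True by (auto simp: mat_def)
      qed
      finally show ?thesis .
    next
      case False
      have "(\<Sum>a\<in>UNIV. Y $ a $ s * (?G p ** Y) $ a $ t) = (\<Sum>a\<in>UNIV. if a = s then (?G p ** Y) $ a $ t else 0)"
        using False by (intro sum.cong) (auto simp: Y_def)
      also have "\<dots> = (?G p ** Y) $ s $ t" by simp
      finally show ?thesis using False by (auto simp: GY mat_def)
    qed
    finally show ?thesis .
  qed
  then have YGY: "transpose Y ** (?G p ** Y) = mat 1" by (simp add: vec_eq_iff)
  then have "(transpose Y ** ?G p) ** Y = mat 1" by (simp add: matrix_mul_assoc)
  then have "Y ** (transpose Y ** ?G p) = mat 1" by (simp add: matrix_left_right_inverse)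
  then have KG: "(Y ** transpose Y) ** ?G p = mat 1" by (simp add: matrix_mul_assoc)
  have "det Y * (det (?G p) * det Y) = 1"
    using arg_cong[OF YGY, of det] by (simp add: det_mul det_transpose)
  then have "det (?G p) * (det Y)\<^sup>2 = 1" by (simp add: power2_eq_square mult_ac)
  then have detG: "0 < det (?G p)"
    by (metis less_numeral_extra(1) linorder_not_le mult_nonpos_nonneg zero_le_power2)
  define K where "K = matrix_inv (?G p)"
  have invG: "invertible (?G p)" using detG by (simp add: invertible_det_nz)
  have K_eq: "K = Y ** transpose Y"
  proof -
    have "K = ((Y ** transpose Y) ** ?G p) ** K" by (simp add: KG)
    also have "\<dots> = (Y ** transpose Y) ** (?G p ** K)" by (simp add: matrix_mul_assoc)
    finally show ?thesis by (simp add: K_def matrix_inv_right[OF invG])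
  qed
  have K_on: "K $ a $ b = (\<Sum>s\<in>S. l s $ a * l s $ b)" if "a \<in> S" for a b
  proof -
    have "K $ a $ b = (\<Sum>s\<in>UNIV. Y $ a $ s * Y $ b $ s)"
      by (simp add: K_eq matrix_matrix_mult_def transpose_def)
    also have "\<dots> = (\<Sum>s\<in>S. Y $ a $ s * Y $ b $ s)"
      using that by (intro sum_coord_support) (auto simp: Y_def)
    finally show ?thesis by (simp add: Y_def)
  qed
  have K_sym: "K $ a $ b = K $ b $ a" for a b
    by (simp add: K_eq matrix_matrix_mult_def transpose_def mult.commute)
  have KG': "K ** ?G p = mat 1" by (simp add: K_def matrix_inv_left[OF invG])
  have ddet: "((\<lambda>z. det (?G z)) has_derivative (\<lambda>\<xi>. det (?G p) * (\<Sum>a\<in>UNIV. \<Sum>b\<in>UNIV. K $ a $ b * dG b a \<xi>))) (at p)"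
    by (rule has_derivative_det_invertible[OF derG KG'])
  define tr where "tr \<xi> = (\<Sum>a\<in>UNIV. \<Sum>b\<in>UNIV. K $ a $ b * dG b a \<xi>)" for \<xi>
  let ?q = "sqrt (det (?G p))"
  have dsqrt: "((\<lambda>z. sqrt (det (?G z))) has_derivative (\<lambda>\<xi>. ?q * tr \<xi> / 2)) (at p)"
  proof -
    have "((\<lambda>z. sqrt (det (?G z))) has_derivative (\<lambda>\<xi>. (det (?G p) * tr \<xi>) * (inverse ?q / 2))) (at p)"
      using has_derivative_real_sqrt[OF detG ddet] unfolding tr_def by (simp add: mult_ac)
    moreover have "(det (?G p) * tr \<xi>) * (inverse ?q / 2) = ?q * tr \<xi> / 2" for \<xi>
      using detG real_div_sqrt[of "det (?G p)"] by (simp add: field_simps)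
    ultimately show ?thesis by (simp only:)
  qed
  have dinv: "((\<lambda>z. matrix_inv (?G z) $ i $ j) has_derivative
      (\<lambda>\<xi>. - (\<Sum>a\<in>UNIV. \<Sum>b\<in>UNIV. K $ i $ a * dG a b \<xi> * K $ b $ j))) (at p)" for i j
    unfolding K_def using detG by (intro has_derivative_matrix_inv derG) simp
  define P where "P i a b = \<Psi>'' (?e a) (?e i) \<bullet> \<Psi>' p (?e b)" for i a b
  have P_sym: "P i a b = P a i b" for i a b
    by (simp add: P_def second_derivative_symmetric[OF \<Psi>, of "?e a" "?e i"])
  have dG_P: "dG a b (?e i) = (if a \<in> S \<and> b \<in> S then P i a b + P i b a else 0)" for a b i
    by (simp add: dG_def P_def inner_commute)
  define F where "F j = f' p (?e j)" for j
  have summand: "partial_deriv i (\<lambda>z. sqrt (det (?G z)) * matrix_inv (?G z) $ i $ j * partial_deriv j f z) p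
      = ?q * (K $ i $ j * f'' (?e j) (?e i)
          + (\<Sum>a\<in>S. \<Sum>b\<in>S. (K $ i $ j * K $ a $ b / 2 - K $ i $ a * K $ b $ j) * (P i a b + P i b a) * F j))" for i j
  proof -
    have dF: "((\<lambda>z. partial_deriv j f z) has_derivative f'' (?e j)) (at p)"
    proof (rule has_derivative_transform_eventually[OF twice_derivativeD2[OF f]])
      have "eventually (\<lambda>z. (f has_derivative f' z) (at z)) (at p)"
        using evf unfolding eventually_at_filter by (rule eventually_mono) simp
      then show "eventually (\<lambda>z. f' z (?e j) = partial_deriv j f z) (at p)"
        by eventually_elim (simp add: partial_deriv_eq)
    qed (simp_all add: partial_deriv_eq[OF twice_derivativeD1[OF f]])
    have Fp: "partial_deriv j f p = F j" by (simp add: F_def partial_deriv_eq[OF twice_derivativeD1[OF f]])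
    have inner_sum: "(\<Sum>a\<in>UNIV. \<Sum>b\<in>UNIV. g a b * dG a b (?e i)) = (\<Sum>a\<in>S. \<Sum>b\<in>S. g a b * (P i a b + P i b a))" for g :: "'n \<Rightarrow> 'n \<Rightarrow> real"
    proof -
      have "(\<Sum>b\<in>UNIV. g a b * dG a b (?e i)) = (\<Sum>b\<in>S. g a b * dG a b (?e i))" for a
        by (rule sum_coord_support) (simp add: dG_P)
      then have "(\<Sum>a\<in>UNIV. \<Sum>b\<in>UNIV. g a b * dG a b (?e i)) = (\<Sum>a\<in>UNIV. \<Sum>b\<in>S. g a b * dG a b (?e i))" by simp
      also have "\<dots> = (\<Sum>a\<in>S. \<Sum>b\<in>S. g a b * dG a b (?e i))"
        by (rule sum_coord_support) (simp add: dG_P)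
      finally show ?thesis by (simp add: dG_P)
    qed
    have tr: "tr (?e i) = (\<Sum>a\<in>S. \<Sum>b\<in>S. K $ a $ b * (P i a b + P i b a))"
    proof -
      have "dG b a (?e i) = dG a b (?e i)" for a b by (simp add: dG_P add.commute)
      then show ?thesis using inner_sum[of "\<lambda>a b. K $ a $ b"] by (simp add: tr_def)
    qed
    have inv: "(\<Sum>a\<in>UNIV. \<Sum>b\<in>UNIV. K $ i $ a * dG a b (?e i) * K $ b $ j)
        = (\<Sum>a\<in>S. \<Sum>b\<in>S. K $ i $ a * K $ b $ j * (P i a b + P i b a))"
      using inner_sum[of "\<lambda>a b. K $ i $ a * K $ b $ j"] by (simp add: mult_ac)
    have "((\<lambda>z. sqrt (det (?G z)) * matrix_inv (?G z) $ i $ j * partial_deriv j f z) has_derivative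
        (\<lambda>\<xi>. ?q * matrix_inv (?G p) $ i $ j * f'' (?e j) \<xi>
          + (?q * - (\<Sum>a\<in>UNIV. \<Sum>b\<in>UNIV. K $ i $ a * dG a b \<xi> * K $ b $ j)
            + ?q * tr \<xi> / 2 * matrix_inv (?G p) $ i $ j) * partial_deriv j f p)) (at p)"
      by (intro has_derivative_mult dsqrt dinv dF)
    then have "partial_deriv i (\<lambda>z. sqrt (det (?G z)) * matrix_inv (?G z) $ i $ j * partial_deriv j f z) p
      = ?q * K $ i $ j * f'' (?e j) (?e i) + (?q * - (\<Sum>a\<in>UNIV. \<Sum>b\<in>UNIV. K $ i $ a * dG a b (?e i) * K $ b $ j)
            + ?q * tr (?e i) / 2 * K $ i $ j) * F j"
      by (simp add: partial_deriv_eq Fp K_def)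
    also have "\<dots> = ?q * (K $ i $ j * f'' (?e j) (?e i) + (K $ i $ j / 2 * tr (?e i)
        - (\<Sum>a\<in>UNIV. \<Sum>b\<in>UNIV. K $ i $ a * dG a b (?e i) * K $ b $ j)) * F j)"
      by (simp add: algebra_simps)
    also have "(K $ i $ j / 2 * tr (?e i) - (\<Sum>a\<in>UNIV. \<Sum>b\<in>UNIV. K $ i $ a * dG a b (?e i) * K $ b $ j)) * F j
        = (\<Sum>a\<in>S. \<Sum>b\<in>S. (K $ i $ j * K $ a $ b / 2 - K $ i $ a * K $ b $ j) * (P i a b + P i b a) * F j)"
      unfolding tr inv sum_distrib_left sum_distrib_right sum_subtractf[symmetric]
      by (intro sum.cong refl) (simp add: algebra_simps)
    finally show ?thesis .
  qed
  have "laplace_in_chart \<Psi> S f p = 1 / ?q * (\<Sum>i\<in>S. \<Sum>j\<in>S. ?q * (K $ i $ j * f'' (?e j) (?e i)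
          + (\<Sum>a\<in>S. \<Sum>b\<in>S. (K $ i $ j * K $ a $ b / 2 - K $ i $ a * K $ b $ j) * (P i a b + P i b a) * F j)))"
    unfolding laplace_in_chart_def summand ..
  also have "\<dots> = (\<Sum>i\<in>S. \<Sum>j\<in>S. K $ i $ j * f'' (?e j) (?e i)) +
      (\<Sum>i\<in>S. \<Sum>j\<in>S. \<Sum>a\<in>S. \<Sum>b\<in>S. (K $ i $ j * K $ a $ b / 2 - K $ i $ a * K $ b $ j) * (P i a b + P i b a) * F j)"
    using detG by (simp add: sum_distrib_left[symmetric] sum.distrib)
  also have "(\<Sum>i\<in>S. \<Sum>j\<in>S. \<Sum>a\<in>S. \<Sum>b\<in>S. (K $ i $ j * K $ a $ b / 2 - K $ i $ a * K $ b $ j) * (P i a b + P i b a) * F j)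
      = - (\<Sum>i\<in>S. \<Sum>j\<in>S. \<Sum>a\<in>S. \<Sum>b\<in>S. K $ i $ a * K $ b $ j * P i a b * F j)"
    by (rule christoffel_contraction[of "\<lambda>i j. K $ i $ j"]) (rule K_sym, rule P_sym)
  also have "(\<Sum>i\<in>S. \<Sum>j\<in>S. \<Sum>a\<in>S. \<Sum>b\<in>S. K $ i $ a * K $ b $ j * P i a b * F j)
      = (\<Sum>i\<in>S. \<Sum>a\<in>S. \<Sum>j\<in>S. \<Sum>b\<in>S. K $ i $ a * K $ b $ j * P i a b * F j)"
    by (rule sum.cong[OF refl], rule sum.swap)
  also have "\<dots> = (\<Sum>i\<in>S. \<Sum>a\<in>S. K $ i $ a * ((\<Sum>t\<in>S. f' p (l t) *\<^sub>R \<Psi>' p (l t)) \<bullet> \<Psi>'' (?e a) (?e i)))"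
  proof (intro sum.cong refl)
    fix i a assume "i \<in> S" "a \<in> S"
    have "(\<Sum>t\<in>S. f' p (l t) *\<^sub>R \<Psi>' p (l t)) \<bullet> \<Psi>'' (?e a) (?e i)
        = (\<Sum>t\<in>S. (\<Sum>j\<in>S. l t $ j * F j) * (\<Sum>b\<in>S. l t $ b * P i a b))"
      unfolding inner_sum_left
    proof (intro sum.cong refl)
      fix t assume "t \<in> S"
      have "f' p (l t) = (\<Sum>j\<in>S. l t $ j * F j)"
        using linear_coord_expand[OF linf l[OF \<open>t \<in> S\<close>]] by (simp add: F_def)
      moreover have "\<Psi>' p (l t) \<bullet> \<Psi>'' (?e a) (?e i) = (\<Sum>b\<in>S. l t $ b * P i a b)"
        unfolding frame[OF \<open>t \<in> S\<close>] inner_sum_left P_def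
        by (simp add: inner_commute[of "\<Psi>'' _ _"])
      ultimately show "(f' p (l t) *\<^sub>R \<Psi>' p (l t)) \<bullet> \<Psi>'' (?e a) (?e i) = (\<Sum>j\<in>S. l t $ j * F j) * (\<Sum>b\<in>S. l t $ b * P i a b)"
        by simp
    qed
    also have "\<dots> = (\<Sum>t\<in>S. \<Sum>j\<in>S. \<Sum>b\<in>S. (l t $ b * l t $ j) * P i a b * F j)"
      by (simp add: sum_product mult_ac)
    also have "\<dots> = (\<Sum>j\<in>S. \<Sum>t\<in>S. \<Sum>b\<in>S. (l t $ b * l t $ j) * P i a b * F j)" by (rule sum.swap)
    also have "\<dots> = (\<Sum>j\<in>S. \<Sum>b\<in>S. \<Sum>t\<in>S. (l t $ b * l t $ j) * P i a b * F j)"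
      by (rule sum.cong[OF refl], rule sum.swap)
    also have "\<dots> = (\<Sum>j\<in>S. \<Sum>b\<in>S. K $ b $ j * P i a b * F j)"
      by (simp add: K_on sum_distrib_right)
    finally show "(\<Sum>j\<in>S. \<Sum>b\<in>S. K $ i $ a * K $ b $ j * P i a b * F j)
        = K $ i $ a * ((\<Sum>t\<in>S. f' p (l t) *\<^sub>R \<Psi>' p (l t)) \<bullet> \<Psi>'' (?e a) (?e i))"
      by (simp add: sum_distrib_left mult_ac)
  qed
  also have "(\<Sum>i\<in>S. \<Sum>j\<in>S. K $ i $ j * f'' (?e j) (?e i)) +
      - (\<Sum>i\<in>S. \<Sum>a\<in>S. K $ i $ a * ((\<Sum>t\<in>S. f' p (l t) *\<^sub>R \<Psi>' p (l t)) \<bullet> \<Psi>'' (?e a) (?e i)))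
      = (\<Sum>i\<in>S. \<Sum>j\<in>S. K $ i $ j * (f'' (?e j) (?e i) - (\<Sum>t\<in>S. f' p (l t) *\<^sub>R \<Psi>' p (l t)) \<bullet> \<Psi>'' (?e j) (?e i)))"
    by (simp add: sum_subtractf right_diff_distrib)
  also have "\<dots> = (\<Sum>i\<in>S. \<Sum>j\<in>S. \<Sum>s\<in>S. l s $ i * l s $ j * (f'' (?e j) (?e i) - (\<Sum>t\<in>S. f' p (l t) *\<^sub>R \<Psi>' p (l t)) \<bullet> \<Psi>'' (?e j) (?e i)))"
    by (intro sum.cong refl) (simp add: K_on sum_distrib_right)
  also have "\<dots> = (\<Sum>i\<in>S. \<Sum>s\<in>S. \<Sum>j\<in>S. l s $ i * l s $ j * (f'' (?e j) (?e i) - (\<Sum>t\<in>S. f' p (l t) *\<^sub>R \<Psi>' p (l t)) \<bullet> \<Psi>'' (?e j) (?e i)))"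
    by (rule sum.cong[OF refl], rule sum.swap)
  also have "\<dots> = (\<Sum>s\<in>S. \<Sum>i\<in>S. \<Sum>j\<in>S. l s $ i * l s $ j * (f'' (?e j) (?e i) - (\<Sum>t\<in>S. f' p (l t) *\<^sub>R \<Psi>' p (l t)) \<bullet> \<Psi>'' (?e j) (?e i)))"
    by (rule sum.swap)
  finally show ?thesis .
qed

section \<open>Submanifolds are nearly flat\<close>

lemma orthonormal_frame_exists:
  fixes A :: "real^'n \<Rightarrow> real^'n"
  assumes A: "linear A" and inj: "inj_on A (coord_space S)"
  obtains l where "\<And>s. s \<in> S \<Longrightarrow> l s \<in> coord_space S"
    "\<And>s t. s \<in> S \<Longrightarrow> t \<in> S \<Longrightarrow> A (l s) \<bullet> A (l t) = (if s = t then 1 else 0)"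
    "\<And>z. z \<in> coord_space S \<Longrightarrow> z = (\<Sum>s\<in>S. (A (l s) \<bullet> A z) *\<^sub>R l s)"
proof -
  have sub: "subspace (A ` coord_space S)" using A by (simp add: linear_subspace_image)
  obtain B where B: "B \<subseteq> A ` coord_space S" "pairwise orthogonal B" "\<And>x. x \<in> B \<Longrightarrow> norm x = 1"
    "independent B" "card B = dim (A ` coord_space S)" "span B = A ` coord_space S"
    using orthonormal_basis_subspace[OF sub] by metis
  have "dim (A ` coord_space S) = card S"
    using dim_image_eq[OF A, of "coord_space S"] inj by (simp add: span_eq_iff[THEN iffD2])
  moreover have finB: "finite B" using B(4) by (rule independent_imp_finite)
  ultimately obtain h where h: "bij_betw h S B"
    using B(5) finite_same_card_bij[of S B] by auto
  have hB: "h s \<in> B" if "s \<in> S" for s using h that by (auto simp: bij_betw_def)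
  then have "\<exists>z. z \<in> coord_space S \<and> A z = h s" if "s \<in> S" for s using B(1) that by (metis imageE subsetD)
  then obtain l where l: "\<And>s. s \<in> S \<Longrightarrow> l s \<in> coord_space S" "\<And>s. s \<in> S \<Longrightarrow> A (l s) = h s" by metis
  have on: "h s \<bullet> h t = (if s = t then 1 else 0)" if "s \<in> S" "t \<in> S" for s t
  proof (cases "s = t")
    case True
    then show ?thesis using B(3)[OF hB[OF that(1)]] by (simp add: dot_square_norm)
  next
    case False
    then have "h s \<noteq> h t" using h that by (auto simp: bij_betw_def inj_on_def)
    then show ?thesis using B(2) hB that False by (auto simp: pairwise_def orthogonal_def)
  qed
  have expand: "z = (\<Sum>s\<in>S. (A (l s) \<bullet> A z) *\<^sub>R l s)" if z: "z \<in> coord_space S" for z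
  proof -
    have "A z \<in> span B" using z B(6) by simp
    then obtain c where c: "A z = (\<Sum>v\<in>B. c v *\<^sub>R v)" using finB by (auto simp: span_finite)
    also have "\<dots> = (\<Sum>s\<in>S. c (h s) *\<^sub>R h s)"
      using sum.reindex_bij_betw[OF h, of "\<lambda>v. c v *\<^sub>R v"] by simp
    finally have Az: "A z = (\<Sum>s\<in>S. c (h s) *\<^sub>R h s)" .
    have coef: "h t \<bullet> A z = c (h t)" if "t \<in> S" for t
    proof -
      have "h t \<bullet> A z = (\<Sum>s\<in>S. if s = t then c (h s) else 0)"
        unfolding Az inner_sum_right using that by (intro sum.cong refl) (auto simp: on)
      then show ?thesis using that by simp
    qed
    have "A (\<Sum>s\<in>S. (A (l s) \<bullet> A z) *\<^sub>R l s) = (\<Sum>s\<in>S. c (h s) *\<^sub>R h s)"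
      by (simp add: linear_sum[OF A] linear_cmul[OF A] l(2) coef)
    then have "A (\<Sum>s\<in>S. (A (l s) \<bullet> A z) *\<^sub>R l s) = A z" using Az by simp
    moreover have "(\<Sum>s\<in>S. (A (l s) \<bullet> A z) *\<^sub>R l s) \<in> coord_space S"
      by (intro subspace_sum subspace_mul l) auto
    ultimately show ?thesis using inj z by (auto simp: inj_on_def)
  qed
  show ?thesis
  proof (rule that[of l])
    show "A (l s) \<bullet> A (l t) = (if s = t then 1 else 0)" if "s \<in> S" "t \<in> S" for s t
      using on l(2) that by simp
  qed (use l expand in auto)
qed

text \<open>
  The inverse chart \<open>\<Psi>\<close> parametrises \<open>M\<close> by the coordinate subspace, and its derivative maps the
  vectors \<open>l s\<close> to an orthonormal basis of the tangent space at \<open>x\<close>.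
\<close>

locale framed_chart =
  fixes M :: "(real^'n) set" and x :: "real^'n" and U V :: "(real^'n) set"
    and \<Phi> \<Psi> :: "real^'n \<Rightarrow> real^'n" and S :: "'n set"
    and \<Psi>' \<Psi>'' :: "real^'n \<Rightarrow> real^'n \<Rightarrow> real^'n" and l :: "'n \<Rightarrow> real^'n"
  assumes closed_M: "closed M" and x_in: "x \<in> M" and openU: "open U" and openV: "open V" and xU: "x \<in> U"
    and homeo: "homeomorphism U V \<Phi> \<Psi>"
    and image: "\<Phi> ` (M \<inter> U) = V \<inter> coord_space S"
    and tw: "twice_derivative \<Psi> \<Psi>' \<Psi>'' (\<Phi> x)"
    and lip: "\<exists>K>0. \<exists>d>0. \<forall>y\<in>cball x d. \<forall>y'\<in>cball x d. norm (\<Phi> y - \<Phi> y') \<le> K * norm (y - y')"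
    and l_in: "\<And>s. s \<in> S \<Longrightarrow> l s \<in> coord_space S"
    and l_on: "\<And>s t. s \<in> S \<Longrightarrow> t \<in> S \<Longrightarrow> \<Psi>' (\<Phi> x) (l s) \<bullet> \<Psi>' (\<Phi> x) (l t) = (if s = t then 1 else 0)"
    and l_expand: "\<And>z. z \<in> coord_space S \<Longrightarrow> z = (\<Sum>s\<in>S. (\<Psi>' (\<Phi> x) (l s) \<bullet> \<Psi>' (\<Phi> x) z) *\<^sub>R l s)"
begin

abbreviation "p \<equiv> \<Phi> x"
abbreviation "A \<equiv> \<Psi>' p"

text \<open>
  The coordinates of the tangential part of \<open>w\<close> in the frame, placed on the axes in \<open>S\<close>: the
  projection takes values in the coordinate subspace instead of the tangent space.
\<close>

definition tproj :: "real^'n \<Rightarrow> real^'n" where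
  "tproj w = (\<Sum>s\<in>S. (A (l s) \<bullet> w) *\<^sub>R axis s 1)"

definition nproj :: "real^'n \<Rightarrow> real^'n" where
  "nproj w = w - (\<Sum>s\<in>S. (A (l s) \<bullet> w) *\<^sub>R A (l s))"

lemma linA: "linear A" by (rule twice_derivative_linear1[OF tw])

lemma tproj_component: "tproj w $ s = (if s \<in> S then A (l s) \<bullet> w else 0)"
proof -
  have "tproj w $ s = (\<Sum>t\<in>S. if t = s then A (l t) \<bullet> w else 0)"
    unfolding tproj_def sum_component by (intro sum.cong refl) (auto simp: axis_def)
  then show ?thesis by simp
qed

lemma lin_tproj: "linear tproj"
  by (auto simp: linear_iff vec_eq_iff tproj_component inner_add_right)

lemma tproj_in: "tproj w \<in> coord_space S"
  by (simp add: coord_space_def tproj_component)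

lemma tproj_norm: "(norm (tproj w))\<^sup>2 = (\<Sum>s\<in>S. (A (l s) \<bullet> w)\<^sup>2)"
proof -
  have "(norm (tproj w))\<^sup>2 = (\<Sum>s\<in>UNIV. (tproj w $ s)\<^sup>2)"
    by (simp add: norm_vec_def L2_set_def sum_nonneg)
  also have "\<dots> = (\<Sum>s\<in>S. (tproj w $ s)\<^sup>2)"
    by (rule sum_coord_support) (simp add: tproj_component)
  finally show ?thesis by (simp add: tproj_component)
qed

lemma pythagoras: "(norm w)\<^sup>2 = (norm (tproj w))\<^sup>2 + (norm (nproj w))\<^sup>2"
proof -
  define T where "T = (\<Sum>s\<in>S. (A (l s) \<bullet> w) *\<^sub>R A (l s))"
  have TT: "T \<bullet> A (l t) = A (l t) \<bullet> w" if "t \<in> S" for t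
  proof -
    have "T \<bullet> A (l t) = (\<Sum>s\<in>S. if s = t then A (l s) \<bullet> w else 0)"
      unfolding T_def inner_sum_left using that by (intro sum.cong refl) (simp add: l_on)
    then show ?thesis using that by simp
  qed
  have "T \<bullet> T = (\<Sum>s\<in>S. (A (l s) \<bullet> w) * (T \<bullet> A (l s)))"
    by (subst (2) T_def) (simp add: inner_sum_right)
  then have "T \<bullet> T = (norm (tproj w))\<^sup>2" by (simp add: TT tproj_norm flip: power2_eq_square)
  moreover have "w \<bullet> T = (norm (tproj w))\<^sup>2"
    unfolding T_def by (simp add: inner_sum_right tproj_norm inner_commute[of w] flip: power2_eq_square)
  ultimately show ?thesis
    unfolding nproj_def T_def[symmetric] power2_norm_eq_inner[of w] power2_norm_eq_inner[of "w - T"]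
    by (simp add: inner_diff_left inner_diff_right inner_commute[of T w])
qed

lemma tproj_le: "norm (tproj w) \<le> norm w"
  by (rule power2_le_imp_le[OF _ norm_ge_zero]) (unfold pythagoras[of w], simp)

lemma nproj_le: "norm (nproj w) \<le> norm w"
  by (rule power2_le_imp_le[OF _ norm_ge_zero]) (unfold pythagoras[of w], simp)

lemma lin_nproj: "linear nproj"
  by (auto simp: linear_iff nproj_def inner_add_right sum.distrib scaleR_add_left scaleR_diff_right scaleR_sum_right)

lemma A_expand: "z \<in> coord_space S \<Longrightarrow> A z = (\<Sum>s\<in>S. (A (l s) \<bullet> A z) *\<^sub>R A (l s))"
  using arg_cong[OF l_expand, of z A] by (simp add: linear_sum[OF linA] linear_cmul[OF linA])

lemma nproj_tangent: "z \<in> coord_space S \<Longrightarrow> nproj (A z) = 0"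
  using A_expand by (simp add: nproj_def)

lemma p_in: "p \<in> V" "p \<in> coord_space S" "\<Psi> p = x"
  using image x_in xU homeo by (auto simp: homeomorphism_def)

text \<open>
  A chord of \<open>M\<close> differs from the tangent vector \<open>A (\<Phi> y - \<Phi> y')\<close> by \<open>O(r)\<close> times its length.
\<close>

lemma chart_estimates:
  obtains K C d where "0 < K" "0 \<le> C" "0 < d"
    "\<And>r y y'. r \<le> d \<Longrightarrow> y \<in> M \<inter> cball x r \<Longrightarrow> y' \<in> M \<inter> cball x r \<Longrightarrow>
      \<Phi> y - \<Phi> y' \<in> coord_space S \<and> norm (\<Phi> y - \<Phi> y') \<le> K * norm (y - y') \<and>
      \<Psi> (\<Phi> y) = y \<and> norm (y - y' - A (\<Phi> y - \<Phi> y')) \<le> C * r * norm (y - y')"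
proof -
  obtain K d1 where K: "0 < K" "0 < d1"
    "\<And>y y'. y \<in> cball x d1 \<Longrightarrow> y' \<in> cball x d1 \<Longrightarrow> norm (\<Phi> y - \<Phi> y') \<le> K * norm (y - y')"
    using lip by metis
  obtain C d2 where C: "0 \<le> C" "0 < d2"
    "\<And>\<rho> w w'. \<rho> \<le> d2 \<Longrightarrow> w \<in> cball p \<rho> \<Longrightarrow> w' \<in> cball p \<rho> \<Longrightarrow>
      norm (\<Psi> w - \<Psi> w' - A (w - w')) \<le> C * \<rho> * norm (w - w')"
    using twice_derivative_quadratic_remainder[OF tw] by metis
  obtain d3 where d3: "0 < d3" "cball x d3 \<subseteq> U"
    using openU xU open_contains_cball by blast
  define d where "d = min (min d1 d3) (d2 / K)"
  have d: "0 < d" "d \<le> d1" "d \<le> d3"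
    using K(1,2) C(2) d3(1) by (auto simp: d_def)
  have "d \<le> d2 / K" by (simp add: d_def)
  then have Kd: "K * d \<le> d2" using K(1) by (simp add: field_simps)
  show ?thesis
  proof (rule that[of K "C * K * K" d])
    fix r y y' assume r: "r \<le> d" and y: "y \<in> M \<inter> cball x r" "y' \<in> M \<inter> cball x r"
    have r0: "0 \<le> r" using y(1) zero_le_dist[of x y] by (simp del: zero_le_dist)
    have sub: "cball x r \<subseteq> cball x d1" "cball x r \<subseteq> U" using r d d3 by (auto intro: order_trans)
    have "\<Phi> y \<in> coord_space S" "\<Phi> y' \<in> coord_space S" using y sub image by blast+
    then have cs: "\<Phi> y - \<Phi> y' \<in> coord_space S" by (simp add: subspace_diff)
    have inv: "\<Psi> (\<Phi> y) = y" "\<Psi> (\<Phi> y') = y'" using y sub homeo by (auto simp: homeomorphism_def)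
    have bnd: "norm (\<Phi> y - \<Phi> y') \<le> K * norm (y - y')" using y sub by (intro K(3)) auto
    have ball: "\<Phi> z \<in> cball p (K * r)" if "z \<in> cball x r" for z
    proof -
      have "norm (\<Phi> z - p) \<le> K * norm (z - x)" using that sub K(2) by (intro K(3)) auto
      also have "\<dots> \<le> K * r" using that K(1) by (intro mult_left_mono) (auto simp: dist_norm norm_minus_commute)
      finally show ?thesis by (simp add: dist_norm norm_minus_commute)
    qed
    have "K * r \<le> d2" using r Kd K(1) by (meson mult_left_mono less_imp_le order_trans)
    then have "norm (y - y' - A (\<Phi> y - \<Phi> y')) \<le> C * (K * r) * norm (\<Phi> y - \<Phi> y')"
      using C(3)[of "K * r" "\<Phi> y" "\<Phi> y'"] ball y inv by auto
    also have "\<dots> \<le> C * (K * r) * (K * norm (y - y'))"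
      using C K r0 bnd by (intro mult_left_mono) auto
    also have "\<dots> = C * K * K * r * norm (y - y')" by simp
    finally show "\<Phi> y - \<Phi> y' \<in> coord_space S \<and> norm (\<Phi> y - \<Phi> y') \<le> K * norm (y - y') \<and>
      \<Psi> (\<Phi> y) = y \<and> norm (y - y' - A (\<Phi> y - \<Phi> y')) \<le> C * K * K * r * norm (y - y')"
      using cs bnd inv by simp
  qed (use K C d in auto)
qed

text \<open>
  The projection composed with the parametrisation has an invertible derivative on the coordinate
  subspace, so it maps neighbourhoods of \<open>p\<close> onto neighbourhoods of \<open>0\<close>.
\<close>

lemma projection_onto:
  assumes "0 < \<epsilon>"
  obtains \<eta> where "0 < \<eta>" "\<And>v. v \<in> coord_space S \<Longrightarrow> norm v < \<eta> \<Longrightarrow> \<exists>y\<in>M \<inter> cball x \<epsilon>. tproj (y - x) = v"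
proof -
  define P :: "real^'n \<Rightarrow> real^'n" where "P z = (\<chi> i. if i \<in> S then z $ i else 0)" for z
  have linP: "linear P" by (auto simp: P_def linear_iff vec_eq_iff)
  have P_in: "P z \<in> coord_space S" for z by (simp add: P_def coord_space_def)
  have P_id: "z \<in> coord_space S \<Longrightarrow> P z = z" for z by (auto simp: P_def coord_space_def vec_eq_iff)
  have cP: "isCont P z" for z using linP by (simp add: linear_continuous_at linear_linear)
  define F where "F z = tproj (\<Psi> (p + P z) - x) + (z - P z)" for z
  have F0: "F 0 = 0" by (simp add: F_def linear_0[OF linP] linear_0[OF lin_tproj] p_in)
  \<comment> \<open>the chart is padded by the identity on the complementary axes to become a local homeomorphism of the whole space\<close>
  have contV: "continuous_on V \<Psi>" and VU: "\<Psi> ` V = U" using homeo by (auto simp: homeomorphism_def)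
  define W where "W = (\<lambda>z. p + P z) -` (V \<inter> \<Psi> -` ball x \<epsilon>)"
  have op: "open (V \<inter> \<Psi> -` ball x \<epsilon>)" using contV openV by (simp add: continuous_open_preimage)
  have "open W" unfolding W_def
    by (rule open_vimage[OF op]) (intro continuous_on_add continuous_on_const
      linear_continuous_on[OF linear_conv_bounded_linear[THEN iffD1, OF linP]])
  have W0: "0 \<in> W" using p_in \<open>0 < \<epsilon>\<close> by (simp add: W_def linear_0[OF linP])
  have contF: "continuous_on W F"
  proof -
    have cPW: "continuous_on W P" using cP by (simp add: continuous_at_imp_continuous_on)
    have "continuous_on W (\<lambda>z. \<Psi> (p + P z))"
    proof (rule continuous_on_compose2[OF contV])
      show "continuous_on W (\<lambda>z. p + P z)" by (intro continuous_intros cPW)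
    qed (auto simp: W_def)
    then have "continuous_on W (\<lambda>z. tproj (\<Psi> (p + P z) - x))"
      using continuous_on_compose2[OF linear_continuous_on[OF linear_conv_bounded_linear[THEN iffD1, OF lin_tproj], of UNIV], of W "\<lambda>z. \<Psi> (p + P z) - x"]
      by (simp add: continuous_on_diff)
    then show ?thesis unfolding F_def[abs_def] by (intro continuous_intros cPW)
  qed
  have derF: "(F has_derivative (\<lambda>h. tproj (A (P h)) + (h - P h))) (at 0)"
  proof -
    have "((\<lambda>z. p + P z) has_derivative P) (at 0)"
      using linear_imp_has_derivative[OF linP] by (auto intro!: derivative_eq_intros)
    moreover have "(\<Psi> has_derivative A) (at (p + P 0))"
      using twice_derivativeD1[OF tw] by (simp add: linear_0[OF linP])
    ultimately have "((\<lambda>z. \<Psi> (p + P z)) has_derivative (\<lambda>h. A (P h))) (at 0)"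
      by (rule has_derivative_compose)
    then have "((\<lambda>z. \<Psi> (p + P z) - x) has_derivative (\<lambda>h. A (P h))) (at 0)"
      by (auto intro!: derivative_eq_intros)
    then have "((\<lambda>z. tproj (\<Psi> (p + P z) - x)) has_derivative (\<lambda>h. tproj (A (P h)))) (at 0)"
      by (rule bounded_linear.has_derivative[OF linear_conv_bounded_linear[THEN iffD1, OF lin_tproj]])
    then show ?thesis unfolding F_def[abs_def]
      by (intro has_derivative_add has_derivative_diff has_derivative_ident linear_imp_has_derivative linP)
  qed
  define L where "L v = (\<Sum>s\<in>S. v $ s *\<^sub>R l s)" for v :: "real^'n"
  have linL: "linear L" by (auto simp: L_def linear_iff scaleR_add_left sum.distrib scaleR_sum_right)
  have L_in: "L v \<in> coord_space S" for v unfolding L_def by (intro subspace_sum subspace_mul l_in) auto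
  have tAL: "tproj (A (L v)) = P v" for v
  proof -
    have "A (l t) \<bullet> A (L v) = v $ t" if "t \<in> S" for t
    proof -
      have "A (l t) \<bullet> A (L v) = (\<Sum>s\<in>S. if s = t then v $ s else 0)"
        unfolding L_def linear_sum[OF linA] linear_cmul[OF linA] inner_sum_right
        using that by (intro sum.cong refl) (simp add: l_on)
      then show ?thesis using that by simp
    qed
    then show ?thesis by (simp add: vec_eq_iff tproj_component P_def)
  qed
  define R where "R v = L v + (v - P v)" for v
  have PP: "P (P v) = P v" for v by (rule P_id[OF P_in])
  have PR: "P (R v) = L v" for v
    by (simp add: R_def linear_add[OF linP] linear_diff[OF linP] PP P_id[OF L_in])
  have right_inv: "(\<lambda>h. tproj (A (P h)) + (h - P h)) \<circ> R = id"
    by (simp add: fun_eq_iff PR tAL) (simp add: R_def)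
  have "bounded_linear R" unfolding R_def[abs_def] linear_conv_bounded_linear[symmetric]
    by (intro linear_compose_add linear_compose_sub linL linP linear_ident)
  then have "F 0 \<in> interior (F ` W)"
    using sussmann_open_mapping[OF \<open>open W\<close> contF W0 derF _ right_inv order_refl] \<open>open W\<close> W0
    by (simp add: interior_open)
  then obtain \<eta> where \<eta>: "0 < \<eta>" "ball 0 \<eta> \<subseteq> F ` W"
    unfolding F0 mem_interior by blast
  show ?thesis
  proof (rule that[OF \<eta>(1)])
    fix v assume v: "v \<in> coord_space S" "norm v < \<eta>"
    then obtain z where z: "z \<in> W" "v = F z" using \<eta>(2) by (metis image_iff mem_ball_0 subsetD)
    have "z - P z = P (z - P z)"
    proof -
      have "z - P z = v - tproj (\<Psi> (p + P z) - x)" by (simp add: z F_def)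
      then have "z - P z \<in> coord_space S" using v tproj_in by (simp add: subspace_diff)
      then show ?thesis by (rule P_id[symmetric])
    qed
    also have "\<dots> = 0" by (simp add: linear_diff[OF linP] PP)
    finally have zP: "tproj (\<Psi> (p + P z) - x) = v" by (simp add: z F_def)
    have pz: "p + P z \<in> V \<inter> coord_space S"
      using z(1) p_in P_in by (auto simp: W_def intro: subspace_add)
    then obtain y where y: "y \<in> M \<inter> U" "p + P z = \<Phi> y" using image by (metis imageE)
    then have "\<Psi> (p + P z) = y" using homeo by (auto simp: homeomorphism_def)
    then show "\<exists>y\<in>M \<inter> cball x \<epsilon>. tproj (y - x) = v"
      using zP z(1) y by (auto simp: W_def intro!: bexI[of _ y])
  qed
qed

text \<open>
  Tangent vectors have no normal part, so the normal part of a chord is bounded by the error in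
  \<open>chart_estimates\<close>, and Pythagoras gives the flatness inequality.
\<close>

lemma nearly_flat_exists: "\<exists>C \<epsilon> \<eta>. nearly_flat M x S tproj C \<epsilon> \<eta>"
proof -
  obtain K C d where KC: "0 < K" "0 \<le> C" "0 < d"
    "\<And>r y y'. r \<le> d \<Longrightarrow> y \<in> M \<inter> cball x r \<Longrightarrow> y' \<in> M \<inter> cball x r \<Longrightarrow>
      \<Phi> y - \<Phi> y' \<in> coord_space S \<and> norm (\<Phi> y - \<Phi> y') \<le> K * norm (y - y') \<and>
      \<Psi> (\<Phi> y) = y \<and> norm (y - y' - A (\<Phi> y - \<Phi> y')) \<le> C * r * norm (y - y')"
    using chart_estimates by metis
  \<comment> \<open>this makes \<open>C * \<epsilon>\<close> at most \<open>1 / 2\<close>\<close>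
  define \<epsilon> where "\<epsilon> = min d (1 / (2 * (C + 1)))"
  have \<epsilon>: "0 < \<epsilon>" "\<epsilon> \<le> d" "\<epsilon> \<le> 1 / (2 * (C + 1))" using KC by (auto simp: \<epsilon>_def)
  have "C * \<epsilon> \<le> (C + 1) * (1 / (2 * (C + 1)))" using \<epsilon> KC by (intro mult_mono) auto
  also have "\<dots> = 1 / 2" using KC by simp
  finally have "(C * \<epsilon>)\<^sup>2 \<le> (1 / 2)\<^sup>2" using \<epsilon> KC by (intro power_mono) auto
  then have C\<epsilon>: "(C * \<epsilon>)\<^sup>2 \<le> 1 / 2" by (simp add: power2_eq_square)
  obtain \<eta> where \<eta>: "0 < \<eta>" "\<And>v. v \<in> coord_space S \<Longrightarrow> norm v < \<eta> \<Longrightarrow> \<exists>y\<in>M \<inter> cball x \<epsilon>. tproj (y - x) = v"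
    using projection_onto[OF \<epsilon>(1)] by metis
  have "nearly_flat M x S tproj C \<epsilon> \<eta>"
  proof
    fix r y y' assume r: "r \<le> \<epsilon>" and y: "y \<in> M \<inter> cball x r" "y' \<in> M \<inter> cball x r"
    let ?w = "\<Phi> y - \<Phi> y'"
    have est: "?w \<in> coord_space S" "norm (y - y' - A ?w) \<le> C * r * norm (y - y')"
      using KC(4)[of r y y'] r y \<epsilon> by auto
    have "nproj (y - y') = nproj (y - y' - A ?w)"
      by (simp add: linear_diff[OF lin_nproj, of "y - y'" "A ?w"] nproj_tangent[OF est(1)])
    then have "norm (nproj (y - y')) \<le> C * r * norm (y - y')"
      using nproj_le[of "y - y' - A ?w"] est(2) by simp
    then have "(norm (nproj (y - y')))\<^sup>2 \<le> (C * r * norm (y - y'))\<^sup>2" by (intro power_mono) auto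
    then show "(1 - (C * r)\<^sup>2) * (norm (y - y'))\<^sup>2 \<le> (norm (tproj (y - y')))\<^sup>2"
      using pythagoras[of "y - y'"] by (simp add: left_diff_distrib power_mult_distrib)
  qed (use closed_M x_in tproj_in tproj_le \<epsilon> C\<epsilon> \<eta> in
      \<open>auto simp: linear_add[OF lin_tproj] linear_cmul[OF lin_tproj]\<close>)
  then show ?thesis by blast
qed

text \<open>
  Subtracting \<open>c \<bullet> \<Psi>\<close>, where \<open>c\<close> is the tangential gradient of \<open>u\<close>, makes \<open>p\<close> a critical point along
  the coordinate subspace, so the Taylor expansion there starts with its quadratic term.  In that
  term the coordinates \<open>z = \<Phi> y - p\<close> may be replaced by \<open>L = \<Sum>s\<in>S. v $ s *\<^sub>R l s\<close> with
  \<open>v = tproj (y - x)\<close>, because \<open>L - z = O(\<bar>y - x\<bar>\<^sup>2)\<close>.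
\<close>

lemma second_order_expansion:
  fixes u :: "real^'n \<Rightarrow> real"
  assumes f: "twice_derivative (u \<circ> \<Psi>) f' f'' p"
  defines "c \<equiv> \<Sum>t\<in>S. f' p (l t) *\<^sub>R A (l t)"
  defines "H \<equiv> \<lambda>i j. f'' (axis j 1) (axis i 1) - c \<bullet> \<Psi>'' (axis j 1) (axis i 1)"
  defines "q \<equiv> \<lambda>s t. (\<Sum>i\<in>S. \<Sum>j\<in>S. l s $ i * l t $ j * H i j) / 2"
  assumes "0 < e"
  shows "\<exists>d>0. \<forall>y\<in>M. dist x y < d \<longrightarrow>
    \<bar>u y - u x - ((\<Sum>s\<in>S. f' p (l s) * tproj (y - x) $ s)
      + (\<Sum>s\<in>S. \<Sum>t\<in>S. q s t * (tproj (y - x) $ s * tproj (y - x) $ t)))\<bar> \<le> e * (dist x y)\<^sup>2"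
proof -
  define h where "h w = (u \<circ> \<Psi>) w - c \<bullet> \<Psi> w" for w
  have twh: "twice_derivative h (\<lambda>w v. f' w v - c \<bullet> \<Psi>' w v) (\<lambda>v \<xi>. f'' v \<xi> - c \<bullet> \<Psi>'' v \<xi>) p"
    unfolding h_def[abs_def] by (intro twice_derivative_diff twice_derivative_inner f tw)
  have linf: "linear (f' p)" by (rule twice_derivative_linear1[OF f])
  have crit: "f' p z - c \<bullet> A z = 0" if z: "z \<in> coord_space S" for z
  proof -
    have "f' p z = f' p (\<Sum>s\<in>S. (A (l s) \<bullet> A z) *\<^sub>R l s)" using l_expand[OF z] by simp
    then show ?thesis
      by (simp add: linear_sum[OF linf] linear_cmul[OF linf] c_def inner_sum_left mult.commute)
  qed
  obtain K C d0 where KC: "0 < K" "0 \<le> C" "0 < d0"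
    "\<And>r y y'. r \<le> d0 \<Longrightarrow> y \<in> M \<inter> cball x r \<Longrightarrow> y' \<in> M \<inter> cball x r \<Longrightarrow>
      \<Phi> y - \<Phi> y' \<in> coord_space S \<and> norm (\<Phi> y - \<Phi> y') \<le> K * norm (y - y') \<and>
      \<Psi> (\<Phi> y) = y \<and> norm (y - y' - A (\<Phi> y - \<Phi> y')) \<le> C * r * norm (y - y')"
    using chart_estimates by metis
  \<comment> \<open>half of the admissible error is spent on the Taylor remainder, half on replacing \<open>z\<close> by \<open>L\<close>\<close>
  define e1 where "e1 = e / (2 * K\<^sup>2)"
  have e1: "0 < e1" using \<open>0 < e\<close> KC by (simp add: e1_def)
  obtain d1 where d1: "0 < d1" "\<And>z. norm z < d1 \<Longrightarrow>
    \<bar>h (p + z) - h p - (f' p z - c \<bullet> A z) - (\<Sum>i\<in>UNIV. \<Sum>j\<in>UNIV. z $ i * z $ j * H i j) / 2\<bar> \<le> e1 * (norm z)\<^sup>2"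
    unfolding H_def by (rule taylor_second_order[OF twh e1]) blast
  define B where "B = (\<Sum>i\<in>S. \<Sum>j\<in>S. \<bar>H i j\<bar>)"
  define \<Lambda> where "\<Lambda> = (\<Sum>s\<in>S. norm (l s))"
  define E where "E = B * (\<Lambda> * C) * (K + \<Lambda>)"
  have B0: "0 \<le> B" "0 \<le> \<Lambda>" by (auto simp: B_def \<Lambda>_def sum_nonneg)
  have E0: "0 \<le> E" using B0 KC by (simp add: E_def)
  define d where "d = min (min d0 (d1 / K)) (e / (E + 1))"
  have d: "0 < d" "d \<le> d0" "K * d \<le> d1" "E * d \<le> e"
  proof -
    show "0 < d" "d \<le> d0" using KC d1 E0 \<open>0 < e\<close> by (auto simp: d_def)
    have "d \<le> d1 / K" by (simp add: d_def)
    then show "K * d \<le> d1" using KC by (simp add: field_simps)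
    have "E * d \<le> (E + 1) * (e / (E + 1))" using E0 \<open>0 < d\<close> by (intro mult_mono) (auto simp: d_def)
    then show "E * d \<le> e" using E0 by simp
  qed
  show ?thesis
  proof (intro exI[of _ d] conjI ballI impI d(1))
    fix y assume y: "y \<in> M" "dist x y < d"
    define r where "r = dist x y"
    have r: "0 \<le> r" "r < d" "r = norm (y - x)" using y by (auto simp: r_def dist_norm norm_minus_commute)
    define z where "z = \<Phi> y - p"
    have est: "z \<in> coord_space S" "norm z \<le> K * r" "\<Psi> (p + z) = y" "norm (y - x - A z) \<le> C * r * r"
      using KC(4)[of r y x] r d y x_in by (auto simp: z_def r_def dist_norm norm_minus_commute)
    define v where "v = tproj (y - x)"
    define L where "L = (\<Sum>s\<in>S. v $ s *\<^sub>R l s)"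
    have v_le: "\<bar>v $ s\<bar> \<le> r" for s
      using component_le_norm_cart[of v s] tproj_le[of "y - x"] r by (simp add: v_def)
    have nL: "norm L \<le> \<Lambda> * r"
      unfolding L_def \<Lambda>_def sum_distrib_right
      by (rule order_trans[OF norm_sum]) (auto intro!: sum_mono mult_mono v_le simp: mult.commute[of "norm _"] r(1))
    have Lz: "norm (L - z) \<le> \<Lambda> * C * r\<^sup>2"
    proof -
      have "v $ s - A (l s) \<bullet> A z = A (l s) \<bullet> (y - x - A z)" if "s \<in> S" for s
        using that by (simp add: v_def tproj_component inner_diff_right)
      moreover have "\<bar>A (l s) \<bullet> (y - x - A z)\<bar> \<le> C * r\<^sup>2" if "s \<in> S" for s
      proof -
        have "norm (A (l s)) = 1" using l_on[OF that that] by (simp add: norm_eq_sqrt_inner)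
        then show ?thesis using Cauchy_Schwarz_ineq2[of "A (l s)" "y - x - A z"] est(4)
          by (simp add: power2_eq_square)
      qed
      ultimately have vs: "\<bar>v $ s - A (l s) \<bullet> A z\<bar> \<le> C * r\<^sup>2" if "s \<in> S" for s using that by simp
      have "L - z = (\<Sum>s\<in>S. (v $ s - A (l s) \<bullet> A z) *\<^sub>R l s)"
        by (subst l_expand[OF est(1)]) (simp add: L_def scaleR_diff_left sum_subtractf)
      also have "norm \<dots> \<le> (\<Sum>s\<in>S. norm (l s) * (C * r\<^sup>2))"
        by (rule order_trans[OF norm_sum]) (auto intro!: sum_mono mult_mono vs simp: mult.commute[of "norm _"] KC(2))
      finally show ?thesis by (simp add: \<Lambda>_def sum_distrib_right mult.assoc)
    qed
    have quad: "(\<Sum>s\<in>S. \<Sum>t\<in>S. q s t * (v $ s * v $ t)) = (\<Sum>i\<in>S. \<Sum>j\<in>S. L $ i * L $ j * H i j) / 2"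
    proof -
      have Li: "L $ i = (\<Sum>s\<in>S. v $ s * l s $ i)" for i by (simp add: L_def)
      have LL: "L $ i * L $ j * H i j = (\<Sum>s\<in>S. \<Sum>t\<in>S. l s $ i * l t $ j * H i j * (v $ s * v $ t))" for i j
        unfolding Li unfolding sum_product unfolding sum_distrib_right by (intro sum.cong refl) (simp add: mult_ac)
      have "(\<Sum>i\<in>S. \<Sum>j\<in>S. L $ i * L $ j * H i j)
          = (\<Sum>i\<in>S. \<Sum>j\<in>S. \<Sum>s\<in>S. \<Sum>t\<in>S. l s $ i * l t $ j * H i j * (v $ s * v $ t))"
        by (simp only: LL)
      also have "\<dots> = (\<Sum>i\<in>S. \<Sum>s\<in>S. \<Sum>j\<in>S. \<Sum>t\<in>S. l s $ i * l t $ j * H i j * (v $ s * v $ t))"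
        by (rule sum.cong[OF refl], rule sum.swap)
      also have "\<dots> = (\<Sum>s\<in>S. \<Sum>i\<in>S. \<Sum>j\<in>S. \<Sum>t\<in>S. l s $ i * l t $ j * H i j * (v $ s * v $ t))"
        by (rule sum.swap)
      also have "\<dots> = (\<Sum>s\<in>S. \<Sum>i\<in>S. \<Sum>t\<in>S. \<Sum>j\<in>S. l s $ i * l t $ j * H i j * (v $ s * v $ t))"
        by (rule sum.cong[OF refl], rule sum.cong[OF refl], rule sum.swap)
      also have "\<dots> = (\<Sum>s\<in>S. \<Sum>t\<in>S. \<Sum>i\<in>S. \<Sum>j\<in>S. l s $ i * l t $ j * H i j * (v $ s * v $ t))"
        by (rule sum.cong[OF refl], rule sum.swap)
      finally show ?thesis by (simp add: q_def sum_divide_distrib sum_distrib_right)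
    qed
    have zS: "(\<Sum>i\<in>UNIV. \<Sum>j\<in>UNIV. z $ i * z $ j * H i j) = (\<Sum>i\<in>S. \<Sum>j\<in>S. z $ i * z $ j * H i j)"
    proof -
      have z0: "i \<notin> S \<Longrightarrow> z $ i = 0" for i using est(1) by (simp add: coord_space_def)
      have "(\<Sum>j\<in>UNIV. z $ i * z $ j * H i j) = (\<Sum>j\<in>S. z $ i * z $ j * H i j)" for i
        by (rule sum_coord_support) (simp add: z0)
      then have "(\<Sum>i\<in>UNIV. \<Sum>j\<in>UNIV. z $ i * z $ j * H i j) = (\<Sum>i\<in>UNIV. \<Sum>j\<in>S. z $ i * z $ j * H i j)" by simp
      also have "\<dots> = (\<Sum>i\<in>S. \<Sum>j\<in>S. z $ i * z $ j * H i j)" by (rule sum_coord_support) (simp add: z0)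
      finally show ?thesis .
    qed
    have "\<bar>(\<Sum>i\<in>S. \<Sum>j\<in>S. z $ i * z $ j * H i j) - (\<Sum>i\<in>S. \<Sum>j\<in>S. L $ i * L $ j * H i j)\<bar>
        \<le> (\<Sum>i\<in>S. \<Sum>j\<in>S. \<bar>H i j\<bar> * ((\<Lambda> * C * r\<^sup>2) * ((K + \<Lambda>) * r)))"
      unfolding sum_subtractf[symmetric]
    proof (rule order_trans[OF sum_abs], rule sum_mono, rule order_trans[OF sum_abs], rule sum_mono)
      fix i j
      have zi: "\<bar>z $ i\<bar> \<le> K * r" for i using component_le_norm_cart[of z i] est(2) by linarith
      have Li: "\<bar>L $ i\<bar> \<le> \<Lambda> * r" for i using component_le_norm_cart[of L i] nL by linarith
      have Di: "\<bar>z $ i - L $ i\<bar> \<le> \<Lambda> * C * r\<^sup>2" for i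
        using component_le_norm_cart[of "L - z" i] Lz by (simp add: abs_minus_commute)
      have "z $ i * z $ j - L $ i * L $ j = (z $ i - L $ i) * z $ j + (z $ j - L $ j) * L $ i"
        by (simp add: algebra_simps)
      then have "\<bar>z $ i * z $ j - L $ i * L $ j\<bar> \<le> \<bar>z $ i - L $ i\<bar> * \<bar>z $ j\<bar> + \<bar>z $ j - L $ j\<bar> * \<bar>L $ i\<bar>"
        by (metis abs_mult abs_triangle_ineq)
      also have "\<dots> \<le> (\<Lambda> * C * r\<^sup>2) * (K * r) + (\<Lambda> * C * r\<^sup>2) * (\<Lambda> * r)"
        using B0 KC r by (intro add_mono mult_mono Di zi Li) auto
      also have "\<dots> = (\<Lambda> * C * r\<^sup>2) * ((K + \<Lambda>) * r)" by (simp add: algebra_simps)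
      finally have "\<bar>H i j\<bar> * \<bar>z $ i * z $ j - L $ i * L $ j\<bar> \<le> \<bar>H i j\<bar> * ((\<Lambda> * C * r\<^sup>2) * ((K + \<Lambda>) * r))"
        by (intro mult_left_mono) auto
      then show "\<bar>z $ i * z $ j * H i j - L $ i * L $ j * H i j\<bar> \<le> \<bar>H i j\<bar> * ((\<Lambda> * C * r\<^sup>2) * ((K + \<Lambda>) * r))"
        unfolding left_diff_distrib[symmetric] abs_mult[of "z $ i * z $ j - L $ i * L $ j"]
        by (simp only: mult.commute)
    qed
    also have "\<dots> = (E * r) * r\<^sup>2"
      by (simp add: sum_distrib_right[symmetric] B_def[symmetric] E_def)
    also have "\<dots> \<le> e * r\<^sup>2"
    proof (rule mult_right_mono)
      have "E * r \<le> E * d" using r E0 by (intro mult_left_mono) auto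
      then show "E * r \<le> e" using d by simp
    qed simp
    finally have main: "\<bar>(\<Sum>i\<in>S. \<Sum>j\<in>S. z $ i * z $ j * H i j) - (\<Sum>i\<in>S. \<Sum>j\<in>S. L $ i * L $ j * H i j)\<bar> \<le> e * r\<^sup>2" .
    have "norm z < d1"
    proof -
      have "K * r < K * d" using r KC by simp
      then show ?thesis using est(2) d by linarith
    qed
    then have tay: "\<bar>h (p + z) - h p - (\<Sum>i\<in>S. \<Sum>j\<in>S. z $ i * z $ j * H i j) / 2\<bar> \<le> e1 * (norm z)\<^sup>2"
      using d1(2)[of z] unfolding crit[OF est(1)] zS by simp
    also have "\<dots> \<le> e1 * (K * r)\<^sup>2" using e1 est(2) by (intro mult_left_mono power_mono) auto
    also have "\<dots> = e / 2 * r\<^sup>2" using KC by (simp add: e1_def power_mult_distrib)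
    finally have tay: "\<bar>h (p + z) - h p - (\<Sum>i\<in>S. \<Sum>j\<in>S. z $ i * z $ j * H i j) / 2\<bar> \<le> e / 2 * r\<^sup>2" .
    have "(\<Sum>s\<in>S. f' p (l s) * v $ s) = c \<bullet> (y - x)"
      by (simp add: c_def inner_sum_left v_def tproj_component)
    then have "h (p + z) - h p = u y - u x - (\<Sum>s\<in>S. f' p (l s) * v $ s)"
      using est(3) p_in by (simp add: h_def inner_diff_right)
    then show "\<bar>u y - u x - ((\<Sum>s\<in>S. f' p (l s) * tproj (y - x) $ s)
      + (\<Sum>s\<in>S. \<Sum>t\<in>S. q s t * (tproj (y - x) $ s * tproj (y - x) $ t)))\<bar> \<le> e * (dist x y)\<^sup>2"
      using tay main unfolding v_def[symmetric] r_def[symmetric] quad by linarith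
  qed
qed

theorem amv_limit_laplace:
  fixes u :: "real^'n \<Rightarrow> real"
  assumes u: "continuous_on UNIV u" and f: "twice_derivative (u \<circ> \<Psi>) f' f'' p"
  shows "((\<lambda>r. amv_laplacian_r (hausdorff_on (card S) M) r u x) \<longlongrightarrow>
    laplace_in_chart \<Psi> S (u \<circ> \<Psi>) p / (2 * (real (card S) + 2))) (at_right 0)"
proof -
  obtain C \<epsilon> \<eta> where nf: "nearly_flat M x S tproj C \<epsilon> \<eta>" using nearly_flat_exists by blast
  define c where "c = (\<Sum>t\<in>S. f' p (l t) *\<^sub>R A (l t))"
  define H where "H i j = f'' (axis j 1) (axis i 1) - c \<bullet> \<Psi>'' (axis j 1) (axis i 1)" for i j
  define q where "q s t = (\<Sum>i\<in>S. \<Sum>j\<in>S. l s $ i * l t $ j * H i j) / 2" for s t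
  have "((\<lambda>r. amv_laplacian_r (hausdorff_on (card S) M) r u x) \<longlongrightarrow> (\<Sum>s\<in>S. q s s) / (real (card S) + 2)) (at_right 0)"
    using second_order_expansion[OF f] unfolding c_def[symmetric] H_def[symmetric] q_def[symmetric]
    by (intro nearly_flat.amv_limit[OF nf u, where a="\<lambda>s. f' p (l s)"]) auto
  moreover have "laplace_in_chart \<Psi> S (u \<circ> \<Psi>) p = (\<Sum>s\<in>S. \<Sum>i\<in>S. \<Sum>j\<in>S. l s $ i * l s $ j * H i j)"
    unfolding H_def c_def by (rule laplace_in_chart_orthonormal[OF tw f]) (erule l_in, erule l_on)
  then have "(\<Sum>s\<in>S. q s s) = laplace_in_chart \<Psi> S (u \<circ> \<Psi>) p / 2"
    by (simp add: q_def sum_divide_distrib)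
  ultimately show ?thesis by (simp add: divide_divide_eq_left)
qed

end

text \<open>
  Differentiating \<open>\<Phi> \<circ> \<Psi> = id\<close> shows that the derivative of \<open>\<Psi>\<close> is injective on the coordinate
  subspace, so an orthonormal frame of its image can be pulled back.
\<close>

lemma slice_chart_framed:
  assumes closed: "closed M" and x: "x \<in> M" and chart: "slice_chart m M x U V \<Phi> \<Psi> S"
  obtains \<Psi>' \<Psi>'' l where "framed_chart M x U V \<Phi> \<Psi> S \<Psi>' \<Psi>'' l"
proof -
  have U: "open U" "open V" "x \<in> U" "homeomorphism U V \<Phi> \<Psi>" "smooth_on U \<Phi>" "smooth_on V \<Psi>"
    and img: "\<Phi> ` (M \<inter> U) = V \<inter> coord_space S"
    using chart by (auto simp: slice_chart_def coord_space_def)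
  have pV: "\<Phi> x \<in> V" using U by (auto simp: homeomorphism_def)
  obtain \<Phi>' \<Phi>'' where tw\<Phi>: "twice_derivative \<Phi> \<Phi>' \<Phi>'' x"
    using Ck_on_2_imp_twice_derivative[of U \<Phi> x] U unfolding smooth_on_def by metis
  obtain \<Psi>' \<Psi>'' where tw\<Psi>: "twice_derivative \<Psi> \<Psi>' \<Psi>'' (\<Phi> x)"
    using Ck_on_2_imp_twice_derivative[of V \<Psi> "\<Phi> x"] U pV unfolding smooth_on_def by metis
  have lip: "\<exists>K>0. \<exists>d>0. \<forall>y\<in>cball x d. \<forall>y'\<in>cball x d. norm (\<Phi> y - \<Phi> y') \<le> K * norm (y - y')"
  proof -
    obtain C d where C: "0 \<le> C" "0 < d" "\<And>\<rho> w w'. \<rho> \<le> d \<Longrightarrow> w \<in> cball x \<rho> \<Longrightarrow> w' \<in> cball x \<rho> \<Longrightarrow>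
        norm (\<Phi> w - \<Phi> w' - \<Phi>' x (w - w')) \<le> C * \<rho> * norm (w - w')"
      using twice_derivative_quadratic_remainder[OF tw\<Phi>] by metis
    have bl: "bounded_linear (\<Phi>' x)"
      using twice_derivativeD1[OF tw\<Phi>] by (rule has_derivative_bounded_linear)
    have o: "0 \<le> onorm (\<Phi>' x)" using bl by (rule onorm_pos_le)
    have "norm (\<Phi> y - \<Phi> y') \<le> (onorm (\<Phi>' x) + C * d + 1) * norm (y - y')" if "y \<in> cball x d" "y' \<in> cball x d" for y y'
    proof -
      have "norm (\<Phi> y - \<Phi> y') \<le> norm (\<Phi>' x (y - y')) + norm (\<Phi> y - \<Phi> y' - \<Phi>' x (y - y'))"
        by (rule norm_triangle_sub)
      also have "\<dots> \<le> onorm (\<Phi>' x) * norm (y - y') + C * d * norm (y - y')"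
        using C(3)[of d y y'] that onorm[OF bl] by (intro add_mono) auto
      also have "\<dots> \<le> (onorm (\<Phi>' x) + C * d + 1) * norm (y - y')" by (simp add: distrib_right)
      finally show ?thesis .
    qed
    moreover have "0 < onorm (\<Phi>' x) + C * d + 1" using o C by (simp add: add_nonneg_pos)
    ultimately show ?thesis using C(2) by blast
  qed
  have inv: "\<Phi>' x (\<Psi>' (\<Phi> x) z) = z" for z
  proof -
    have px: "\<Psi> (\<Phi> x) = x" using U by (auto simp: homeomorphism_def)
    have "((\<Phi> \<circ> \<Psi>) has_derivative (\<Phi>' x \<circ> \<Psi>' (\<Phi> x))) (at (\<Phi> x))"
      using diff_chain_at[OF twice_derivativeD1[OF tw\<Psi>]] twice_derivativeD1[OF tw\<Phi>] px by metis
    moreover have "((\<Phi> \<circ> \<Psi>) has_derivative (\<lambda>z. z)) (at (\<Phi> x))"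
      using U pV by (intro has_derivative_transform_within_open[OF has_derivative_ident, of V]) (auto simp: homeomorphism_def)
    ultimately have "\<Phi>' x \<circ> \<Psi>' (\<Phi> x) = (\<lambda>z. z)" by (rule has_derivative_unique)
    then show ?thesis by (simp add: fun_eq_iff)
  qed
  have "inj_on (\<Psi>' (\<Phi> x)) (coord_space S)" by (rule inj_on_inverseI[of _ "\<Phi>' x"]) (rule inv)
  then obtain l where l: "\<And>s. s \<in> S \<Longrightarrow> l s \<in> coord_space S"
    "\<And>s t. s \<in> S \<Longrightarrow> t \<in> S \<Longrightarrow> \<Psi>' (\<Phi> x) (l s) \<bullet> \<Psi>' (\<Phi> x) (l t) = (if s = t then 1 else 0)"
    "\<And>z. z \<in> coord_space S \<Longrightarrow> z = (\<Sum>s\<in>S. (\<Psi>' (\<Phi> x) (l s) \<bullet> \<Psi>' (\<Phi> x) z) *\<^sub>R l s)"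
    by (rule orthonormal_frame_exists[OF twice_derivative_linear1[OF tw\<Psi>]]) blast
  have "framed_chart M x U V \<Phi> \<Psi> S \<Psi>' \<Psi>'' l"
    by unfold_locales (fact closed x U img tw\<Psi> lip l)+
  then show ?thesis by (rule that)
qed

lemma submanifold_density:
  fixes M :: "(real^'n) set"
  assumes closed: "closed M" and x: "x \<in> M" and M: "smooth_submanifold m M"
  obtains S :: "'n set" where "card S = m"
    "((\<lambda>r. measure (hausdorff_on m M) (ball x r) / r ^ m) \<longlongrightarrow> disc_vol S) (at_right 0)"
    "eventually (\<lambda>r. emeasure (hausdorff_on m M) (ball x r) < \<infinity>) (at_right 0)"
proof -
  obtain U V \<Phi> \<Psi> S where chart: "slice_chart m M x U V \<Phi> \<Psi> S"
    using M x unfolding smooth_submanifold_def by blast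
  then have S: "card S = m" by (simp add: slice_chart_def)
  obtain \<Psi>' \<Psi>'' l where "framed_chart M x U V \<Phi> \<Psi> S \<Psi>' \<Psi>'' l"
    using slice_chart_framed[OF closed x chart] by metis
  then obtain \<pi> C \<epsilon> \<eta> where nf: "nearly_flat M x S \<pi> C \<epsilon> \<eta>"
    using framed_chart.nearly_flat_exists by blast
  have "eventually (\<lambda>r. emeasure (hausdorff_on m M) (ball x r) < \<infinity>) (at_right 0)"
    using nearly_flat.small_radius[OF nf zero_less_one]
    by eventually_elim (use nearly_flat.emeasure_ball_finite[OF nf] S in auto)
  then show ?thesis using that[OF S] nearly_flat.density_limit[OF nf] S by simp
qed

text \<open>
  The chart selected in the definition of \<open>laplace_beltrami\<close> is unknown, but the limit is the same
  expression in every slice chart.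
\<close>

lemma amv_limit_laplace_beltrami:
  fixes M :: "(real^'n) set"
  assumes closed: "closed M" and x: "x \<in> M" and M: "smooth_submanifold m M" and u: "Ck_on 2 UNIV u"
  shows "((\<lambda>r. amv_laplacian_r (hausdorff_on m M) r u x) \<longlongrightarrow>
    laplace_beltrami m M u x / (2 * (real m + 2))) (at_right 0)"
proof -
  have "\<exists>L. \<exists>U V \<Phi> \<Psi> S. slice_chart m M x U V \<Phi> \<Psi> S \<and> L = laplace_in_chart \<Psi> S (u \<circ> \<Psi>) (\<Phi> x)"
    using M x unfolding smooth_submanifold_def by blast
  from someI_ex[OF this] obtain U V \<Phi> \<Psi> S where chart: "slice_chart m M x U V \<Phi> \<Psi> S"
    and L: "laplace_beltrami m M u x = laplace_in_chart \<Psi> S (u \<circ> \<Psi>) (\<Phi> x)"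
    unfolding laplace_beltrami_def[symmetric] by blast
  have S: "card S = m" using chart by (simp add: slice_chart_def)
  obtain \<Psi>' \<Psi>'' l where fc: "framed_chart M x U V \<Phi> \<Psi> S \<Psi>' \<Psi>'' l"
    using slice_chart_framed[OF closed x chart] by metis
  obtain u' u'' where twu: "twice_derivative u u' u'' (\<Psi> (\<Phi> x))"
    using Ck_on_2_imp_twice_derivative[OF u open_UNIV UNIV_I] by metis
  obtain F'' where twf: "twice_derivative (u \<circ> \<Psi>) (\<lambda>w v. u' (\<Psi> w) (\<Psi>' w v)) F'' (\<Phi> x)"
    using twice_derivative_compose[OF twu framed_chart.tw[OF fc]] by metis
  obtain Du where "\<And>w. (u has_derivative Du w) (at w)"
    using u by (auto simp: numeral_2_eq_2)
  then have "continuous_on UNIV u"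
    by (meson continuous_at_imp_continuous_on has_derivative_continuous)
  from framed_chart.amv_limit_laplace[OF fc this twf] show ?thesis by (simp add: L S)
qed

section \<open>Sums of measures\<close>

lemma sets_sum_borel_measure [simp, measurable_cong]: "sets (sum_borel_measure I N) = sets borel"
  by (simp add: sum_borel_measure_def sets.sigma_sets_eq[of borel, simplified])

lemma space_sum_borel_measure [simp]: "space (sum_borel_measure I N) = UNIV"
  by (simp add: sum_borel_measure_def)

lemma nn_integral_sum_borel_measure:
  fixes N :: "'i \<Rightarrow> 'a::topological_space measure" and f :: "'a \<Rightarrow> ennreal"
  assumes N: "\<And>i. i \<in> I \<Longrightarrow> sets (N i) = sets borel" and f: "f \<in> borel_measurable borel"
  shows "integral\<^sup>N (sum_borel_measure I N) f = (\<Sum>i\<in>I. integral\<^sup>N (N i) f)"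
  using f
proof (induction rule: borel_measurable_induct)
  case (cong f g)
  then have "f = g" by auto
  then show ?case using cong by simp
next
  case (set A)
  then show ?case using N by (simp add: emeasure_sum_borel_measure)
next
  case (mult v c)
  have "v \<in> borel_measurable (N i)" if "i \<in> I" for i using mult measurable_cong_sets[OF N[OF that] refl] by blast
  then show ?case using mult by (simp add: nn_integral_cmult sum_distrib_left)
next
  case (add v w)
  have "v \<in> borel_measurable (N i)" "w \<in> borel_measurable (N i)" if "i \<in> I" for i
    using add measurable_cong_sets[OF N[OF that] refl] by blast+
  then show ?case using add by (simp add: nn_integral_add sum.distrib)
next
  case (seq W)
  have Wm: "W n \<in> borel_measurable (N i)" if "i \<in> I" for n i
    using seq.hyps(1) measurable_cong_sets[OF N[OF that] refl] by blast
  have lim: "(\<lambda>n. W n z) \<longlonglongrightarrow> (SUP i. W i) z" for z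
    using LIMSEQ_SUP[of "\<lambda>n. W n z"] \<open>incseq W\<close> by (simp add: image_comp incseq_def le_fun_def)
  have a: "(\<lambda>n. integral\<^sup>N (sum_borel_measure I N) (W n)) \<longlonglongrightarrow> integral\<^sup>N (sum_borel_measure I N) (SUP i. W i)"
    using seq.hyps(1) by (intro nn_integral_LIMSEQ[OF \<open>incseq W\<close>] lim) simp
  have b: "(\<lambda>n. \<Sum>i\<in>I. integral\<^sup>N (N i) (W n)) \<longlonglongrightarrow> (\<Sum>i\<in>I. integral\<^sup>N (N i) (SUP i. W i))"
    by (intro tendsto_sum nn_integral_LIMSEQ[OF \<open>incseq W\<close>] lim Wm)
  show ?case by (rule LIMSEQ_unique[OF a]) (use b in \<open>simp only: seq.IH\<close>)
qed

lemma integral_sum_borel_measure: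
  fixes N :: "'i \<Rightarrow> 'a::topological_space measure" and f :: "'a \<Rightarrow> real"
  assumes fin: "finite I" and N: "\<And>i. i \<in> I \<Longrightarrow> sets (N i) = sets borel" and f: "integrable (sum_borel_measure I N) f"
  shows "\<And>i. i \<in> I \<Longrightarrow> integrable (N i) f"
    and "integral\<^sup>L (sum_borel_measure I N) f = (\<Sum>i\<in>I. integral\<^sup>L (N i) f)"
proof -
  have fm: "f \<in> borel_measurable borel" using borel_measurable_integrable[OF f] by simp
  have nn: "integral\<^sup>N (sum_borel_measure I N) (\<lambda>z. ennreal (g z)) = (\<Sum>i\<in>I. integral\<^sup>N (N i) (\<lambda>z. ennreal (g z)))"
    if "g \<in> borel_measurable borel" for g :: "'a \<Rightarrow> real"
    using that by (intro nn_integral_sum_borel_measure N) auto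
  have "(\<Sum>i\<in>I. integral\<^sup>N (N i) (\<lambda>z. ennreal (norm (f z)))) < \<infinity>"
    using f nn[of "\<lambda>z. norm (f z)"] fm by (simp add: integrable_iff_bounded)
  then have "integral\<^sup>N (N i) (\<lambda>z. ennreal (norm (f z))) < \<infinity>" if "i \<in> I" for i
    using that fin by simp
  moreover have "f \<in> borel_measurable (N i)" if "i \<in> I" for i
    using fm measurable_cong_sets[OF N[OF that] refl] by blast
  ultimately show int: "integrable (N i) f" if "i \<in> I" for i
    using that by (simp add: integrable_iff_bounded)
  have "integral\<^sup>N (N i) (\<lambda>z. ennreal (f z)) < \<infinity>" "integral\<^sup>N (N i) (\<lambda>z. ennreal (- f z)) < \<infinity>" if "i \<in> I" for i
    using int[OF that] unfolding real_integrable_def by (auto simp: less_top)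
  then show "integral\<^sup>L (sum_borel_measure I N) f = (\<Sum>i\<in>I. integral\<^sup>L (N i) f)"
    using fm int by (simp add: real_lebesgue_integral_def[OF f] real_lebesgue_integral_def nn enn2real_sum sum_subtractf)
qed

lemma set_integral_null:
  fixes f :: "'a \<Rightarrow> real"
  assumes "emeasure N A = 0" "A \<in> sets N"
  shows "(LINT y:A|N. f y) = 0"
proof -
  have "AE y in N. indicator A y *\<^sub>R f y = 0"
    by (rule AE_I[of _ _ A]) (use assms in \<open>auto simp: indicator_def\<close>)
  then show ?thesis unfolding set_lebesgue_integral_def by (rule integral_eq_zero_AE)
qed

section \<open>Averaging over the components of lowest dimension\<close>

text \<open>
  The set \<open>A\<close> collects the components through \<open>x\<close> and \<open>B\<close> those of the lowest dimension \<open>m0\<close>.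
  The mean value quantity of the sum is the average of those of the \<open>N j\<close> with weights
  \<open>measure (N j) (ball x r)\<close>.  After division by \<open>r ^ m0\<close> the weight of \<open>N j\<close> is \<open>\<kappa> j * r ^ (m j - m0)\<close>
  up to a factor tending to \<open>1\<close>; the power of \<open>r\<close> is shifted to the mean value quantity, which is
  why it appears in the hypothesis with limit \<open>R\<close>.
\<close>

lemma amv_sum_tendsto:
  fixes N :: "'i \<Rightarrow> (real^'n) measure" and u :: "real^'n \<Rightarrow> real" and m :: "'i \<Rightarrow> nat" and \<kappa> R :: "'i \<Rightarrow> real"
  assumes fin: "finite I" and N: "\<And>j. j \<in> I \<Longrightarrow> sets (N j) = sets borel"
    and u: "locally_integrable (sum_borel_measure I N) u"
    and AI: "A \<subseteq> I"
    and null: "\<And>j. j \<in> I - A \<Longrightarrow> eventually (\<lambda>r. emeasure (N j) (ball x r) = 0) (at_right 0)"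
    and dens: "\<And>j. j \<in> A \<Longrightarrow> ((\<lambda>r. measure (N j) (ball x r) / r ^ m j) \<longlongrightarrow> \<kappa> j) (at_right 0)"
    and \<kappa>: "\<And>j. j \<in> A \<Longrightarrow> 0 < \<kappa> j"
    and finite_ball: "\<And>j. j \<in> A \<Longrightarrow> eventually (\<lambda>r. emeasure (N j) (ball x r) < \<infinity>) (at_right 0)"
    and m0: "\<And>j. j \<in> A \<Longrightarrow> m0 \<le> m j"
    and lim: "\<And>j. j \<in> A \<Longrightarrow> ((\<lambda>r. r ^ (m j - m0) * amv_laplacian_r (N j) r u x) \<longlongrightarrow> R j) (at_right 0)"
    and R: "\<And>j. j \<in> A \<Longrightarrow> m0 < m j \<Longrightarrow> R j = 0"
    and B: "B = {j\<in>A. m j = m0}" "B \<noteq> {}"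
  shows "((\<lambda>r. amv_laplacian_r (sum_borel_measure I N) r u x) \<longlongrightarrow> (\<Sum>j\<in>B. \<kappa> j * R j) / (\<Sum>j\<in>B. \<kappa> j)) (at_right 0)"
proof -
  let ?\<mu> = "sum_borel_measure I N"
  have finA: "finite A" using AI fin by (rule finite_subset)
  have BA: "B \<subseteq> A" using B by auto
  define W where "W j r = measure (N j) (ball x r) / r ^ m j" for j r
  define D where "D r = (\<Sum>j\<in>A. W j r * r ^ (m j - m0))" for r
  have pw: "((\<lambda>r. r ^ (m j - m0)) \<longlongrightarrow> (if j \<in> B then 1 else 0)) (at_right (0::real))" if "j \<in> A" for j
    using that m0[OF that] B by (intro tendsto_at_right_continuous continuous_intros) (auto simp: power_0_left)
  have "(D \<longlongrightarrow> (\<Sum>j\<in>A. \<kappa> j * (if j \<in> B then 1 else 0))) (at_right 0)"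
    unfolding D_def[abs_def] W_def by (intro tendsto_sum tendsto_mult dens pw)
  moreover have "(\<Sum>j\<in>A. \<kappa> j * (if j \<in> B then 1 else 0)) = (\<Sum>j\<in>B. \<kappa> j)"
    using BA finA by (intro sum.mono_neutral_cong_right) auto
  ultimately have limD: "(D \<longlongrightarrow> (\<Sum>j\<in>B. \<kappa> j)) (at_right 0)" by simp
  have pos: "0 < (\<Sum>j\<in>B. \<kappa> j)"
    using B BA \<kappa> finite_subset[OF BA finA] by (intro sum_pos) auto
  have "((\<lambda>r. (\<Sum>j\<in>A. W j r * (r ^ (m j - m0) * amv_laplacian_r (N j) r u x)) / D r)
      \<longlongrightarrow> (\<Sum>j\<in>A. \<kappa> j * R j) / (\<Sum>j\<in>B. \<kappa> j)) (at_right 0)"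
    unfolding W_def using pos limD by (intro tendsto_divide tendsto_sum tendsto_mult dens lim) auto
  moreover have "(\<Sum>j\<in>A. \<kappa> j * R j) = (\<Sum>j\<in>B. \<kappa> j * R j)"
  proof (rule sum.mono_neutral_right[OF finA BA])
    show "\<forall>j\<in>A - B. \<kappa> j * R j = 0" using R m0 B by fastforce
  qed
  moreover have "eventually (\<lambda>r. (\<Sum>j\<in>A. W j r * (r ^ (m j - m0) * amv_laplacian_r (N j) r u x)) / D r
      = amv_laplacian_r ?\<mu> r u x) (at_right 0)"
  proof -
    have "eventually (\<lambda>r. \<forall>j\<in>I - A. emeasure (N j) (ball x r) = 0) (at_right 0)"
      using fin null by (intro eventually_ball_finite) auto
    moreover have "eventually (\<lambda>r. \<forall>j\<in>A. emeasure (N j) (ball x r) < \<infinity>) (at_right 0)"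
      using finA finite_ball by (intro eventually_ball_finite) auto
    moreover have "eventually (\<lambda>r. \<forall>j\<in>A. 0 < W j r) (at_right 0)"
      using finA \<kappa> unfolding W_def by (intro eventually_ball_finite ballI order_tendstoD(1)[OF dens]) auto
    moreover have "eventually (\<lambda>r::real. 0 < r) (at_right 0)" by (simp add: eventually_at_right_less)
    ultimately show ?thesis
    proof eventually_elim
      case (elim r)
      have bsets: "ball x r \<in> sets (N j)" if "j \<in> I" for j using N[OF that] by simp
      have em: "emeasure ?\<mu> (ball x r) = (\<Sum>j\<in>A. emeasure (N j) (ball x r))"
        using elim(1) AI fin by (subst emeasure_sum_borel_measure) (auto simp: N intro!: sum.mono_neutral_right)
      then have fin\<mu>: "emeasure ?\<mu> (ball x r) < \<infinity>" using elim(2) finA by simp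
      have meas: "measure ?\<mu> (ball x r) = (\<Sum>j\<in>A. measure (N j) (ball x r))"
        using elim(2) unfolding measure_def em by (subst enn2real_sum) auto
      have intu: "set_integrable ?\<mu> (ball x r) u"
      proof (rule set_integrable_subset)
        show "set_integrable ?\<mu> (cball x r) u" using u by (simp add: locally_integrable_def)
      qed auto
      have intc: "set_integrable ?\<mu> (ball x r) (\<lambda>y. u x)"
        by (rule set_integrable_continuous_bounded) (use fin\<mu> in auto)
      have "integrable ?\<mu> (\<lambda>y. indicator (ball x r) y *\<^sub>R (u y - u x))"
        using set_integral_diff(1)[OF intu intc] by (simp add: set_integrable_def)
      then have "(LINT y:ball x r|?\<mu>. u y - u x) = (\<Sum>j\<in>I. LINT y:ball x r|N j. u y - u x)"
        unfolding set_lebesgue_integral_def by (intro integral_sum_borel_measure(2)[OF fin]) (use N in simp_all)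
      also have "\<dots> = (\<Sum>j\<in>A. LINT y:ball x r|N j. u y - u x)"
        using elim(1) AI fin bsets by (intro sum.mono_neutral_right) (auto intro!: set_integral_null)
      finally have int: "(LINT y:ball x r|?\<mu>. u y - u x) = (\<Sum>j\<in>A. LINT y:ball x r|N j. u y - u x)" .
      have mj: "measure (N j) (ball x r) = r ^ m0 * (W j r * r ^ (m j - m0))" if "j \<in> A" for j
      proof -
        have "r ^ m j = r ^ m0 * r ^ (m j - m0)" using m0[OF that] by (simp add: power_add[symmetric])
        then show ?thesis using elim(4) by (simp add: W_def)
      qed
      have lj: "(LINT y:ball x r|N j. u y - u x)
          = r\<^sup>2 * r ^ m0 * (W j r * (r ^ (m j - m0) * amv_laplacian_r (N j) r u x))" if "j \<in> A" for j
      proof -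
        have "0 < W j r" using elim(3) that by blast
        then have "measure (N j) (ball x r) \<noteq> 0" by (auto simp: W_def)
        then have "(LINT y:ball x r|N j. u y - u x) = r\<^sup>2 * (measure (N j) (ball x r) * amv_laplacian_r (N j) r u x)"
          using elim(4) by (simp add: amv_laplacian_r_def)
        also have "\<dots> = r\<^sup>2 * r ^ m0 * (W j r * (r ^ (m j - m0) * amv_laplacian_r (N j) r u x))"
          unfolding mj[OF that] by simp
        finally show ?thesis .
      qed
      have "measure ?\<mu> (ball x r) = r ^ m0 * D r"
        by (simp add: meas mj D_def sum_distrib_left)
      moreover have "(LINT y:ball x r|?\<mu>. u y - u x)
          = r\<^sup>2 * r ^ m0 * (\<Sum>j\<in>A. W j r * (r ^ (m j - m0) * amv_laplacian_r (N j) r u x))"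
        by (simp add: int lj sum_distrib_left)
      ultimately show ?case using elim(4) by (simp add: amv_laplacian_r_def)
    qed
  qed
  ultimately show ?thesis by (auto elim: Lim_transform_eventually)
qed

lemma amv_laplacianI:
  assumes "((\<lambda>r. amv_laplacian_r \<nu> r u x) \<longlongrightarrow> L) (at_right 0)"
  shows "amv_laplacian_exists \<nu> u x" "amv_laplacian \<nu> u x = L"
  using assms by (auto simp: amv_laplacian_exists_def amv_laplacian_def intro!: tendsto_Lim)

lemma amv_laplacian_tendsto:
  assumes "amv_laplacian_exists \<nu> u x"
  shows "((\<lambda>r. amv_laplacian_r \<nu> r u x) \<longlongrightarrow> amv_laplacian \<nu> u x) (at_right 0)"
  using assms amv_laplacianI(2) unfolding amv_laplacian_exists_def by metis

theorem corollary3p7: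
  fixes k l t :: nat
    and m J :: "nat \<Rightarrow> nat"
    and M :: "nat \<Rightarrow> (real^'n) set"
    and \<mu> :: "(real^'n) measure"
    and u :: "real^'n \<Rightarrow> real"
    and x :: "real^'n"
  assumes m_mono: "mono_on {1..k} m"
    and submanifold: "\<And>j. j \<in> {1..k} \<Longrightarrow> smooth_submanifold (m j) (M j)"
    and closed: "\<And>j. j \<in> {1..k} \<Longrightarrow> closed (M j)"
    and \<mu>: "\<mu> = sum_borel_measure {1..k} (\<lambda>j. hausdorff_on (m j) (M j))"
    and u_L1loc: "locally_integrable \<mu> u"
    and u_repr: "precise_representative \<mu> u"
    and J_mono: "strict_mono_on {1..l} J"
    and J_indices: "J ` {1..l} = {j \<in> {1..k}. x \<in> M j}"
    and t: "1 \<le> t" "t \<le> l"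
    and m_eq: "\<And>i. i \<in> {1..t} \<Longrightarrow> m (J i) = m (J 1)"
    and m_less: "t < l \<Longrightarrow> m (J t) < m (J (t + 1))"
  shows "((\<forall>i\<in>{1..t}. amv_laplacian_exists (hausdorff_on (m (J i)) (M (J i))) u x) \<and>
          (\<forall>i\<in>{t+1..l}.
             ((\<lambda>r. r ^ (m (J i) - m (J 1)) * \<bar>amv_laplacian_r (hausdorff_on (m (J i)) (M (J i))) r u x\<bar>)
                \<longlongrightarrow> 0) (at_right 0))
          \<longrightarrow>
          amv_laplacian_exists \<mu> u x \<and>
          amv_laplacian \<mu> u x =
            1 / real t * (\<Sum>i=1..t. amv_laplacian (hausdorff_on (m (J i)) (M (J i))) u x))
       \<and> (Ck_on 2 UNIV u
          \<longrightarrow>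
          amv_laplacian_exists \<mu> u x \<and>
          amv_laplacian \<mu> u x =
            1 / (2 * (real (m (J 1)) + 2) * real t) *
            (\<Sum>i=1..t. laplace_beltrami (m (J i)) (M (J i)) u x))"
proof -
  let ?N = "\<lambda>j. hausdorff_on (m j) (M j)"
  let ?A = "J ` {1..l}" and ?B = "J ` {1..t}"
  have Jk: "J i \<in> {1..k}" "x \<in> M (J i)" if "i \<in> {1..l}" for i using J_indices that by blast+
  have injJ: "inj_on J {1..l}" using J_mono by (rule strict_mono_on_imp_inj_on)
  then have injJt: "inj_on J {1..t}" by (rule inj_on_subset) (use t in auto)
  have J_le: "J i \<le> J i'" if "i \<in> {1..l}" "i' \<in> {1..l}" "i \<le> i'" for i i'
    using J_mono that by (metis strict_mono_onD nat_less_le order_refl)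
  have mJ_le: "m (J i) \<le> m (J i')" if "i \<in> {1..l}" "i' \<in> {1..l}" "i \<le> i'" for i i'
    using m_mono Jk(1) J_le that by (meson mono_onD)
  have mJ_gt: "m (J 1) < m (J i)" if "i \<in> {t+1..l}" for i
  proof -
    have "m (J 1) = m (J t)" using m_eq[of t] t by simp
    also have "\<dots> < m (J (t + 1))" using m_less that by simp
    also have "\<dots> \<le> m (J i)" using that by (intro mJ_le) auto
    finally show ?thesis .
  qed
  have B_eq: "?B = {j\<in>?A. m j = m (J 1)}"
  proof (intro set_eqI iffI)
    fix j assume "j \<in> {j\<in>?A. m j = m (J 1)}"
    then obtain i where i: "i \<in> {1..l}" "j = J i" "m (J i) = m (J 1)" by auto
    then have "i \<in> {1..t}" using mJ_gt[of i] by (cases "i \<le> t") auto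
    then show "j \<in> ?B" using i by blast
  next
    fix j assume "j \<in> ?B"
    then obtain i where i: "i \<in> {1..t}" "j = J i" by blast
    then have "i \<in> {1..l}" using t by simp
    then show "j \<in> {j\<in>?A. m j = m (J 1)}" using i m_eq[OF i(1)] by blast
  qed
  have "\<exists>S :: 'n set. card S = m j \<and>
      ((\<lambda>r. measure (?N j) (ball x r) / r ^ m j) \<longlongrightarrow> disc_vol S) (at_right 0) \<and>
      eventually (\<lambda>r. emeasure (?N j) (ball x r) < \<infinity>) (at_right 0)" if "j \<in> ?A" for j
  proof -
    have "j \<in> {j \<in> {1..k}. x \<in> M j}" using that unfolding J_indices .
    then have j: "j \<in> {1..k}" "x \<in> M j" by simp_all
    show ?thesis by (rule submanifold_density[OF closed[OF j(1)] j(2) submanifold[OF j(1)]]) blast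
  qed
  then have "\<exists>S :: nat \<Rightarrow> 'n set. \<forall>j\<in>?A. card (S j) = m j \<and>
      ((\<lambda>r. measure (?N j) (ball x r) / r ^ m j) \<longlongrightarrow> disc_vol (S j)) (at_right 0) \<and>
      eventually (\<lambda>r. emeasure (?N j) (ball x r) < \<infinity>) (at_right 0)"
    by (intro bchoice ballI)
  then obtain S :: "nat \<Rightarrow> 'n set" where S: "\<And>j. j \<in> ?A \<Longrightarrow> card (S j) = m j"
    "\<And>j. j \<in> ?A \<Longrightarrow> ((\<lambda>r. measure (?N j) (ball x r) / r ^ m j) \<longlongrightarrow> disc_vol (S j)) (at_right 0)"
    "\<And>j. j \<in> ?A \<Longrightarrow> eventually (\<lambda>r. emeasure (?N j) (ball x r) < \<infinity>) (at_right 0)"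
    by blast
  have null: "eventually (\<lambda>r. emeasure (?N j) (ball x r) = 0) (at_right 0)" if "j \<in> {1..k} - ?A" for j
  proof -
    have "j \<in> {1..k} - {j \<in> {1..k}. x \<in> M j}" using that unfolding J_indices .
    then have j: "j \<in> {1..k}" "x \<notin> M j" by simp_all
    then have "open (- M j)" "x \<in> - M j" using closed by auto
    then obtain d where d: "0 < d" "ball x d \<subseteq> - M j" using open_contains_ball by blast
    show ?thesis
    proof (rule eventually_at_rightI[OF _ d(1)])
      fix r assume "r \<in> {0<..<d}"
      then have "M j \<inter> ball x r = {}" using d(2) subset_ball[of r d x] by auto
      then show "emeasure (?N j) (ball x r) = 0" using closed[OF j(1)] by (simp add: emeasure_hausdorff_on)
    qed
  qed
  define \<kappa> where "\<kappa> = disc_vol (S (J 1))"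
  have \<kappa>: "0 < \<kappa>" by (simp add: \<kappa>_def disc_vol_pos)
  have \<kappa>_eq: "disc_vol (S (J i)) = \<kappa>" if "i \<in> {1..t}" for i
    unfolding \<kappa>_def using S(1)[of "J i"] S(1)[of "J 1"] that t m_eq[OF that]
    by (intro disc_vol_cong_card) auto
  \<comment> \<open>both claims are instances of the weighted average, with limits \<open>L\<close> on the components of lowest dimension\<close>
  have average: "((\<lambda>r. amv_laplacian_r \<mu> r u x) \<longlongrightarrow> 1 / real t * (\<Sum>i=1..t. L i)) (at_right 0)"
    if L: "\<And>i. i \<in> {1..t} \<Longrightarrow> ((\<lambda>r. amv_laplacian_r (?N (J i)) r u x) \<longlongrightarrow> L i) (at_right 0)"
      and high: "\<And>i. i \<in> {t+1..l} \<Longrightarrow> ((\<lambda>r. r ^ (m (J i) - m (J 1)) * amv_laplacian_r (?N (J i)) r u x) \<longlongrightarrow> 0) (at_right 0)"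
    for L
  proof -
    define R where "R j = (if j \<in> ?B then L (the_inv_into {1..t} J j) else 0)" for j
    have RJ: "R (J i) = L i" if "i \<in> {1..t}" for i
      using the_inv_into_f_f[OF injJt that] that by (simp add: R_def del: One_nat_def)
    have "((\<lambda>r. amv_laplacian_r \<mu> r u x) \<longlongrightarrow> (\<Sum>j\<in>?B. disc_vol (S j) * R j) / (\<Sum>j\<in>?B. disc_vol (S j))) (at_right 0)"
      unfolding \<mu>
    proof (rule amv_sum_tendsto[where A="?A" and m=m and ?m0.0="m (J 1)"])
      show "locally_integrable (sum_borel_measure {1..k} ?N) u" using u_L1loc \<mu> by simp
      show "?A \<subseteq> {1..k}" unfolding J_indices by blast
      show "m (J 1) \<le> m j" if "j \<in> ?A" for j using that t mJ_le[of 1] by auto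
      show "((\<lambda>r. r ^ (m j - m (J 1)) * amv_laplacian_r (?N j) r u x) \<longlongrightarrow> R j) (at_right 0)" if jA: "j \<in> ?A" for j
      proof -
        obtain i where i: "i \<in> {1..l}" "j = J i" using jA by blast
        show ?thesis
        proof (cases "i \<le> t")
          case True
          then show ?thesis using i L[of i] RJ[of i] m_eq[of i] by simp
        next
          case False
          then have it: "i \<in> {t+1..l}" using i by simp
          then have "j \<notin> ?B" using B_eq mJ_gt[OF it] i by auto
          then show ?thesis using high[OF it] i by (simp add: R_def)
        qed
      qed
      show "R j = 0" if "j \<in> ?A" "m (J 1) < m j" for j using that B_eq by (auto simp: R_def)
      show "?B \<noteq> {}" using t by auto
    qed (use S null B_eq disc_vol_pos in auto)
    also have "(\<Sum>j\<in>?B. disc_vol (S j) * R j) / (\<Sum>j\<in>?B. disc_vol (S j)) = 1 / real t * (\<Sum>i=1..t. L i)"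
    proof -
      have "(\<Sum>j\<in>?B. disc_vol (S j) * R j) = \<kappa> * (\<Sum>i=1..t. L i)"
        unfolding sum.reindex[OF injJt] o_def sum_distrib_left by (intro sum.cong refl) (simp only: RJ \<kappa>_eq)
      moreover have "(\<Sum>j\<in>?B. disc_vol (S j)) = (\<Sum>i=1..t. \<kappa>)"
        unfolding sum.reindex[OF injJt] o_def by (intro sum.cong refl) (simp only: \<kappa>_eq)
      ultimately show ?thesis using \<kappa> by simp
    qed
    finally show ?thesis .
  qed
  show ?thesis
  proof (rule conjI; rule impI)
    assume hyp: "(\<forall>i\<in>{1..t}. amv_laplacian_exists (?N (J i)) u x) \<and>
        (\<forall>i\<in>{t+1..l}. ((\<lambda>r. r ^ (m (J i) - m (J 1)) * \<bar>amv_laplacian_r (?N (J i)) r u x\<bar>) \<longlongrightarrow> 0) (at_right 0))"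
    then have ex: "\<forall>i\<in>{1..t}. amv_laplacian_exists (?N (J i)) u x"
      and high: "\<forall>i\<in>{t+1..l}. ((\<lambda>r. r ^ (m (J i) - m (J 1)) * \<bar>amv_laplacian_r (?N (J i)) r u x\<bar>) \<longlongrightarrow> 0) (at_right 0)"
      by blast+
    have "((\<lambda>r. r ^ (m (J i) - m (J 1)) * amv_laplacian_r (?N (J i)) r u x) \<longlongrightarrow> 0) (at_right 0)" if "i \<in> {t+1..l}" for i
    proof (rule Lim_null_comparison)
      show "((\<lambda>r. r ^ (m (J i) - m (J 1)) * \<bar>amv_laplacian_r (?N (J i)) r u x\<bar>) \<longlongrightarrow> 0) (at_right 0)"
        using high that by blast
      show "eventually (\<lambda>r. norm (r ^ (m (J i) - m (J 1)) * amv_laplacian_r (?N (J i)) r u x)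
          \<le> r ^ (m (J i) - m (J 1)) * \<bar>amv_laplacian_r (?N (J i)) r u x\<bar>) (at_right 0)"
        using eventually_at_right_less[of "0::real"] by eventually_elim (simp add: abs_mult)
    qed
    with ex have "((\<lambda>r. amv_laplacian_r \<mu> r u x) \<longlongrightarrow>
        1 / real t * (\<Sum>i=1..t. amv_laplacian (?N (J i)) u x)) (at_right 0)"
      by (intro average amv_laplacian_tendsto) auto
    from amv_laplacianI[OF this] show "amv_laplacian_exists \<mu> u x \<and>
      amv_laplacian \<mu> u x = 1 / real t * (\<Sum>i=1..t. amv_laplacian (?N (J i)) u x)" by blast
  next
    assume C2: "Ck_on 2 UNIV u"
    have lap: "((\<lambda>r. amv_laplacian_r (?N (J i)) r u x) \<longlongrightarrow>
        laplace_beltrami (m (J i)) (M (J i)) u x / (2 * (real (m (J i)) + 2))) (at_right 0)" if "i \<in> {1..l}" for i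
      using Jk[OF that] by (intro amv_limit_laplace_beltrami closed submanifold C2)
    have "((\<lambda>r. r ^ (m (J i) - m (J 1)) * amv_laplacian_r (?N (J i)) r u x) \<longlongrightarrow> 0) (at_right 0)" if "i \<in> {t+1..l}" for i
    proof -
      have "((\<lambda>r::real. r ^ (m (J i) - m (J 1))) \<longlongrightarrow> 0) (at_right 0)"
        using mJ_gt[OF that] by (intro tendsto_at_right_continuous continuous_intros) (simp add: power_0_left)
      from tendsto_mult[OF this lap[of i]] that show ?thesis by simp
    qed
    then have "((\<lambda>r. amv_laplacian_r \<mu> r u x) \<longlongrightarrow>
        1 / real t * (\<Sum>i=1..t. laplace_beltrami (m (J i)) (M (J i)) u x / (2 * (real (m (J i)) + 2)))) (at_right 0)"
      using t by (intro average lap) auto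
    moreover have "1 / real t * (\<Sum>i=1..t. laplace_beltrami (m (J i)) (M (J i)) u x / (2 * (real (m (J i)) + 2)))
        = 1 / (2 * (real (m (J 1)) + 2) * real t) * (\<Sum>i=1..t. laplace_beltrami (m (J i)) (M (J i)) u x)"
    proof -
      have "(\<Sum>i=1..t. laplace_beltrami (m (J i)) (M (J i)) u x / (2 * (real (m (J i)) + 2)))
          = (\<Sum>i=1..t. laplace_beltrami (m (J i)) (M (J i)) u x) / (2 * (real (m (J 1)) + 2))"
        unfolding sum_divide_distrib
      proof (intro sum.cong refl)
        fix i assume "i \<in> {1..t}"
        from m_eq[OF this] show "laplace_beltrami (m (J i)) (M (J i)) u x / (2 * (real (m (J i)) + 2))
            = laplace_beltrami (m (J i)) (M (J i)) u x / (2 * (real (m (J 1)) + 2))"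
          by (simp only:)
      qed
      then show ?thesis by simp
    qed
    ultimately have "((\<lambda>r. amv_laplacian_r \<mu> r u x) \<longlongrightarrow>
        1 / (2 * (real (m (J 1)) + 2) * real t) * (\<Sum>i=1..t. laplace_beltrami (m (J i)) (M (J i)) u x)) (at_right 0)"
      by simp
    from amv_laplacianI[OF this] show "amv_laplacian_exists \<mu> u x \<and>
      amv_laplacian \<mu> u x = 1 / (2 * (real (m (J 1)) + 2) * real t) * (\<Sum>i=1..t. laplace_beltrami (m (J i)) (M (J i)) u x)"
      by blast
  qed
qed

end
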